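(* Let $(X,d,\mu)$ be a space of homogeneous type, $\mathcal D$ a dyadic lattice of $X$, $\gamma>0$, $0<q<\infty$, $1\le p_0<p_i<\infty$ for $i=1,\dots,m$, and $\eta:=\sum_{i=1}^m\frac1{p_i}-\frac1q\in[0,m)$. Let $u,\sigma_1,\dots,\sigma_m$ be weights with $\|u,\vec\sigma\|_{A^\star_{\vec p/p_0,q/p_0}(X)}<\infty$ and $u,\sigma_i\in A_\infty(X)$ for $i=1,\dots,m$, and let $\omega_i=\sigma_i^{1-p_i/p_0}$ (equivalently $\sigma_i=\omega_i^{1-(p_i/p_0)'}$). If $\gamma\ge p_0$, then $$\sup_{\mathcal S\subseteq\mathcal D}\|\mathcal A_{\eta,\mathcal S,p_0,\gamma}\|_{L^{p_1}(X,\omega_1)\times\cdots\times L^{p_m}(X,\omega_m)\to L^q(X,u)}\lesssim\|u,\vec\sigma\|_{A^\star_{\vec p/p_0,q/p_0}(X)}^{\frac1q}\Big(\prod_{i=1}^m[\sigma_i]_{A_\infty(X)}^{\frac1{p_i}}+[u]_{A_\infty(X)}^{(\frac1\gamma-\frac1q)_+}\sum_{j=1}^m\prod_{i\ne j}[\sigma_i]_{A_\infty(X)}^{\frac1{p_i}}\Big),$$ where the supremum is over sparse families $\mathcal S\subseteq\mathcal D$ and $(\frac1\gamma-\frac1q)_+=\max\{\frac1\gamma-\frac1q,0\}$. If $0<\gamma<p_0$, then the same estimate still holds for all $q>\gamma$.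
   Context: **Space.** $(X,d,\mu)$ is a space of homogeneous type: $d$ is a quasi-metric on the non-empty set $X$ (symmetric, $d(x,x)=0$, $d(x,y)\le A_0(d(x,z)+d(z,y))$ with $A_0\ge1$), and $\mu$ is a regular measure on the $\sigma$-algebra generated by open sets and quasi-metric balls with $0<\mu(B(x,2r))\le C_\mu\,\mu(B(x,r))<\infty$ for all balls. **Dyadic lattices.** A dyadic lattice is a countable family $\mathcal D=\bigcup_{k\in\mathbb Z}\mathcal D_k$, $\mathcal D_k=\{Q^k_\alpha\}_\alpha$, with parameters $\delta_0\in(0,1)$, $0<a_1\le A_1<\infty$, such that: for each $k$, $X$ is the disjoint union of the cubes of $\mathcal D_k$; if $l\ge k$ then $Q^l_\beta\subseteq Q^k_\alpha$ or $Q^l_\beta\cap Q^k_\alpha=\emptyset$; for $l\le k$ each $Q^k_\alpha$ is contained in a unique $Q^l_\beta$; each $Q^k_\alpha$ is the union of at most $M$ cubes of $\mathcal D_{k+1}$; $B(x^k_\alpha,a_1\delta_0^k)\subseteq Q^k_\alpha\subseteq B(x^k_\alpha,A_1\delta_0^k)=:B(Q^k_\alpha)$; and $B(Q^l_\beta)\subseteq B(Q^k_\alpha)$ whenever $l\ge k$, $Q^l_\beta\subseteq Q^k_\alpha$. $\mathcal S\subseteq\mathcal D$ is sparse ($\delta$-sparse, for a fixed $\delta\in(0,1)$) if for each $Q\in\mathcal S$ there is a measurable $E_Q\subseteq Q$ with $\mu(E_Q)\ge\delta\mu(Q)$ and the sets $E_Q$ are pairwise disjoint. **Weights.** A weight is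 a locally integrable $\omega$ with $0<\omega<\infty$ a.e.; $\omega(E)=\int_E\omega\,d\mu$; $L^p(X,\omega)$ is $L^p$ with respect to $\omega\,d\mu$. $\langle g\rangle_Q=\mu(Q)^{-1}\int_Qg\,d\mu$; $s'=s/(s-1)$. For exponents $\vec s=(s_1,\dots,s_m)$, $s_i>1$, and $t>0$, $$\|u,\vec\sigma\|_{A^\star_{\vec s,t}(X)}=\sup_{Q\in\mathcal D}\langle u\rangle_Q\prod_{i=1}^m\langle\sigma_i\rangle_Q^{t/s_i'};$$ here it is used with $\vec s=\vec p/p_0=(p_1/p_0,\dots,p_m/p_0)$, $t=q/p_0$. The $A_\infty$ constant is the Fujii–Wilson one, $[\omega]_{A_\infty(X)}=\sup_Q\omega(Q)^{-1}\int_QM(\omega\chi_Q)\,d\mu$, with $M$ the Hardy–Littlewood maximal operator. **Sparse operator.** With $\langle f\rangle_{Q,p_0}=\langle|f|^{p_0}\rangle_Q^{1/p_0}$, $$\mathcal A_{\eta,\mathcal S,p_0,\gamma}(\vec f)(x)=\Big(\sum_{Q\in\mathcal S}\Big[\mu(Q)^\eta\prod_{i=1}^m\langle f_i\rangle_{Q,p_0}\Big]^\gamma\chi_Q(x)\Big)^{1/\gamma}.$$ The operator norm is the least $C$ with $\|\mathcal A(\vec f)\|_{L^q(X,u)}\le C\prod_i\|f_i\|_{L^{p_i}(X,\omega_i)}$ for all $\vec f$. $A\lesssim B$ means $A\le CB$ with $C$ independent of the weights and of $\mathcal S$ (it may depend on $m$, the exponents, $\delta$ and $X$). *)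

theory Defs
  imports "HOL-Analysis.Analysis"
begin

section \<open>Spaces of homogeneous type\<close>

text \<open>The underlying set \<open>X\<close> is always \<^term>\<open>space M\<close>; the values of \<open>d\<close> outside it are
  irrelevant.\<close>

definition qball :: "'a measure \<Rightarrow> ('a \<Rightarrow> 'a \<Rightarrow> real) \<Rightarrow> 'a \<Rightarrow> real \<Rightarrow> 'a set" where
  "qball M d x r = {y \<in> space M. d x y < r}"

definition quasi_metric_on :: "'a set \<Rightarrow> ('a \<Rightarrow> 'a \<Rightarrow> real) \<Rightarrow> real \<Rightarrow> bool" where
  "quasi_metric_on X d A\<^sub>0 \<longleftrightarrow>
     (\<forall>x\<in>X. \<forall>y\<in>X. 0 \<le> d x y \<and> d x y = d y x) \<and>
     (\<forall>x\<in>X. d x x = 0) \<and>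
     1 \<le> A\<^sub>0 \<and>
     (\<forall>x\<in>X. \<forall>y\<in>X. \<forall>z\<in>X. d x y \<le> A\<^sub>0 * (d x z + d z y))"

text \<open>Balls of a quasi-metric need not be open in this topology, which is why they are added to
  the generators of the \<open>\<sigma>\<close>-algebra below.\<close>

definition qtopology :: "'a measure \<Rightarrow> ('a \<Rightarrow> 'a \<Rightarrow> real) \<Rightarrow> 'a topology" where
  "qtopology M d = topology (\<lambda>U. U \<subseteq> space M \<and> (\<forall>x\<in>U. \<exists>r>0. qball M d x r \<subseteq> U))"

lemma openin_qtopology:
  "openin (qtopology M d) U \<longleftrightarrow> U \<subseteq> space M \<and> (\<forall>x\<in>U. \<exists>r>0. qball M d x r \<subseteq> U)"
proof -
  have "istopology (\<lambda>U. U \<subseteq> space M \<and> (\<forall>x\<in>U. \<exists>r>0. qball M d x r \<subseteq> U))"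
    unfolding istopology_def
  proof (intro conjI allI impI)
    fix S T
    assume S: "S \<subseteq> space M \<and> (\<forall>x\<in>S. \<exists>r>0. qball M d x r \<subseteq> S)"
      and T: "T \<subseteq> space M \<and> (\<forall>x\<in>T. \<exists>r>0. qball M d x r \<subseteq> T)"
    show "S \<inter> T \<subseteq> space M" using S by blast
    show "\<forall>x\<in>S \<inter> T. \<exists>r>0. qball M d x r \<subseteq> S \<inter> T"
    proof
      fix x assume x: "x \<in> S \<inter> T"
      obtain r s where "r > 0" "s > 0" "qball M d x r \<subseteq> S" "qball M d x s \<subseteq> T"
        using S T x by blast
      then have "min r s > 0" "qball M d x (min r s) \<subseteq> S \<inter> T"
        by (auto simp: qball_def)
      then show "\<exists>r>0. qball M d x r \<subseteq> S \<inter> T" by blast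
    qed
  next
    fix K :: "'a set set"
    assume K: "\<forall>U\<in>K. U \<subseteq> space M \<and> (\<forall>x\<in>U. \<exists>r>0. qball M d x r \<subseteq> U)"
    show "\<Union>K \<subseteq> space M" using K by blast
    show "\<forall>x\<in>\<Union>K. \<exists>r>0. qball M d x r \<subseteq> \<Union>K" using K by (meson Sup_upper UnionE order_trans)
  qed
  then show ?thesis
    unfolding qtopology_def by (simp add: topology_inverse')
qed

text \<open>As \<open>d\<close> is not assumed to separate points, compact sets need not be measurable; hence the
  restriction to measurable ones.\<close>

definition regular_measure :: "'a measure \<Rightarrow> 'a topology \<Rightarrow> bool" where
  "regular_measure M T \<longleftrightarrow>
     (\<forall>E\<in>sets M.
        emeasure M E = (INF U\<in>{U. openin T U \<and> E \<subseteq> U}. emeasure M U) \<and>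
        emeasure M E = (SUP K\<in>{K \<in> sets M. compactin T K \<and> K \<subseteq> E}. emeasure M K))"

definition homogeneous_type :: "'a measure \<Rightarrow> ('a \<Rightarrow> 'a \<Rightarrow> real) \<Rightarrow> real \<Rightarrow> real \<Rightarrow> bool" where
  "homogeneous_type M d A\<^sub>0 C\<^sub>\<mu> \<longleftrightarrow>
     space M \<noteq> {} \<and>
     quasi_metric_on (space M) d A\<^sub>0 \<and>
     sets M = sigma_sets (space M)
       ({U. openin (qtopology M d) U} \<union> {qball M d x r | x r. x \<in> space M \<and> 0 < r}) \<and>
     regular_measure M (qtopology M d) \<and>
     (\<forall>x\<in>space M. \<forall>r>0.
        0 < emeasure M (qball M d x (2 * r)) \<and>
        emeasure M (qball M d x (2 * r)) \<le> ennreal C\<^sub>\<mu> * emeasure M (qball M d x r) \<and>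
        ennreal C\<^sub>\<mu> * emeasure M (qball M d x r) < \<infinity>)"


section \<open>Dyadic lattices and sparse families\<close>

text \<open>\<open>D k\<close> is the generation \<open>\<D>\<^sub>k\<close>, as a set of sets. One set may be a cube of several
  generations, so the centre \<open>c k Q\<close>, and with it the ball \<open>B(Q)\<close>, depends on \<open>k\<close> as well.\<close>

definition dyadic_lattice ::
  "'a measure \<Rightarrow> ('a \<Rightarrow> 'a \<Rightarrow> real) \<Rightarrow> real \<Rightarrow> real \<Rightarrow> real \<Rightarrow> (int \<Rightarrow> 'a set set) \<Rightarrow> bool" where
  "dyadic_lattice M d \<delta>\<^sub>0 a\<^sub>1 A\<^sub>1 D \<longleftrightarrow>
     0 < \<delta>\<^sub>0 \<and> \<delta>\<^sub>0 < 1 \<and> 0 < a\<^sub>1 \<and> a\<^sub>1 \<le> A\<^sub>1 \<and>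
     (\<forall>k. countable (D k) \<and> D k \<subseteq> sets M) \<and>
     (\<forall>k. \<Union>(D k) = space M \<and> disjoint (D k)) \<and>
     (\<forall>k l. k \<le> l \<longrightarrow> (\<forall>Q\<in>D k. \<forall>R\<in>D l. R \<subseteq> Q \<or> R \<inter> Q = {})) \<and>
     (\<forall>k l. l \<le> k \<longrightarrow> (\<forall>Q\<in>D k. \<exists>!R. R \<in> D l \<and> Q \<subseteq> R)) \<and>
     (\<exists>N::nat. \<forall>k. \<forall>Q\<in>D k. \<exists>F\<subseteq>D (k + 1). finite F \<and> card F \<le> N \<and> Q = \<Union>F) \<and>
     (\<exists>c. (\<forall>k. \<forall>Q\<in>D k. c k Q \<in> space M \<and>
              qball M d (c k Q) (a\<^sub>1 * \<delta>\<^sub>0 powi k) \<subseteq> Q \<and>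
              Q \<subseteq> qball M d (c k Q) (A\<^sub>1 * \<delta>\<^sub>0 powi k)) \<and>
          (\<forall>k l. k \<le> l \<longrightarrow> (\<forall>Q\<in>D k. \<forall>R\<in>D l. R \<subseteq> Q \<longrightarrow>
              qball M d (c l R) (A\<^sub>1 * \<delta>\<^sub>0 powi l) \<subseteq> qball M d (c k Q) (A\<^sub>1 * \<delta>\<^sub>0 powi k))))"

definition cubes :: "(int \<Rightarrow> 'a set set) \<Rightarrow> 'a set set" where
  "cubes D = (\<Union>k. D k)"

definition sparse_family :: "'a measure \<Rightarrow> real \<Rightarrow> 'a set set \<Rightarrow> bool" where
  "sparse_family M \<delta> S \<longleftrightarrow>
     (\<exists>E. (\<forall>Q\<in>S. E Q \<in> sets M \<and> E Q \<subseteq> Q \<and> ennreal \<delta> * emeasure M Q \<le> emeasure M (E Q)) \<and>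
          disjoint_family_on E S)"


section \<open>Powers and averages of extended nonnegative functions\<close>

text \<open>Only meant for exponents \<open>a \<ge> 0\<close>. The case \<open>a = 0\<close> is separate because \<^term>\<open>0 powr 0 = (0::real)\<close>
  in the library.\<close>

definition epowr :: "ennreal \<Rightarrow> real \<Rightarrow> ennreal"  (infixr "powr\<^sub>\<infinity>" 80) where
  "x powr\<^sub>\<infinity> a = (if a = 0 then 1 else if x = \<infinity> then \<infinity> else ennreal (enn2real x powr a))"

definition avg :: "'a measure \<Rightarrow> ('a \<Rightarrow> ennreal) \<Rightarrow> 'a set \<Rightarrow> ennreal" where
  "avg M g Q = (\<integral>\<^sup>+x\<in>Q. g x \<partial>M) / emeasure M Q"


section \<open>Weights\<close>

definition weight :: "'a measure \<Rightarrow> ('a \<Rightarrow> 'a \<Rightarrow> real) \<Rightarrow> ('a \<Rightarrow> real) \<Rightarrow> bool" where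
  "weight M d w \<longleftrightarrow>
     w \<in> borel_measurable M \<and> (AE x in M. 0 < w x) \<and>
     (\<forall>x\<in>space M. \<forall>r>0. set_integrable M (qball M d x r) w)"

text \<open>The measure \<open>w d\<mu>\<close>.\<close>

definition wmeasure :: "'a measure \<Rightarrow> ('a \<Rightarrow> real) \<Rightarrow> 'a measure" where
  "wmeasure M w = density M (\<lambda>x. ennreal (w x))"

definition Lp_norm :: "'a measure \<Rightarrow> real \<Rightarrow> ('a \<Rightarrow> ennreal) \<Rightarrow> ennreal" where
  "Lp_norm N p g = (\<integral>\<^sup>+x. g x powr\<^sub>\<infinity> p \<partial>N) powr\<^sub>\<infinity> (1 / p)"

definition Lp_space :: "'a measure \<Rightarrow> real \<Rightarrow> ('a \<Rightarrow> complex) set" where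
  "Lp_space N p = {f \<in> borel_measurable N. Lp_norm N p (\<lambda>x. ennreal (norm (f x))) < \<infinity>}"

definition conj_exponent :: "real \<Rightarrow> real" where
  "conj_exponent s = s / (s - 1)"

definition A_star :: "'a measure \<Rightarrow> (int \<Rightarrow> 'a set set) \<Rightarrow> nat \<Rightarrow> (nat \<Rightarrow> real) \<Rightarrow> real \<Rightarrow>
    ('a \<Rightarrow> real) \<Rightarrow> (nat \<Rightarrow> 'a \<Rightarrow> real) \<Rightarrow> ennreal" where
  "A_star M D m s t u \<sigma> =
     (SUP Q\<in>cubes D. avg M (\<lambda>x. ennreal (u x)) Q *
        (\<Prod>i=1..m. avg M (\<lambda>x. ennreal (\<sigma> i x)) Q powr\<^sub>\<infinity> (t / conj_exponent (s i))))"

text \<open>The uncentred Hardy--Littlewood maximal operator over quasi-metric balls.\<close>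

definition HL_maximal ::
  "'a measure \<Rightarrow> ('a \<Rightarrow> 'a \<Rightarrow> real) \<Rightarrow> ('a \<Rightarrow> real) \<Rightarrow> 'a \<Rightarrow> ennreal" where
  "HL_maximal M d f x =
     (SUP B\<in>{qball M d z r | z r. z \<in> space M \<and> 0 < r \<and> x \<in> qball M d z r}.
        avg M (\<lambda>y. ennreal \<bar>f y\<bar>) B)"

text \<open>Fujii--Wilson constant. Since balls need not be open, the maximal function may fail to be
  measurable; \<^const>\<open>nn_integral\<close> is then its lower integral.\<close>

definition A_infty_const ::
  "'a measure \<Rightarrow> ('a \<Rightarrow> 'a \<Rightarrow> real) \<Rightarrow> (int \<Rightarrow> 'a set set) \<Rightarrow> ('a \<Rightarrow> real) \<Rightarrow> ennreal" where
  "A_infty_const M d D w =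
     (SUP Q\<in>cubes D. (\<integral>\<^sup>+x\<in>Q. HL_maximal M d (\<lambda>y. w y * indicator Q y) x \<partial>M) /
        emeasure (wmeasure M w) Q)"

definition A_infty ::
  "'a measure \<Rightarrow> ('a \<Rightarrow> 'a \<Rightarrow> real) \<Rightarrow> (int \<Rightarrow> 'a set set) \<Rightarrow> ('a \<Rightarrow> real) set" where
  "A_infty M d D = {w. weight M d w \<and> A_infty_const M d D w < \<infinity>}"


section \<open>The sparse operator\<close>

definition sparse_op :: "'a measure \<Rightarrow> nat \<Rightarrow> real \<Rightarrow> 'a set set \<Rightarrow> real \<Rightarrow> real \<Rightarrow>
    (nat \<Rightarrow> 'a \<Rightarrow> complex) \<Rightarrow> 'a \<Rightarrow> ennreal" where
  "sparse_op M m \<eta> S p\<^sub>0 \<gamma> f x =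
     (\<Sum>\<^sub>\<infinity>Q\<in>S.
        (emeasure M Q powr\<^sub>\<infinity> \<eta> *
         (\<Prod>i=1..m. avg M (\<lambda>y. ennreal (norm (f i y)) powr\<^sub>\<infinity> p\<^sub>0) Q powr\<^sub>\<infinity> (1 / p\<^sub>0))) powr\<^sub>\<infinity> \<gamma> *
        indicator Q x) powr\<^sub>\<infinity> (1 / \<gamma>)"

text \<open>The least \<open>C\<close> bounding \<open>T\<close> from the product of the spaces \<open>L\<^sup>p\<close> with exponents \<open>p i\<close> and
  weights \<open>\<omega> i\<close> into \<open>L\<^sup>q\<close> with weight \<open>u\<close>; it is \<open>\<infinity>\<close> if \<open>T\<close> is unbounded.\<close>

definition op_norm :: "'a measure \<Rightarrow> nat \<Rightarrow> (nat \<Rightarrow> real) \<Rightarrow> real \<Rightarrow> (nat \<Rightarrow> 'a \<Rightarrow> real) \<Rightarrow>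
    ('a \<Rightarrow> real) \<Rightarrow> ((nat \<Rightarrow> 'a \<Rightarrow> complex) \<Rightarrow> 'a \<Rightarrow> ennreal) \<Rightarrow> ennreal" where
  "op_norm M m p q \<omega> u T =
     Inf {C. \<forall>f. (\<forall>i\<in>{1..m}. f i \<in> Lp_space (wmeasure M (\<omega> i)) (p i)) \<longrightarrow>
            Lp_norm (wmeasure M u) q (T f) \<le>
              C * (\<Prod>i=1..m. Lp_norm (wmeasure M (\<omega> i)) (p i) (\<lambda>x. ennreal (norm (f i x))))}"

end

theory Submission
  imports Defs
begin

text \<open>
  Write \<open>|f\<^sub>i| ^ p\<^sub>0 = g\<^sub>i \<sigma>\<^sub>i\<close> and \<open>s\<^sub>i = p\<^sub>i / p\<^sub>0\<close>, \<open>r = \<gamma> / p\<^sub>0\<close>, \<open>t = q / p\<^sub>0\<close>. The claim becomes a bound for the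
  norm in \<open>L ^ (t / r)\<close> with weight \<open>u\<close> of \<open>\<Phi> = \<Sum>\<^sub>Q c\<^sub>Q \<chi>\<^sub>Q\<close>, where \<open>c\<^sub>Q\<close> is the \<open>r\<close>-th power of a power of
  \<open>\<mu>(Q)\<close> times the product of the averages of \<open>g\<^sub>i \<sigma>\<^sub>i\<close>, by the norms of the \<open>g\<^sub>i\<close> in \<open>L ^ s\<^sub>i\<close> with weight \<open>\<sigma>\<^sub>i\<close>.
  By monotone convergence the family \<open>S\<close> may be taken finite. Averages of \<open>g\<^sub>i \<sigma>\<^sub>i\<close> with respect to \<open>\<mu>\<close>
  are products of the average of \<open>\<sigma>\<^sub>i\<close> and the \<open>\<sigma>\<^sub>i\<close>-average of \<open>g\<^sub>i\<close>.

  Two tools carry the proof. The first is Hoelder's inequality for sums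
  \<open>\<Sum>\<^sub>Q \<Prod>\<^sub>i y\<^sub>i(Q) ^ e\<^sub>i \<le> \<Prod>\<^sub>i (\<Sum>\<^sub>Q y\<^sub>i(Q)) ^ e\<^sub>i\<close>, valid as soon as \<open>\<Sum>\<^sub>i e\<^sub>i \<ge> 1\<close>
  (\<open>sum_prod_powr_le\<close>); the condition \<open>\<eta> \<ge> 0\<close> says exactly that the exponents are large enough.
  The second is a stopping time without recursion: give \<open>Q\<close> the label \<open>\<lfloor>log 2 a\<rfloor>\<close>, where \<open>a\<close> is the
  largest average of \<open>g\<close> over a member of \<open>S\<close> containing \<open>Q\<close>, and call \<open>F\<close> principal if no proper
  superset has its label. For every \<open>s > 1\<close> the sum of \<open>2 ^ (s label(F)) v(F)\<close> over principal \<open>F\<close> is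
  at most a constant times \<open>\<integral> g ^ s dv\<close> (\<open>principal_powr_le\<close>), and the same sum over all of \<open>S\<close>
  costs one more factor, the Carleson constant of \<open>v\<close> along \<open>S\<close> (\<open>sum_le_sum_principal\<close>), which is
  at most a constant times the Fujii--Wilson constant of \<open>v\<close> (\<open>carleson_A_infty\<close>).

  If \<open>q \<le> \<gamma>\<close>, then \<open>\<Phi> ^ (t / r)\<close> is at most the sum of the \<open>c\<^sub>Q ^ (t / r) \<chi>\<^sub>Q\<close>, and the two tools together with
  the definition of the two-weight constant give the first term of the claim (\<open>sparse_estimate_low\<close>).

  If \<open>q > \<gamma>\<close>, put \<open>h = \<Phi> ^ (t / r - 1)\<close>. Then \<open>\<integral> \<Phi> ^ (t / r) u = \<Sum>\<^sub>Q c\<^sub>Q \<integral>\<^sub>Q h u\<close> is an \<open>(m + 1)\<close>-linear expression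
  in which \<open>h\<close> with \<open>v\<^sub>0 = u\<close> plays the same part as the \<open>g\<^sub>i\<close> with \<open>v\<^sub>i = \<sigma>\<^sub>i\<close>. Its coefficients are
  \<open>X\<^sub>Q \<Prod>\<^sub>i v\<^sub>i(Q) ^ \<theta>\<^sub>i\<close> with \<open>\<Sum>\<^sub>i \<theta>\<^sub>i \<ge> 1\<close>, where \<open>X\<^sub>Q\<close> is a product of powers of averages of the \<open>v\<^sub>i\<close>, bounded by a
  power of the two-weight constant. The plain argument would cost the \<open>A\<^sub>\<infinity>\<close> constants of all \<open>m + 1\<close>
  weights; the theorem asserts that one of them can be saved. To see this, split \<open>S\<close> according to the
  dyadic size of \<open>X\<^sub>Q\<close>; the bounds for the pieces form a geometric series. Where \<open>X\<^sub>Q\<close> is almost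
  constant, powers of it may be inserted freely, and they lower the exponents \<open>\<theta>\<^sub>i\<close> of the averages so
  that Kolmogorov's inequality applies: the products \<open>\<Prod>\<^sub>i v\<^sub>i(Q) ^ \<theta>\<^sub>i\<close> satisfy a Carleson condition with
  a constant independent of the weights (\<open>products_carleson_on_level\<close>). Finally, every \<open>Q\<close> lies in a set \<open>F\<close>
  that has the same \<open>m + 1\<close> labels as \<open>Q\<close> and is principal for some index \<open>j\<close>
  (\<open>exists_common_principal\<close>). Summing first over \<open>Q \<subseteq> F\<close> and then over the sets principal for \<open>j\<close>
  uses the Carleson constants of all weights except the \<open>j\<close>-th. The index of \<open>h\<close> produces the
  first term of the claim, the other indices produce the sum that contains the constant of \<open>u\<close>.
  As \<open>\<integral> h ^ (t / (t - r)) u = \<integral> \<Phi> ^ (t / r) u\<close>, a power of the left-hand side can be divided out at the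
  end (\<open>sparse_estimate_high\<close>).
\<close>

section \<open>Sums of powers\<close>

lemma sum_powr_above:
  fixes a y :: real and K :: "int set"
  assumes "finite K" "0 < a" "0 < y" "\<And>k. k \<in> K \<Longrightarrow> y \<le> 2 powr k"
  shows "(\<Sum>k\<in>K. 2 powr (- a * k)) \<le> y powr (- a) / (1 - 2 powr (- a))"
proof (cases "K = {}")
  case True
  have "2 powr (- a) < (1::real)" using assms(2) by (simp add: powr_less_one)
  then show ?thesis using True assms(3) by simp
next
  case False
  define n where "n = Min K"
  define x :: real where "x = 2 powr (- a)"
  have x: "0 < x" "x < 1"
    using assms(2) unfolding x_def by (auto simp: powr_less_one)
  have n: "n \<in> K" "\<And>k. k \<in> K \<Longrightarrow> n \<le> k"
    using assms(1) False by (auto simp: n_def)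
  define f where "f = (\<lambda>k. nat (k - n))"
  have inj: "inj_on f K"
  proof (rule inj_onI)
    fix k l assume "k \<in> K" "l \<in> K" "f k = f l"
    then show "k = l" using n(2)[of k] n(2)[of l] by (simp add: f_def)
  qed
  have "(\<Sum>k\<in>K. 2 powr (- a * k)) = (\<Sum>k\<in>K. 2 powr (- a * n) * x ^ f k)"
  proof (rule sum.cong[OF refl])
    fix k assume "k \<in> K"
    then have k: "real_of_int k = n + real (f k)" using n(2) by (simp add: f_def)
    have "x ^ f k = 2 powr (- a * real (f k))"
      by (simp add: x_def powr_realpow[symmetric] powr_powr)
    then show "2 powr (- a * k) = 2 powr (- a * n) * x ^ f k"
      unfolding k by (simp add: powr_add[symmetric] algebra_simps)
  qed
  also have "\<dots> = 2 powr (- a * n) * (\<Sum>j\<in>f ` K. x ^ j)"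
    by (simp add: sum_distrib_left sum.reindex[OF inj])
  also have "\<dots> \<le> 2 powr (- a * n) * (1 / (1 - x))"
  proof (rule mult_left_mono)
    have "(\<Sum>j\<in>f ` K. x ^ j) \<le> (\<Sum>j. x ^ j)"
      by (rule sum_le_suminf) (use x assms(1) in \<open>auto intro!: summable_geometric\<close>)
    also have "\<dots> = 1 / (1 - x)" using x by (intro suminf_geometric) auto
    finally show "(\<Sum>j\<in>f ` K. x ^ j) \<le> 1 / (1 - x)" .
  qed simp
  also have "\<dots> \<le> y powr (- a) * (1 / (1 - x))"
  proof (rule mult_right_mono)
    have "2 powr (- a * n) = (2 powr n) powr (- a)" by (simp add: powr_powr mult.commute)
    also have "\<dots> \<le> y powr (- a)"
      using assms(2,3) assms(4)[OF n(1)] by (intro powr_mono2') auto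
    finally show "2 powr (- a * n) \<le> y powr (- a)" .
  qed (use x in simp)
  finally show ?thesis by (simp add: x_def)
qed

lemma sum_powr_below:
  fixes a y :: real and K :: "int set"
  assumes "finite K" "0 < a" "0 < y" "\<And>k. k \<in> K \<Longrightarrow> 2 powr k \<le> y"
  shows "(\<Sum>k\<in>K. 2 powr (a * k)) \<le> y powr a / (1 - 2 powr (- a))"
proof -
  have "(\<Sum>k\<in>K. 2 powr (a * k)) = (\<Sum>k\<in>uminus ` K. 2 powr (- a * k))"
    by (simp add: sum.reindex)
  also have "\<dots> \<le> (1 / y) powr (- a) / (1 - 2 powr (- a))"
    using assms by (intro sum_powr_above) (auto simp: powr_minus divide_simps)
  also have "(1 / y) powr (- a) = y powr a"
    using assms(3) by (simp add: powr_minus powr_divide)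
  finally show ?thesis .
qed

lemma prod_powr_le_weighted_sum:
  fixes z e :: "'i \<Rightarrow> real"
  assumes I: "finite I" "\<And>i. i \<in> I \<Longrightarrow> 0 \<le> z i" "\<And>i. i \<in> I \<Longrightarrow> 0 < e i" "sum e I = 1"
  shows "(\<Prod>i\<in>I. z i powr e i) \<le> (\<Sum>i\<in>I. e i * z i)"
proof (cases "\<exists>i\<in>I. z i = 0")
  case True
  then have "(\<Prod>i\<in>I. z i powr e i) = 0" using I(1) by auto
  moreover have "(\<Sum>i\<in>I. e i * z i) \<ge> 0"
    using I by (intro sum_nonneg) (auto simp: less_imp_le)
  ultimately show ?thesis by simp
next
  case False
  then have z: "z i > 0" if "i \<in> I" for i using I(2)[OF that] that by force
  have ne: "I \<noteq> {}" using I(4) by auto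
  have pos: "(\<Sum>i\<in>I. e i * z i) > 0" using I(1,3) z ne by (intro sum_pos) auto
  have "(\<Sum>i\<in>I. e i * ln (z i)) \<le> ln (\<Sum>i\<in>I. e i *\<^sub>R z i)"
    using I z ne by (intro concave_on_sum[OF _ _ ln_concave]) (auto simp: less_imp_le)
  then have "exp (\<Sum>i\<in>I. e i * ln (z i)) \<le> (\<Sum>i\<in>I. e i * z i)"
    using pos by (simp add: ln_ge_iff)
  also have "exp (\<Sum>i\<in>I. e i * ln (z i)) = (\<Prod>i\<in>I. z i powr e i)"
    unfolding exp_sum[OF I(1)] by (intro prod.cong refl) (use z in \<open>force simp: powr_def\<close>)
  finally show ?thesis .
qed

text \<open>After dividing each factor by its sum over \<open>A\<close>, all quantities lie in \<open>[0, 1]\<close>, so lowering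
  the exponents to total \<open>1\<close> only increases the product and the weighted arithmetic--geometric mean
  inequality applies.\<close>

lemma sum_prod_powr_le:
  fixes y :: "'i \<Rightarrow> 'b \<Rightarrow> real" and e :: "'i \<Rightarrow> real"
  assumes fin: "finite I" "finite A"
    and y: "\<And>i x. i \<in> I \<Longrightarrow> x \<in> A \<Longrightarrow> 0 \<le> y i x"
    and e: "\<And>i. i \<in> I \<Longrightarrow> 0 < e i" "1 \<le> sum e I"
  shows "(\<Sum>x\<in>A. \<Prod>i\<in>I. y i x powr e i) \<le> (\<Prod>i\<in>I. (\<Sum>x\<in>A. y i x) powr e i)"
proof (cases "\<exists>i\<in>I. (\<Sum>x\<in>A. y i x) = 0")
  case True
  then obtain i where i: "i \<in> I" "(\<Sum>x\<in>A. y i x) = 0" by blast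
  then have "y i x = 0" if "x \<in> A" for x
    using that y fin(2) sum_nonneg_eq_0_iff[of A "y i"] by auto
  then have "(\<Prod>i\<in>I. y i x powr e i) = 0" if "x \<in> A" for x
    using that i(1) fin(1) by auto
  then show ?thesis by (simp add: prod_nonneg)
next
  case False
  define Y where "Y i = (\<Sum>x\<in>A. y i x)" for i
  define E where "E = sum e I"
  have E: "1 \<le> E" using e(2) by (simp add: E_def)
  have Y: "Y i > 0" if "i \<in> I" for i
    using False that y sum_nonneg[of A "y i"] unfolding Y_def by force
  have le: "(\<Prod>i\<in>I. y i x powr e i) \<le> (\<Prod>i\<in>I. Y i powr e i) * (\<Sum>i\<in>I. e i / E * (y i x / Y i))"
    if x: "x \<in> A" for x
  proof -
    have z: "0 \<le> y i x / Y i" "y i x / Y i \<le> 1" if "i \<in> I" for i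
    proof -
      have "y i x \<le> Y i" unfolding Y_def using x y that fin(2)
        by (intro member_le_sum) auto
      then show "0 \<le> y i x / Y i" "y i x / Y i \<le> 1" using Y[OF that] y[OF that x] by auto
    qed
    have "(\<Prod>i\<in>I. y i x powr e i) = (\<Prod>i\<in>I. Y i powr e i) * (\<Prod>i\<in>I. (y i x / Y i) powr e i)"
      unfolding prod.distrib[symmetric]
    proof (rule prod.cong[OF refl])
      fix i assume i: "i \<in> I"
      show "y i x powr e i = Y i powr e i * (y i x / Y i) powr e i"
        using Y[OF i] y[OF i x] by (simp add: powr_divide)
    qed
    also have "\<dots> \<le> (\<Prod>i\<in>I. Y i powr e i) * (\<Prod>i\<in>I. (y i x / Y i) powr (e i / E))"
    proof (intro mult_left_mono prod_mono conjI)
      fix i assume i: "i \<in> I"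
      have "e i / E \<le> e i" using E e(1)[OF i] by (simp add: divide_le_eq)
      then show "(y i x / Y i) powr e i \<le> (y i x / Y i) powr (e i / E)"
        using z[OF i] powr_mono'[of "e i / E" "e i" "y i x / Y i"] by simp
    qed (auto simp: prod_nonneg)
    also have "\<dots> \<le> (\<Prod>i\<in>I. Y i powr e i) * (\<Sum>i\<in>I. e i / E * (y i x / Y i))"
      using E e(1) z(1) fin(1)
      by (intro mult_left_mono prod_powr_le_weighted_sum)
         (auto simp: prod_nonneg E_def sum_divide_distrib[symmetric])
    finally show ?thesis .
  qed
  have "(\<Sum>x\<in>A. \<Prod>i\<in>I. y i x powr e i) \<le>
      (\<Sum>x\<in>A. (\<Prod>i\<in>I. Y i powr e i) * (\<Sum>i\<in>I. e i / E * (y i x / Y i)))"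
    by (rule sum_mono[OF le])
  also have "\<dots> = (\<Prod>i\<in>I. Y i powr e i) * (\<Sum>i\<in>I. \<Sum>x\<in>A. e i / E * (y i x / Y i))"
    by (simp add: sum_distrib_left[symmetric] sum.swap[of _ A])
  also have "(\<Sum>i\<in>I. \<Sum>x\<in>A. e i / E * (y i x / Y i)) = (\<Sum>i\<in>I. e i / E)"
  proof (rule sum.cong[OF refl])
    fix i assume i: "i \<in> I"
    have "(\<Sum>x\<in>A. e i / E * (y i x / Y i)) = e i / E * (Y i / Y i)"
      by (simp add: Y_def sum_distrib_left[symmetric] sum_divide_distrib[symmetric])
    then show "(\<Sum>x\<in>A. e i / E * (y i x / Y i)) = e i / E" using Y[OF i] by simp
  qed
  also have "\<dots> = 1" using E by (simp add: sum_divide_distrib[symmetric] E_def[symmetric])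
  finally show ?thesis by (simp add: Y_def)
qed

section \<open>Laminar families and principal sets\<close>

definition laminar :: "'a set set \<Rightarrow> bool" where
  "laminar S \<longleftrightarrow> (\<forall>Q\<in>S. \<forall>R\<in>S. Q \<subseteq> R \<or> R \<subseteq> Q \<or> Q \<inter> R = {})"

text \<open>The Carleson condition for the coefficients \<open>c\<close> relative to the set function \<open>V\<close>, tested only
  on members of \<open>S\<close>.\<close>

definition carleson :: "'a set set \<Rightarrow> ('a set \<Rightarrow> real) \<Rightarrow> real \<Rightarrow> ('a set \<Rightarrow> real) \<Rightarrow> bool" where
  "carleson S c \<Lambda> V \<longleftrightarrow> (\<forall>Q\<in>S. (\<Sum>R\<in>{R\<in>S. R \<subseteq> Q}. c R) \<le> \<Lambda> * V Q)"

definition superadditive :: "'a set set \<Rightarrow> ('a set \<Rightarrow> real) \<Rightarrow> bool" where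
  "superadditive S V \<longleftrightarrow>
     (\<forall>Q\<in>S. \<forall>P. P \<subseteq> S \<longrightarrow> disjoint P \<longrightarrow> (\<forall>R\<in>P. R \<subseteq> Q) \<longrightarrow> sum V P \<le> V Q)"

definition decreasing_labels :: "'a set set \<Rightarrow> ('a set \<Rightarrow> int) \<Rightarrow> bool" where
  "decreasing_labels S l \<longleftrightarrow> (\<forall>Q\<in>S. \<forall>R\<in>S. Q \<subseteq> R \<longrightarrow> l R \<le> l Q)"

definition principal_sets :: "'a set set \<Rightarrow> ('a set \<Rightarrow> int) \<Rightarrow> 'a set set" where
  "principal_sets S l = {F\<in>S. \<forall>R\<in>S. F \<subset> R \<longrightarrow> l R \<noteq> l F}"

definition run_max :: "'a set set \<Rightarrow> ('a set \<Rightarrow> real) \<Rightarrow> 'a set \<Rightarrow> real" where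
  "run_max S a Q = Max (a ` {R\<in>S. Q \<subseteq> R})"

definition dyadic_level :: "'a set set \<Rightarrow> ('a set \<Rightarrow> real) \<Rightarrow> 'a set \<Rightarrow> int" where
  "dyadic_level S a Q = \<lfloor>log 2 (run_max S a Q)\<rfloor>"

lemma laminar_subset: "laminar S \<Longrightarrow> T \<subseteq> S \<Longrightarrow> laminar T"
  unfolding laminar_def by blast

lemma superadditive_subset: "superadditive S V \<Longrightarrow> T \<subseteq> S \<Longrightarrow> superadditive T V"
  unfolding superadditive_def by (meson order_trans subsetD)

lemma carleson_subset:
  assumes "carleson S c \<Lambda> V" "T \<subseteq> S" "finite S" "\<And>Q. Q \<in> S \<Longrightarrow> 0 \<le> c Q"
  shows "carleson T c \<Lambda> V"
  unfolding carleson_def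
proof
  fix Q assume Q: "Q \<in> T"
  have "(\<Sum>R\<in>{R\<in>T. R \<subseteq> Q}. c R) \<le> (\<Sum>R\<in>{R\<in>S. R \<subseteq> Q}. c R)"
    using assms by (intro sum_mono2) auto
  also have "\<dots> \<le> \<Lambda> * V Q" using assms(1,2) Q by (auto simp: carleson_def)
  finally show "(\<Sum>R\<in>{R\<in>T. R \<subseteq> Q}. c R) \<le> \<Lambda> * V Q" .
qed

lemma principal_subset: "principal_sets S l \<subseteq> S"
  by (auto simp: principal_sets_def)

lemma exists_principal_above:
  assumes "finite S" "Q \<in> S"
  shows "\<exists>F\<in>principal_sets S l. Q \<subseteq> F \<and> l F = l Q"
proof -
  have "finite {R\<in>S. l R = l Q}" using assms by simp
  then obtain F where F: "F \<in> S" "l F = l Q" "Q \<subseteq> F"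
    and max: "\<forall>R\<in>{R\<in>S. l R = l Q}. F \<subseteq> R \<longrightarrow> F = R"
    using finite_has_maximal2[of "{R\<in>S. l R = l Q}" Q] assms(2) by auto
  then have "F \<in> principal_sets S l" by (auto simp: principal_sets_def)
  then show ?thesis using F by blast
qed

lemma disjoint_principal_level:
  assumes "laminar S"
  shows "disjoint {F\<in>principal_sets S l. l F = k}"
  unfolding disjoint_def
proof (intro ballI impI)
  fix F G assume *: "F \<in> {F\<in>principal_sets S l. l F = k}" "G \<in> {F\<in>principal_sets S l. l F = k}" "F \<noteq> G"
  then have "\<not> F \<subseteq> G" "\<not> G \<subseteq> F" by (auto simp: principal_sets_def)
  then show "F \<inter> G = {}" using assms * by (auto simp: laminar_def principal_sets_def)
qed

lemma sum_le_sum_related: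
  fixes f :: "'b \<Rightarrow> real"
  assumes "finite S" "finite T" "\<And>x. x \<in> S \<Longrightarrow> \<exists>y\<in>T. r x y" "\<And>x. x \<in> S \<Longrightarrow> 0 \<le> f x"
  shows "sum f S \<le> (\<Sum>y\<in>T. sum f {x\<in>S. r x y})"
proof -
  obtain h where h: "\<And>x. x \<in> S \<Longrightarrow> h x \<in> T \<and> r x (h x)" using assms(3) by metis
  have "sum f S = (\<Sum>y\<in>T. sum f {x\<in>S. h x = y})"
    using assms(1,2) h by (intro sum.group[symmetric]) auto
  also have "\<dots> \<le> (\<Sum>y\<in>T. sum f {x\<in>S. r x y})"
    using assms h by (intro sum_mono sum_mono2) auto
  finally show ?thesis .
qed

text \<open>Sorting the members of \<open>S\<close> by the principal set of the same label above them, the Carleson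
  condition is used once for each principal set.\<close>

lemma sum_le_sum_principal:
  assumes fin: "finite S" and car: "carleson S c \<Lambda> V"
    and c: "\<And>Q. Q \<in> S \<Longrightarrow> 0 \<le> c Q" and w: "\<And>k. 0 \<le> w k"
  shows "(\<Sum>Q\<in>S. w (l Q) * c Q) \<le> \<Lambda> * (\<Sum>F\<in>principal_sets S l. w (l F) * V F)"
proof -
  have finP: "finite (principal_sets S l)" using fin principal_subset finite_subset by metis
  have "(\<Sum>Q\<in>S. w (l Q) * c Q) \<le>
      (\<Sum>F\<in>principal_sets S l. \<Sum>Q\<in>{Q\<in>S. Q \<subseteq> F \<and> l Q = l F}. w (l Q) * c Q)"
  proof (rule sum_le_sum_related[where r = "\<lambda>Q F. Q \<subseteq> F \<and> l Q = l F"])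
    fix Q assume "Q \<in> S"
    then show "\<exists>F\<in>principal_sets S l. Q \<subseteq> F \<and> l Q = l F"
      using exists_principal_above[OF fin, of Q l] by metis
  qed (use fin finP c w in auto)
  also have "\<dots> \<le> (\<Sum>F\<in>principal_sets S l. w (l F) * (\<Lambda> * V F))"
  proof (rule sum_mono)
    fix F assume F: "F \<in> principal_sets S l"
    have "(\<Sum>Q\<in>{Q\<in>S. Q \<subseteq> F \<and> l Q = l F}. w (l Q) * c Q) =
        w (l F) * (\<Sum>Q\<in>{Q\<in>S. Q \<subseteq> F \<and> l Q = l F}. c Q)"
      by (simp add: sum_distrib_left)
    also have "(\<Sum>Q\<in>{Q\<in>S. Q \<subseteq> F \<and> l Q = l F}. c Q) \<le> (\<Sum>Q\<in>{Q\<in>S. Q \<subseteq> F}. c Q)"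
      using fin c by (intro sum_mono2) auto
    also have "\<dots> \<le> \<Lambda> * V F" using car F principal_subset[of S l] unfolding carleson_def by blast
    finally show "(\<Sum>Q\<in>{Q\<in>S. Q \<subseteq> F \<and> l Q = l F}. w (l Q) * c Q) \<le> w (l F) * (\<Lambda> * V F)"
      using w by (simp add: mult_left_mono)
  qed
  also have "\<dots> = \<Lambda> * (\<Sum>F\<in>principal_sets S l. w (l F) * V F)"
    by (simp add: sum_distrib_left mult_ac)
  finally show ?thesis .
qed

text \<open>The smallest proper superset \<open>P\<close> of \<open>F\<close> differs from \<open>F\<close> in some label, and by monotonicity
  every larger set differs from \<open>F\<close> in that same label; so one index works for all supersets.\<close>

lemma exists_common_principal:
  assumes S: "finite S" "laminar S" "{} \<notin> S" and I: "I \<noteq> {}"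
    and l: "\<And>i. i \<in> I \<Longrightarrow> decreasing_labels S (l i)" and Q: "Q \<in> S"
  shows "\<exists>j\<in>I. \<exists>F\<in>principal_sets S (l j). Q \<subseteq> F \<and> (\<forall>i\<in>I. l i F = l i Q)"
proof -
  let ?A = "{R\<in>S. \<forall>i\<in>I. l i R = l i Q}"
  have "finite ?A" "Q \<in> ?A" using S(1) Q by auto
  then obtain F where F: "F \<in> S" "\<forall>i\<in>I. l i F = l i Q" "Q \<subseteq> F"
    and max: "\<forall>R\<in>?A. F \<subseteq> R \<longrightarrow> F = R"
    using finite_has_maximal2[of ?A Q] by auto
  show ?thesis
  proof (cases "{R\<in>S. F \<subset> R} = {}")
    case True
    then have "F \<in> principal_sets S (l j)" for j using F(1) by (auto simp: principal_sets_def)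
    then show ?thesis using F I by blast
  next
    case False
    have "finite {R\<in>S. F \<subset> R}" using S(1) by simp
    from finite_has_minimal[OF this False]
    obtain P where P': "P \<in> {R\<in>S. F \<subset> R}" and min: "\<forall>R\<in>{R\<in>S. F \<subset> R}. R \<subseteq> P \<longrightarrow> P = R"
      by (elim bexE)
    then have P: "P \<in> S" "F \<subset> P" by simp_all
    have "\<exists>j\<in>I. l j P \<noteq> l j F"
    proof (rule ccontr)
      assume "\<not> (\<exists>j\<in>I. l j P \<noteq> l j F)"
      then have "P \<in> ?A" using P(1) F(2) by simp
      then show False using max P(2) by auto
    qed
    then obtain j where j: "j \<in> I" "l j P \<noteq> l j F" by (elim bexE)
    have "l j R \<noteq> l j F" if R: "R \<in> S" "F \<subset> R" for R
    proof -
      have "F \<noteq> {}" using F(1) S(3) by metis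
      then have "R \<inter> P \<noteq> {}" using R(2) P(2) by auto
      then have "P \<subseteq> R \<or> R \<subseteq> P" using S(2) R(1) P(1) unfolding laminar_def by metis
      moreover have "R \<subseteq> P \<longrightarrow> P = R" using min R by simp
      ultimately have "P \<subseteq> R" by auto
      then have "l j R \<le> l j P" "l j P \<le> l j F"
        using l[OF j(1)] R P F(1) by (auto simp: decreasing_labels_def)
      then show ?thesis using j(2) by linarith
    qed
    then have "F \<in> principal_sets S (l j)" using F(1) by (auto simp: principal_sets_def)
    then show ?thesis using F(2,3) j(1) by (intro bexI[of _ j] bexI[of _ F]) auto
  qed
qed

section \<open>Dyadic levels of averages\<close>

context
  fixes S :: "'a set set" and a :: "'a set \<Rightarrow> real"
  assumes fin: "finite S" and pos: "\<forall>Q\<in>S. 0 < a Q"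
begin

lemma run_max_attained:
  assumes "Q \<in> S"
  obtains R where "R \<in> S" "Q \<subseteq> R" "run_max S a Q = a R"
proof -
  have "run_max S a Q \<in> a ` {R\<in>S. Q \<subseteq> R}"
    unfolding run_max_def using fin assms by (intro Max_in) auto
  then show ?thesis using that by auto
qed

lemma le_run_max: "R \<in> S \<Longrightarrow> Q \<subseteq> R \<Longrightarrow> a R \<le> run_max S a Q"
  unfolding run_max_def using fin by (intro Max_ge) auto

lemma run_max_pos: "Q \<in> S \<Longrightarrow> 0 < run_max S a Q"
  using le_run_max pos by (metis order_less_le_trans subset_refl)

lemma powr_level_le: "Q \<in> S \<Longrightarrow> 2 powr dyadic_level S a Q \<le> run_max S a Q"
  unfolding dyadic_level_def using run_max_pos[of Q] by (simp add: powr_le_iff le_log_iff[symmetric])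

lemma run_max_less: "Q \<in> S \<Longrightarrow> run_max S a Q < 2 powr (dyadic_level S a Q + 1)"
  unfolding dyadic_level_def using run_max_pos[of Q] by (simp add: log_less_iff[symmetric])

lemma average_le: "Q \<in> S \<Longrightarrow> a Q \<le> 2 powr (dyadic_level S a Q + 1)"
  using run_max_less[of Q] le_run_max[of Q Q] by simp

lemma run_max_antimono:
  assumes "Q \<in> S" "R \<in> S" "Q \<subseteq> R"
  shows "run_max S a R \<le> run_max S a Q"
proof -
  obtain T where "T \<in> S" "R \<subseteq> T" "run_max S a R = a T" using run_max_attained[OF assms(2)] .
  then show ?thesis using le_run_max[of T Q] assms(3) by auto
qed

lemma decreasing_labels_level: "decreasing_labels S (dyadic_level S a)"
  unfolding decreasing_labels_def dyadic_level_def
  using run_max_antimono run_max_pos by (auto intro!: floor_mono)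

lemma powr_level_le_average:
  assumes "F \<in> principal_sets S (dyadic_level S a)"
  shows "2 powr dyadic_level S a F \<le> a F"
proof -
  have F: "F \<in> S" and *: "\<And>R. R \<in> S \<Longrightarrow> F \<subset> R \<Longrightarrow> dyadic_level S a R \<noteq> dyadic_level S a F"
    using assms by (auto simp: principal_sets_def)
  obtain R where R: "R \<in> S" "F \<subseteq> R" "run_max S a F = a R" using run_max_attained[OF F] .
  have "run_max S a R = run_max S a F"
    using le_run_max[of R R] run_max_antimono[OF F R(1,2)] R by simp
  then have "dyadic_level S a R = dyadic_level S a F" by (simp add: dyadic_level_def)
  then have "R = F" using *[OF R(1)] R(2) by blast
  then show ?thesis using powr_level_le[OF F] R(3) by simp
qed

end

text \<open>A form of Kolmogorov's inequality for the maximal function: below \<open>Q\<close> only levels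
  at least that of \<open>Q\<close> occur, and since \<open>\<sigma> < 1\<close> their contributions decay geometrically.\<close>

lemma kolmogorov_sum:
  fixes \<mu> V :: "'a set \<Rightarrow> real"
  assumes \<sigma>: "0 < \<sigma>" "\<sigma> < 1" and S: "finite S" "laminar S"
    and pos: "\<And>Q. Q \<in> S \<Longrightarrow> 0 < \<mu> Q" "\<And>Q. Q \<in> S \<Longrightarrow> 0 < V Q"
    and \<Delta>: "0 \<le> \<Delta>" "carleson S \<mu> \<Delta> \<mu>" and V: "superadditive S V" and Q: "Q \<in> S"
  shows "(\<Sum>R\<in>{R\<in>S. R \<subseteq> Q}. \<mu> R * (V R / \<mu> R) powr \<sigma>) \<le>
    2 * \<Delta> / (1 - 2 powr (\<sigma> - 1)) * (\<mu> Q * (V Q / \<mu> Q) powr \<sigma>)"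
proof -
  define T where "T = {R\<in>S. R \<subseteq> Q}"
  define a where "a R = V R / \<mu> R" for R
  define l where "l = dyadic_level T a"
  have T: "finite T" "T \<subseteq> S" "Q \<in> T" using S(1) Q by (auto simp: T_def)
  have a: "\<forall>R\<in>T. 0 < a R" using pos T(2) by (auto simp: a_def)
  have lam: "laminar T" using laminar_subset S(2) T(2) by blast
  note lev = average_le[OF T(1) a] powr_level_le_average[OF T(1) a]
    decreasing_labels_level[OF T(1) a]
  have pT: "principal_sets T l \<subseteq> T" by (rule principal_subset)
  have finP: "finite (principal_sets T l)" using pT T(1) finite_subset by blast
  have low: "a Q / 2 \<le> 2 powr l F" if "F \<in> T" for F
  proof -
    have "l Q \<le> l F"
      using lev(3) that T(3) by (auto simp: decreasing_labels_def l_def T_def)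
    then have "(2::real) powr l Q \<le> 2 powr l F" by simp
    moreover have "a Q \<le> 2 * 2 powr l Q"
      using lev(1)[OF T(3)] by (simp add: l_def powr_add)
    ultimately show ?thesis by linarith
  qed
  have "(\<Sum>R\<in>T. \<mu> R * a R powr \<sigma>) \<le> (\<Sum>R\<in>T. 2 powr \<sigma> * (2 powr (\<sigma> * l R) * \<mu> R))"
  proof (rule sum_mono)
    fix R assume R: "R \<in> T"
    have "a R powr \<sigma> \<le> (2 powr (l R + 1)) powr \<sigma>"
      using lev(1)[OF R] a R \<sigma> by (intro powr_mono2) (auto simp: l_def less_imp_le)
    also have "\<dots> = 2 powr \<sigma> * 2 powr (\<sigma> * l R)"
      by (simp add: powr_powr powr_add[symmetric] algebra_simps)
    finally show "\<mu> R * a R powr \<sigma> \<le> 2 powr \<sigma> * (2 powr (\<sigma> * l R) * \<mu> R)"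
      using pos(1)[of R] R T(2) by (auto simp: mult_left_mono mult_ac)
  qed
  also have "\<dots> = 2 powr \<sigma> * (\<Sum>R\<in>T. 2 powr (\<sigma> * l R) * \<mu> R)"
    by (simp add: sum_distrib_left)
  also have "\<dots> \<le> 2 powr \<sigma> * (\<Delta> * (\<Sum>F\<in>principal_sets T l. 2 powr (\<sigma> * l F) * \<mu> F))"
  proof (rule mult_left_mono)
    show "(\<Sum>R\<in>T. 2 powr (\<sigma> * l R) * \<mu> R) \<le> \<Delta> * (\<Sum>F\<in>principal_sets T l. 2 powr (\<sigma> * l F) * \<mu> F)"
      using T(1,2) carleson_subset[OF \<Delta>(2) T(2) S(1)] pos(1)
      by (intro sum_le_sum_principal[where w = "\<lambda>k. 2 powr (\<sigma> * k)"]) (auto simp: less_imp_le)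
  qed simp
  also have "\<dots> \<le> 2 powr \<sigma> * (\<Delta> * (V Q * ((a Q / 2) powr (\<sigma> - 1) / (1 - 2 powr (\<sigma> - 1)))))"
  proof (intro mult_left_mono)
    have "(\<Sum>F\<in>principal_sets T l. 2 powr (\<sigma> * l F) * \<mu> F) \<le>
        (\<Sum>F\<in>principal_sets T l. 2 powr (- (1 - \<sigma>) * l F) * V F)"
    proof (rule sum_mono)
      fix F assume F: "F \<in> principal_sets T l"
      have "2 powr l F * \<mu> F \<le> V F"
      proof -
        have "0 < \<mu> F" using pos(1) F pT T(2) by blast
        moreover have "2 powr l F \<le> V F / \<mu> F"
          using lev(2) F unfolding l_def a_def[of F, symmetric] by blast
        ultimately show ?thesis by (simp add: pos_le_divide_eq)
      qed
      then have "2 powr (- (1 - \<sigma>) * l F) * (2 powr l F * \<mu> F) \<le> 2 powr (- (1 - \<sigma>) * l F) * V F"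
        by (intro mult_left_mono) auto
      moreover have "(2::real) powr (- (1 - \<sigma>) * l F) * 2 powr l F = 2 powr (\<sigma> * l F)"
        by (simp add: powr_add[symmetric] algebra_simps)
      ultimately show "2 powr (\<sigma> * l F) * \<mu> F \<le> 2 powr (- (1 - \<sigma>) * l F) * V F"
        by (metis mult.assoc)
    qed
    also have "\<dots> = (\<Sum>k\<in>l ` principal_sets T l. \<Sum>F\<in>{F\<in>principal_sets T l. l F = k}. 2 powr (- (1 - \<sigma>) * l F) * V F)"
      using finP by (intro sum.group[symmetric]) auto
    also have "\<dots> = (\<Sum>k\<in>l ` principal_sets T l. 2 powr (- (1 - \<sigma>) * k) * (\<Sum>F\<in>{F\<in>principal_sets T l. l F = k}. V F))"
      by (simp add: sum_distrib_left)
    also have "\<dots> \<le> (\<Sum>k\<in>l ` principal_sets T l. 2 powr (- (1 - \<sigma>) * k) * V Q)"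
    proof (intro sum_mono mult_left_mono)
      fix k
      have "{F\<in>principal_sets T l. l F = k} \<subseteq> S" "\<forall>F\<in>{F\<in>principal_sets T l. l F = k}. F \<subseteq> Q"
        using pT T(2) by (auto simp: T_def)
      moreover have "disjoint {F\<in>principal_sets T l. l F = k}"
        by (rule disjoint_principal_level[OF lam])
      moreover have "\<And>P. P \<subseteq> S \<Longrightarrow> disjoint P \<Longrightarrow> \<forall>R\<in>P. R \<subseteq> Q \<Longrightarrow> sum V P \<le> V Q"
        using V Q by (simp add: superadditive_def)
      ultimately show "(\<Sum>F\<in>{F\<in>principal_sets T l. l F = k}. V F) \<le> V Q" by presburger
    qed simp
    also have "\<dots> = V Q * (\<Sum>k\<in>l ` principal_sets T l. 2 powr (- (1 - \<sigma>) * k))"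
      by (simp add: sum_distrib_left mult.commute)
    also have "\<dots> \<le> V Q * ((a Q / 2) powr (- (1 - \<sigma>)) / (1 - 2 powr (- (1 - \<sigma>))))"
      using finP \<sigma> a T(3) low pT pos(2)[OF Q]
      by (intro mult_left_mono sum_powr_above) auto
    finally show "(\<Sum>F\<in>principal_sets T l. 2 powr (\<sigma> * l F) * \<mu> F) \<le>
        V Q * ((a Q / 2) powr (\<sigma> - 1) / (1 - 2 powr (\<sigma> - 1)))" by simp
  qed (use \<Delta> in auto)
  also have "\<dots> = 2 * \<Delta> / (1 - 2 powr (\<sigma> - 1)) * (\<mu> Q * a Q powr \<sigma>)"
  proof -
    have aQ: "0 < a Q" using a T(3) by blast
    have "2 powr \<sigma> * (a Q / 2) powr (\<sigma> - 1) = 2 * a Q powr (\<sigma> - 1)"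
      using aQ by (simp add: powr_divide powr_diff)
    moreover have "V Q * a Q powr (\<sigma> - 1) = \<mu> Q * a Q powr \<sigma>"
    proof -
      have "V Q = \<mu> Q * a Q" using pos(1)[OF Q] by (simp add: a_def)
      then show ?thesis using aQ by (simp add: powr_diff)
    qed
    ultimately show ?thesis by (simp add: field_simps)
  qed
  finally show ?thesis by (simp add: T_def a_def)
qed

section \<open>The multilinear form\<close>

text \<open>The hypotheses on a finite family that do not involve the functions: \<open>\<mu>\<close> and the \<open>V i\<close> are
  measures reduced to their values on \<open>S\<close>, and sparseness enters only as the Carleson condition for
  \<open>\<mu>\<close>.\<close>

definition sparse_system :: "'a set set \<Rightarrow> 'i set \<Rightarrow> ('a set \<Rightarrow> real) \<Rightarrow> ('i \<Rightarrow> 'a set \<Rightarrow> real) \<Rightarrow> real \<Rightarrow> bool" where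
  "sparse_system S I \<mu> V \<Delta> \<longleftrightarrow>
     finite S \<and> laminar S \<and> {} \<notin> S \<and> (\<forall>Q\<in>S. 0 < \<mu> Q) \<and> (\<forall>i\<in>I. \<forall>Q\<in>S. 0 < V i Q) \<and>
     carleson S \<mu> \<Delta> \<mu> \<and> (\<forall>i\<in>I. superadditive S (V i))"

lemma sparse_system_subset:
  assumes "sparse_system S I \<mu> V \<Delta>" "T \<subseteq> S"
  shows "sparse_system T I \<mu> V \<Delta>"
  using assms laminar_subset[of S T] superadditive_subset[of S _ T] carleson_subset[of S \<mu> \<Delta> \<mu> T]
  unfolding sparse_system_def by (auto simp: less_imp_le dest: finite_subset)

text \<open>\<open>\<kappa>\<close> is chosen so small that all exponents \<open>\<alpha> i\<close> stay positive; the quotient in the product is the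
  constant of \<open>kolmogorov_sum\<close>.\<close>

definition product_const :: "'i set \<Rightarrow> ('i \<Rightarrow> real) \<Rightarrow> ('i \<Rightarrow> real) \<Rightarrow> real \<Rightarrow> real" where
  "product_const I \<theta> \<rho> \<Delta> =
    (let \<kappa> = Min ((\<lambda>i. \<theta> i / (2 * (\<rho> i - \<theta> i))) ` I);
         \<alpha> = (\<lambda>i. \<theta> i - \<kappa> * (\<rho> i - \<theta> i));
         \<sigma> = sum \<alpha> I / sum \<theta> I
     in 1 + 2 powr \<kappa> * (\<Prod>i\<in>I. (2 * \<Delta> / (1 - 2 powr (\<sigma> - 1))) powr (\<alpha> i / \<sigma>)))"

lemma product_const_pos: "0 < product_const I \<theta> \<rho> \<Delta>"
  unfolding product_const_def Let_def by (intro add_pos_nonneg) (auto simp: prod_nonneg)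

text \<open>Let \<open>X\<close> be the product of the \<open>(V i Q / \<mu> Q) powr (\<rho> i - \<theta> i)\<close>. As \<open>X\<close> varies by at most a factor
  2, inserting \<open>X powr (- \<kappa>)\<close> changes nothing up to constants, but it lowers the exponent of the average
  \<open>V i Q / \<mu> Q\<close> from \<open>\<theta> i\<close> to some \<open>\<alpha> i\<close>. The power of \<open>\<mu> Q\<close> is still the sum of the \<open>\<theta> i\<close>, which is
  more than the sum of the \<open>\<alpha> i\<close>; so Hoelder's inequality reduces the sum to \<open>kolmogorov_sum\<close> with an exponent
  \<open>\<sigma> < 1\<close>.\<close>

lemma products_carleson_on_level:
  fixes \<theta> \<rho> :: "'i \<Rightarrow> real"
  assumes I: "finite I" "I \<noteq> {}" and \<theta>: "\<And>i. i \<in> I \<Longrightarrow> 0 < \<theta> i" "\<And>i. i \<in> I \<Longrightarrow> \<theta> i < \<rho> i"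
    and sum: "1 \<le> sum \<theta> I" and \<Delta>: "0 \<le> \<Delta>"
    and sys: "sparse_system S I \<mu> V \<Delta>" and k: "0 < k"
    and X: "\<And>Q. Q \<in> S \<Longrightarrow> k \<le> (\<Prod>i\<in>I. (V i Q / \<mu> Q) powr (\<rho> i - \<theta> i))"
      "\<And>Q. Q \<in> S \<Longrightarrow> (\<Prod>i\<in>I. (V i Q / \<mu> Q) powr (\<rho> i - \<theta> i)) \<le> 2 * k"
  shows "carleson S (\<lambda>Q. \<Prod>i\<in>I. V i Q powr \<theta> i) (product_const I \<theta> \<rho> \<Delta>)
    (\<lambda>Q. \<Prod>i\<in>I. V i Q powr \<theta> i)"
proof -
  define \<kappa> where "\<kappa> = Min ((\<lambda>i. \<theta> i / (2 * (\<rho> i - \<theta> i))) ` I)"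
  have \<kappa>: "0 < \<kappa>" "\<And>i. i \<in> I \<Longrightarrow> \<kappa> * (\<rho> i - \<theta> i) \<le> \<theta> i / 2"
  proof -
    have "\<kappa> \<in> (\<lambda>i. \<theta> i / (2 * (\<rho> i - \<theta> i))) ` I"
      unfolding \<kappa>_def using I by (intro Min_in) auto
    then show "0 < \<kappa>" using \<theta> by auto
    fix i assume i: "i \<in> I"
    then have "\<kappa> \<le> \<theta> i / (2 * (\<rho> i - \<theta> i))" unfolding \<kappa>_def using I by (intro Min_le) auto
    then show "\<kappa> * (\<rho> i - \<theta> i) \<le> \<theta> i / 2" using \<theta>(2)[OF i] by (simp add: field_simps)
  qed
  \<comment> \<open>the exponents left on the averages; the choice of \<open>\<kappa>\<close> keeps them positive\<close>
  define \<alpha> where "\<alpha> i = \<theta> i - \<kappa> * (\<rho> i - \<theta> i)" for i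
  define \<Theta> where "\<Theta> = sum \<theta> I"
  define \<sigma> where "\<sigma> = sum \<alpha> I / \<Theta>"
  have \<Theta>: "1 \<le> \<Theta>" using sum by (simp add: \<Theta>_def)
  have \<alpha>: "0 < \<alpha> i" "\<alpha> i < \<theta> i" if "i \<in> I" for i
  proof -
    have "\<alpha> i \<ge> \<theta> i / 2" using \<kappa>(2)[OF that] by (simp add: \<alpha>_def)
    then show "0 < \<alpha> i" using \<theta>(1)[OF that] by linarith
    have "\<kappa> * (\<rho> i - \<theta> i) > 0" using \<kappa>(1) \<theta>(2)[OF that] by simp
    then show "\<alpha> i < \<theta> i" by (simp add: \<alpha>_def)
  qed
  have s\<alpha>: "0 < sum \<alpha> I" "sum \<alpha> I < \<Theta>"
    using I \<alpha> unfolding \<Theta>_def by (auto intro!: sum_pos sum_strict_mono)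
  have \<sigma>: "0 < \<sigma>" "\<sigma> < 1" using s\<alpha> \<Theta> by (auto simp: \<sigma>_def)
  \<comment> \<open>Hoelder exponents; their sum is the sum of the \<open>\<theta> i\<close>, hence at least 1\<close>
  define e where "e i = \<alpha> i / \<sigma>" for i
  have e: "0 < e i" if "i \<in> I" for i using \<alpha>(1)[OF that] \<sigma>(1) by (simp add: e_def)
  have se: "sum e I = \<Theta>"
    using s\<alpha> \<Theta> by (simp add: e_def \<sigma>_def sum_divide_distrib[symmetric] sum_distrib_right[symmetric])
  define c where "c = 2 * \<Delta> / (1 - 2 powr (\<sigma> - 1))"
  have "2 powr (\<sigma> - 1) < (1::real)" using \<sigma> by (simp add: powr_less_one)
  then have c: "0 \<le> c" using \<Delta> by (simp add: c_def)
  define C where "C = 1 + 2 powr \<kappa> * (\<Prod>i\<in>I. c powr e i)"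
  have C_eq: "product_const I \<theta> \<rho> \<Delta> = C"
    by (simp only: product_const_def Let_def C_def c_def e_def \<sigma>_def \<Theta>_def \<alpha>_def[abs_def] \<kappa>_def)
  show ?thesis
    unfolding carleson_def C_eq
  proof
    fix Q assume Q: "Q \<in> S"
    define X where "X R = (\<Prod>i\<in>I. (V i R / \<mu> R) powr (\<rho> i - \<theta> i))" for R
    define W where "W R = (\<Prod>i\<in>I. (\<mu> R * (V i R / \<mu> R) powr \<sigma>) powr e i)" for R
    define w where "w R = (\<Prod>i\<in>I. V i R powr \<theta> i)" for R
    define T where "T = {R\<in>S. R \<subseteq> Q}"
    have fin: "finite S" "finite T" using sys by (auto simp: sparse_system_def T_def)
    have pos: "0 < \<mu> R" "\<And>i. i \<in> I \<Longrightarrow> 0 < V i R" if "R \<in> S" for R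
      using sys that by (auto simp: sparse_system_def)
    have X': "k \<le> X R" "X R \<le> 2 * k" if "R \<in> S" for R
      using X[OF that] by (auto simp: X_def)
    have w_eq: "w R = X R powr \<kappa> * W R" if R: "R \<in> S" for R
    proof -
      have \<mu>: "0 < \<mu> R" using pos(1)[OF R] .
      have "w R = (\<Prod>i\<in>I. \<mu> R powr \<theta> i * (V i R / \<mu> R) powr \<theta> i)"
        unfolding w_def
      proof (rule prod.cong[OF refl])
        fix i assume i: "i \<in> I"
        show "V i R powr \<theta> i = \<mu> R powr \<theta> i * (V i R / \<mu> R) powr \<theta> i"
          using \<mu> pos(2)[OF R i] by (simp add: powr_divide)
      qed
      also have "\<dots> = \<mu> R powr \<Theta> * (\<Prod>i\<in>I. (V i R / \<mu> R) powr \<theta> i)"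
        using \<mu> by (simp add: prod.distrib powr_sum \<Theta>_def)
      also have "\<dots> = (\<Prod>i\<in>I. \<mu> R powr e i) * (\<Prod>i\<in>I. (V i R / \<mu> R) powr \<theta> i)"
        using \<mu> by (simp add: se[symmetric] powr_sum)
      also have "\<dots> = X R powr \<kappa> * W R"
        unfolding X_def W_def prod_powr_distrib prod.distrib[symmetric]
      proof (rule prod.cong[OF refl])
        fix i assume i: "i \<in> I"
        have "(V i R / \<mu> R) powr \<theta> i =
            (V i R / \<mu> R) powr ((\<rho> i - \<theta> i) * \<kappa>) * (V i R / \<mu> R) powr \<alpha> i"
          by (simp add: powr_add[symmetric] \<alpha>_def mult.commute)
        moreover have "(\<mu> R * (V i R / \<mu> R) powr \<sigma>) powr e i = \<mu> R powr e i * (V i R / \<mu> R) powr \<alpha> i"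
          using \<mu> \<sigma> by (simp add: powr_mult powr_powr e_def)
        ultimately show "\<mu> R powr e i * (V i R / \<mu> R) powr \<theta> i =
          ((V i R / \<mu> R) powr (\<rho> i - \<theta> i)) powr \<kappa> * (\<mu> R * (V i R / \<mu> R) powr \<sigma>) powr e i"
          by (simp add: powr_powr)
      qed
      finally show ?thesis .
    qed
    have W0: "0 \<le> W R" for R by (simp add: W_def prod_nonneg)
    have "(\<Sum>R\<in>T. w R) \<le> (\<Sum>R\<in>T. (2 * k) powr \<kappa> * W R)"
    proof (rule sum_mono)
      fix R assume "R \<in> T"
      then have R: "R \<in> S" by (simp add: T_def)
      have "X R powr \<kappa> \<le> (2 * k) powr \<kappa>"
        using X'[OF R] k \<kappa>(1) by (intro powr_mono2) auto
      then show "w R \<le> (2 * k) powr \<kappa> * W R"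
        using w_eq[OF R] W0 by (simp add: mult_right_mono)
    qed
    also have "\<dots> = (2 * k) powr \<kappa> * (\<Sum>R\<in>T. W R)" by (simp add: sum_distrib_left)
    also have "(\<Sum>R\<in>T. W R) \<le> (\<Prod>i\<in>I. (\<Sum>R\<in>T. \<mu> R * (V i R / \<mu> R) powr \<sigma>) powr e i)"
      unfolding W_def using I fin e se \<Theta> pos
      by (intro sum_prod_powr_le) (auto simp: T_def less_imp_le)
    also have "\<dots> \<le> (\<Prod>i\<in>I. (c * (\<mu> Q * (V i Q / \<mu> Q) powr \<sigma>)) powr e i)"
    proof (intro prod_mono conjI powr_mono2)
      fix i assume i: "i \<in> I"
      show "(\<Sum>R\<in>T. \<mu> R * (V i R / \<mu> R) powr \<sigma>) \<le> c * (\<mu> Q * (V i Q / \<mu> Q) powr \<sigma>)"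
        unfolding T_def c_def using sys i Q pos \<sigma> \<Delta>
        by (intro kolmogorov_sum) (auto simp: sparse_system_def)
      show "0 \<le> (\<Sum>R\<in>T. \<mu> R * (V i R / \<mu> R) powr \<sigma>)"
        using pos(1) by (intro sum_nonneg) (auto simp: T_def less_imp_le)
    qed (use e in \<open>auto simp: less_imp_le\<close>)
    also have "\<dots> = (\<Prod>i\<in>I. c powr e i) * W Q"
      unfolding W_def prod.distrib[symmetric] using c pos(1)[OF Q]
      by (intro prod.cong) (auto simp: powr_mult)
    finally have "(\<Sum>R\<in>T. w R) \<le> (2 * k) powr \<kappa> * ((\<Prod>i\<in>I. c powr e i) * W Q)"
      by (simp add: mult_left_mono)
    also have "\<dots> = 2 powr \<kappa> * (\<Prod>i\<in>I. c powr e i) * (k powr \<kappa> * W Q)"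
      using k by (simp add: powr_mult)
    also have "\<dots> \<le> 2 powr \<kappa> * (\<Prod>i\<in>I. c powr e i) * (X Q powr \<kappa> * W Q)"
      using X'[OF Q] k \<kappa>(1) W0 by (intro mult_left_mono mult_right_mono powr_mono2) (auto simp: prod_nonneg)
    also have "\<dots> \<le> C * w Q"
      unfolding w_eq[OF Q] using W0 by (intro mult_right_mono) (auto simp: C_def)
    finally show "(\<Sum>R\<in>{R\<in>S. R \<subseteq> Q}. \<Prod>i\<in>I. V i R powr \<theta> i) \<le> C * (\<Prod>i\<in>I. V i Q powr \<theta> i)"
      by (simp add: T_def w_def)
  qed
qed

text \<open>Each \<open>Q\<close> is charged to a pair \<open>(j, F)\<close> where \<open>F\<close> contains \<open>Q\<close>, has the same labels and is principal
  for \<open>j\<close>. The Carleson condition for the products removes \<open>Q\<close>. In the remaining sum over \<open>F\<close>, Hoelder's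
  inequality separates the indices; the \<open>j\<close>-th factor runs over principal sets only and needs no
  Carleson constant.\<close>

lemma labelled_form_bound:
  fixes \<theta> s \<Lambda> N :: "'i \<Rightarrow> real" and l :: "'i \<Rightarrow> 'a set \<Rightarrow> int"
  assumes I: "finite I" "I \<noteq> {}" and \<theta>: "\<And>i. i \<in> I \<Longrightarrow> 0 < \<theta> i" "1 \<le> sum \<theta> I"
    and S: "finite S" "laminar S" "{} \<notin> S"
    and V: "\<And>i Q. i \<in> I \<Longrightarrow> Q \<in> S \<Longrightarrow> 0 < V i Q"
    and w: "carleson S (\<lambda>Q. \<Prod>i\<in>I. V i Q powr \<theta> i) C (\<lambda>Q. \<Prod>i\<in>I. V i Q powr \<theta> i)" and C: "0 \<le> C"
    and l: "\<And>i. i \<in> I \<Longrightarrow> decreasing_labels S (l i)"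
    and \<Lambda>: "\<And>i. i \<in> I \<Longrightarrow> 0 \<le> \<Lambda> i" "\<And>i. i \<in> I \<Longrightarrow> carleson S (V i) (\<Lambda> i) (V i)"
    and N: "\<And>i. i \<in> I \<Longrightarrow> (\<Sum>F\<in>principal_sets S (l i). 2 powr (s i * l i F) * V i F) \<le> N i"
  shows "(\<Sum>Q\<in>S. (\<Prod>i\<in>I. 2 powr (s i * \<theta> i * l i Q)) * (\<Prod>i\<in>I. V i Q powr \<theta> i)) \<le>
    C * ((\<Sum>j\<in>I. \<Prod>i\<in>I - {j}. \<Lambda> i powr \<theta> i) * (\<Prod>i\<in>I. N i powr \<theta> i))"
proof -
  define w where "w Q = (\<Prod>i\<in>I. V i Q powr \<theta> i)" for Q
  define E where "E Q = (\<Prod>i\<in>I. 2 powr (s i * \<theta> i * l i Q))" for Q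
  define Z where "Z = Sigma I (\<lambda>j. principal_sets S (l j))"
  have finP: "finite (principal_sets S (l j))" for j
    using S(1) principal_subset finite_subset by metis
  have w0: "0 \<le> w Q" for Q by (simp add: w_def prod_nonneg)
  have E0: "0 \<le> E Q" for Q by (simp add: E_def prod_nonneg)
  have N0: "0 \<le> N i" if "i \<in> I" for i
  proof -
    have "0 \<le> (\<Sum>F\<in>principal_sets S (l i). 2 powr (s i * l i F) * V i F)"
      using V[OF that] principal_subset[of S "l i"] by (intro sum_nonneg) (auto simp: less_imp_le)
    then show ?thesis using N[OF that] by linarith
  qed
  have "(\<Sum>Q\<in>S. E Q * w Q) \<le>
      (\<Sum>z\<in>Z. \<Sum>Q\<in>{Q\<in>S. Q \<subseteq> snd z \<and> (\<forall>i\<in>I. l i (snd z) = l i Q)}. E Q * w Q)"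
  proof (rule sum_le_sum_related[where r = "\<lambda>Q z. Q \<subseteq> snd z \<and> (\<forall>i\<in>I. l i (snd z) = l i Q)"])
    fix Q assume "Q \<in> S"
    then obtain j F where jF: "j \<in> I" "F \<in> principal_sets S (l j)" "Q \<subseteq> F" "\<forall>i\<in>I. l i F = l i Q"
      using exists_common_principal[where l = l, OF S I(2) l] by metis
    then show "\<exists>z\<in>Z. Q \<subseteq> snd z \<and> (\<forall>i\<in>I. l i (snd z) = l i Q)"
      by (intro bexI[of _ "(j, F)"]) (auto simp: Z_def)
  qed (use S(1) I(1) finP w0 E0 in \<open>auto simp: Z_def\<close>)
  also have "\<dots> = (\<Sum>j\<in>I. \<Sum>F\<in>principal_sets S (l j).
      \<Sum>Q\<in>{Q\<in>S. Q \<subseteq> F \<and> (\<forall>i\<in>I. l i F = l i Q)}. E Q * w Q)"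
    unfolding Z_def using I(1) finP by (simp add: sum.Sigma split_def)
  also have "\<dots> \<le> (\<Sum>j\<in>I. \<Sum>F\<in>principal_sets S (l j). C * (E F * w F))"
  proof (intro sum_mono)
    fix j F assume F: "F \<in> principal_sets S (l j)"
    have "(\<Sum>Q\<in>{Q\<in>S. Q \<subseteq> F \<and> (\<forall>i\<in>I. l i F = l i Q)}. E Q * w Q) =
        E F * (\<Sum>Q\<in>{Q\<in>S. Q \<subseteq> F \<and> (\<forall>i\<in>I. l i F = l i Q)}. w Q)"
      unfolding sum_distrib_left by (intro sum.cong refl) (auto simp: E_def)
    also have "\<dots> \<le> E F * (\<Sum>Q\<in>{Q\<in>S. Q \<subseteq> F}. w Q)"
      using S(1) w0 E0 by (intro mult_left_mono sum_mono2) auto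
    also have "\<dots> \<le> E F * (C * w F)"
      using assms(9) F principal_subset[of S "l j"] E0
      by (intro mult_left_mono) (auto simp: carleson_def w_def)
    finally show "(\<Sum>Q\<in>{Q\<in>S. Q \<subseteq> F \<and> (\<forall>i\<in>I. l i F = l i Q)}. E Q * w Q) \<le> C * (E F * w F)"
      by (simp add: mult_ac)
  qed
  also have "\<dots> = C * (\<Sum>j\<in>I. \<Sum>F\<in>principal_sets S (l j). \<Prod>i\<in>I. (2 powr (s i * l i F) * V i F) powr \<theta> i)"
    unfolding sum_distrib_left
  proof (intro sum.cong refl arg_cong2[where f = times])
    fix j F assume F: "F \<in> principal_sets S (l j)"
    show "E F * w F = (\<Prod>i\<in>I. (2 powr (s i * l i F) * V i F) powr \<theta> i)"
      unfolding E_def w_def prod.distrib[symmetric]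
    proof (rule prod.cong[OF refl])
      fix i assume "i \<in> I"
      then have "0 < V i F" using V F principal_subset by blast
      then show "2 powr (s i * \<theta> i * l i F) * V i F powr \<theta> i = (2 powr (s i * l i F) * V i F) powr \<theta> i"
        by (simp add: powr_mult powr_powr mult_ac)
    qed
  qed
  also have "\<dots> \<le> C * (\<Sum>j\<in>I. (\<Prod>i\<in>I - {j}. \<Lambda> i powr \<theta> i) * (\<Prod>i\<in>I. N i powr \<theta> i))"
  proof (intro mult_left_mono[OF _ C] sum_mono)
    fix j assume j: "j \<in> I"
    define P where "P = principal_sets S (l j)"
    have P: "P \<subseteq> S" "finite P" using principal_subset finP by (auto simp: P_def)
    have nn: "0 \<le> 2 powr (s i * l i F) * V i F" if "i \<in> I" "F \<in> S" for i F
      using V[OF that] by simp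
    have "(\<Sum>F\<in>P. \<Prod>i\<in>I. (2 powr (s i * l i F) * V i F) powr \<theta> i) \<le>
        (\<Prod>i\<in>I. (\<Sum>F\<in>P. 2 powr (s i * l i F) * V i F) powr \<theta> i)"
      using I P \<theta> nn by (intro sum_prod_powr_le) auto
    also have "\<dots> = (\<Sum>F\<in>P. 2 powr (s j * l j F) * V j F) powr \<theta> j *
        (\<Prod>i\<in>I - {j}. (\<Sum>F\<in>P. 2 powr (s i * l i F) * V i F) powr \<theta> i)"
      using I(1) j by (simp add: prod.remove)
    also have "\<dots> \<le> N j powr \<theta> j * (\<Prod>i\<in>I - {j}. (\<Lambda> i * N i) powr \<theta> i)"
    proof (intro mult_mono prod_mono conjI powr_mono2)
      show "(\<Sum>F\<in>P. 2 powr (s j * l j F) * V j F) \<le> N j" using N[OF j] by (simp add: P_def)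
      fix i assume i: "i \<in> I - {j}"
      have "(\<Sum>F\<in>P. 2 powr (s i * l i F) * V i F) \<le> (\<Sum>F\<in>S. 2 powr (s i * l i F) * V i F)"
        using P S(1) nn i by (intro sum_mono2) auto
      also have "\<dots> \<le> \<Lambda> i * (\<Sum>F\<in>principal_sets S (l i). 2 powr (s i * l i F) * V i F)"
        using S(1) \<Lambda> i V
        by (intro sum_le_sum_principal[where w = "\<lambda>k. 2 powr (s i * k)"]) (auto simp: less_imp_le)
      also have "\<dots> \<le> \<Lambda> i * N i" using N \<Lambda>(1) i by (intro mult_left_mono) auto
      finally show "(\<Sum>F\<in>P. 2 powr (s i * l i F) * V i F) \<le> \<Lambda> i * N i" .
    qed (use \<theta>(1) j P nn in \<open>auto simp: less_imp_le prod_nonneg intro!: sum_nonneg\<close>)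
    also have "\<dots> = N j powr \<theta> j * ((\<Prod>i\<in>I - {j}. \<Lambda> i powr \<theta> i) * (\<Prod>i\<in>I - {j}. N i powr \<theta> i))"
      unfolding prod.distrib[symmetric] using \<Lambda>(1) N0
      by (intro arg_cong2[where f = times] prod.cong refl) (auto simp: powr_mult)
    also have "\<dots> = (\<Prod>i\<in>I - {j}. \<Lambda> i powr \<theta> i) * (\<Prod>i\<in>I. N i powr \<theta> i)"
      using I(1) j by (simp add: prod.remove[of I j] mult_ac)
    finally show "(\<Sum>F\<in>principal_sets S (l j). \<Prod>i\<in>I. (2 powr (s i * l i F) * V i F) powr \<theta> i) \<le>
        (\<Prod>i\<in>I - {j}. \<Lambda> i powr \<theta> i) * (\<Prod>i\<in>I. N i powr \<theta> i)" by (simp add: P_def)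
  qed
  finally show ?thesis by (simp add: E_def w_def sum_distrib_right)
qed

definition form_const :: "'i set \<Rightarrow> ('i \<Rightarrow> real) \<Rightarrow> ('i \<Rightarrow> real) \<Rightarrow> real \<Rightarrow> real" where
  "form_const I \<theta> \<rho> \<Delta> = 4 * (\<Prod>i\<in>I. 2 powr \<rho> i) * product_const I \<theta> \<rho> \<Delta>"

lemma form_const_pos: "0 < form_const I \<theta> \<rho> \<Delta>"
  unfolding form_const_def by (auto intro!: mult_pos_pos prod_pos product_const_pos)

text \<open>The family is split by the dyadic size of the product of averages that is bounded by \<open>K\<close>. On
  each piece the labels are formed within the piece, which is why the hypothesis on \<open>N\<close> is required
  for all subfamilies; the bounds for the pieces form a geometric series controlled by \<open>K\<close>.\<close>

lemma multilinear_form_bound: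
  fixes \<theta> \<rho> \<Lambda> N :: "'i \<Rightarrow> real"
  assumes I: "finite I" "I \<noteq> {}" and \<theta>: "\<And>i. i \<in> I \<Longrightarrow> 0 < \<theta> i" "\<And>i. i \<in> I \<Longrightarrow> \<theta> i < \<rho> i"
    and sum: "1 \<le> sum \<theta> I" and \<Delta>: "0 \<le> \<Delta>"
    and sys: "sparse_system S I \<mu> V \<Delta>" and K0: "0 \<le> K"
    and a: "\<And>i Q. i \<in> I \<Longrightarrow> Q \<in> S \<Longrightarrow> 0 < a i Q"
    and \<Lambda>: "\<And>i. i \<in> I \<Longrightarrow> 0 \<le> \<Lambda> i" "\<And>i. i \<in> I \<Longrightarrow> carleson S (V i) (\<Lambda> i) (V i)"
    and N: "\<And>i T. i \<in> I \<Longrightarrow> T \<subseteq> S \<Longrightarrow> (\<Sum>F\<in>principal_sets T (dyadic_level T (a i)).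
        2 powr (\<rho> i / \<theta> i * dyadic_level T (a i) F) * V i F) \<le> N i"
    and K: "\<And>Q. Q \<in> S \<Longrightarrow> (\<Prod>i\<in>I. (V i Q / \<mu> Q) powr (\<rho> i - \<theta> i)) \<le> K"
  shows "(\<Sum>Q\<in>S. (\<Prod>i\<in>I. a i Q powr \<rho> i) *
        ((\<Prod>i\<in>I. (V i Q / \<mu> Q) powr (\<rho> i - \<theta> i)) * (\<Prod>i\<in>I. V i Q powr \<theta> i)))
      \<le> form_const I \<theta> \<rho> \<Delta> * K *
        ((\<Sum>j\<in>I. \<Prod>i\<in>I - {j}. \<Lambda> i powr \<theta> i) * (\<Prod>i\<in>I. N i powr \<theta> i))"
proof -
  define C where "C = product_const I \<theta> \<rho> \<Delta>"
  have C: "0 < C" by (simp add: C_def product_const_pos)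
  define c where "c = (\<Prod>i\<in>I. 2 powr \<rho> i)"
  have c: "0 < c" by (auto simp: c_def prod_pos)
  define X where "X Q = (\<Prod>i\<in>I. (V i Q / \<mu> Q) powr (\<rho> i - \<theta> i))" for Q
  define w where "w Q = (\<Prod>i\<in>I. V i Q powr \<theta> i)" for Q
  define G where "G Q = (\<Prod>i\<in>I. a i Q powr \<rho> i)" for Q
  define B where "B = (\<Sum>j\<in>I. \<Prod>i\<in>I - {j}. \<Lambda> i powr \<theta> i) * (\<Prod>i\<in>I. N i powr \<theta> i)"
  define n where "n Q = \<lfloor>log 2 (X Q)\<rfloor>" for Q
  have S: "finite S" "laminar S" "{} \<notin> S" using sys by (auto simp: sparse_system_def)
  have pos: "0 < \<mu> Q" "\<And>i. i \<in> I \<Longrightarrow> 0 < V i Q" if "Q \<in> S" for Q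
    using sys that by (auto simp: sparse_system_def)
  have B: "0 \<le> B" by (auto simp: B_def intro!: mult_nonneg_nonneg sum_nonneg prod_nonneg)
  have w0: "0 \<le> w Q" "0 \<le> G Q" for Q by (auto simp: w_def G_def prod_nonneg)
  have X: "2 powr n Q \<le> X Q" "X Q \<le> 2 * 2 powr n Q" if Q: "Q \<in> S" for Q
  proof -
    have *: "0 < X Q" unfolding X_def
    proof (rule prod_pos)
      fix i assume "i \<in> I"
      then have "V i Q / \<mu> Q \<noteq> 0" using pos[OF Q] by force
      then show "0 < (V i Q / \<mu> Q) powr (\<rho> i - \<theta> i)" by simp
    qed
    show "2 powr n Q \<le> X Q" unfolding n_def using * by (simp add: le_log_iff[symmetric])
    have "X Q < 2 powr (n Q + 1)" unfolding n_def using * by (simp add: log_less_iff[symmetric])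
    then show "X Q \<le> 2 * 2 powr n Q" by (simp add: powr_add)
  qed
  have level: "(\<Sum>Q\<in>{Q\<in>S. n Q = k}. G Q * (X Q * w Q)) \<le> 2 powr k * (2 * c * C * B)" for k
  proof -
    define T where "T = {Q\<in>S. n Q = k}"
    define l where "l i = dyadic_level T (a i)" for i
    have T: "T \<subseteq> S" "finite T" using S(1) by (auto simp: T_def)
    have aT: "\<forall>Q\<in>T. 0 < a i Q" if "i \<in> I" for i using a that T by auto
    have sysT: "sparse_system T I \<mu> V \<Delta>" using sparse_system_subset[OF sys T(1)] .
    have XT: "2 powr k \<le> X Q" "X Q \<le> 2 * 2 powr k" if "Q \<in> T" for Q
      using X[of Q] that by (auto simp: T_def)
    have "(\<Sum>Q\<in>T. G Q * (X Q * w Q)) \<le>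
        (\<Sum>Q\<in>T. (2 * 2 powr k * c) * ((\<Prod>i\<in>I. 2 powr (\<rho> i / \<theta> i * \<theta> i * l i Q)) * w Q))"
    proof (rule sum_mono)
      fix Q assume Q: "Q \<in> T"
      have "G Q \<le> (\<Prod>i\<in>I. 2 powr \<rho> i * 2 powr (\<rho> i / \<theta> i * \<theta> i * l i Q))"
        unfolding G_def
      proof (intro prod_mono conjI)
        fix i assume i: "i \<in> I"
        have "a i Q powr \<rho> i \<le> (2 powr (l i Q + 1)) powr \<rho> i"
          using average_le[OF T(2) aT[OF i] Q] \<theta>[OF i] aT[OF i] Q
          by (intro powr_mono2) (auto simp: l_def less_imp_le)
        also have "\<dots> = 2 powr \<rho> i * 2 powr (\<rho> i / \<theta> i * \<theta> i * l i Q)"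
          using \<theta>(1)[OF i] by (simp add: powr_powr powr_add[symmetric] algebra_simps)
        finally show "a i Q powr \<rho> i \<le> 2 powr \<rho> i * 2 powr (\<rho> i / \<theta> i * \<theta> i * l i Q)" .
      qed simp
      also have "\<dots> = c * (\<Prod>i\<in>I. 2 powr (\<rho> i / \<theta> i * \<theta> i * l i Q))"
        by (simp add: prod.distrib c_def)
      finally have "G Q * (X Q * w Q) \<le>
          (c * (\<Prod>i\<in>I. 2 powr (\<rho> i / \<theta> i * \<theta> i * l i Q))) * (2 * 2 powr k * w Q)"
        using XT[OF Q] w0 c powr_ge_zero[of 2 "real_of_int k"]
        by (intro mult_mono mult_right_mono) (auto simp: prod_nonneg intro: order_trans[OF powr_ge_zero])
      then show "G Q * (X Q * w Q) \<le>
          (2 * 2 powr k * c) * ((\<Prod>i\<in>I. 2 powr (\<rho> i / \<theta> i * \<theta> i * l i Q)) * w Q)"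
        by (simp only: mult_ac)
    qed
    also have "\<dots> = (2 * 2 powr k * c) * (\<Sum>Q\<in>T. (\<Prod>i\<in>I. 2 powr (\<rho> i / \<theta> i * \<theta> i * l i Q)) * w Q)"
      by (simp add: sum_distrib_left)
    also have "\<dots> \<le> (2 * 2 powr k * c) * (C * B)"
      unfolding w_def B_def
    proof (rule mult_left_mono, rule labelled_form_bound[OF I \<theta>(1) sum T(2)])
      show "laminar T" "{} \<notin> T" using laminar_subset S T(1) by auto
      show "carleson T (\<lambda>Q. \<Prod>i\<in>I. V i Q powr \<theta> i) C (\<lambda>Q. \<Prod>i\<in>I. V i Q powr \<theta> i)"
        unfolding C_def using XT
          by (intro products_carleson_on_level[OF I \<theta> sum \<Delta> sysT, of "2 powr k"]) (auto simp: X_def)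
      show "decreasing_labels T (l i)" if "i \<in> I" for i
        using decreasing_labels_level[OF T(2) aT[OF that]] by (simp add: l_def)
      show "carleson T (V i) (\<Lambda> i) (V i)" if "i \<in> I" for i
        using carleson_subset[OF \<Lambda>(2)[OF that] T(1) S(1)] pos(2) that by (simp add: less_imp_le)
      show "(\<Sum>F\<in>principal_sets T (l i). 2 powr (\<rho> i / \<theta> i * l i F) * V i F) \<le> N i" if "i \<in> I" for i
        using N[OF that T(1)] by (simp add: l_def)
      show "0 < V i Q" if "i \<in> I" "Q \<in> T" for i Q using pos(2) that T(1) by auto
    qed (use \<Lambda>(1) C c in auto)
    finally show ?thesis by (simp add: T_def mult_ac)
  qed
  have "(\<Sum>Q\<in>S. G Q * (X Q * w Q)) = (\<Sum>k\<in>n ` S. \<Sum>Q\<in>{Q\<in>S. n Q = k}. G Q * (X Q * w Q))"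
    using S(1) by (intro sum.group[symmetric]) auto
  also have "\<dots> \<le> (\<Sum>k\<in>n ` S. 2 powr k * (2 * c * C * B))" by (intro sum_mono level)
  also have "\<dots> = (\<Sum>k\<in>n ` S. 2 powr (1 * real_of_int k)) * (2 * c * C * B)" by (simp add: sum_distrib_right)
  also have "\<dots> \<le> (2 * K) * (2 * c * C * B)"
  proof (cases "S = {}")
    case True then show ?thesis using K0 c C B by simp
  next
    case False
    then obtain Q where Q: "Q \<in> S" by blast
    have "0 < (2::real) powr n Q" by simp
    also have "\<dots> \<le> K" using X(1)[OF Q] K[OF Q] by (simp add: X_def)
    finally have "0 < K" .
    moreover have "2 powr k \<le> K" if k: "k \<in> n ` S" for k
    proof -
      obtain Q where "Q \<in> S" "k = n Q" using k by blast
      then show ?thesis using X(1)[of Q] K[of Q] by (simp add: X_def)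
    qed
    ultimately have "(\<Sum>k\<in>n ` S. 2 powr (1 * real_of_int k)) \<le> K powr 1 / (1 - 2 powr (- 1))"
      using S(1) by (intro sum_powr_below) auto
    also have "\<dots> = 2 * K" using \<open>0 < K\<close> by (simp add: powr_minus)
    finally show ?thesis using c C B by (intro mult_right_mono) auto
  qed
  finally show ?thesis
    by (simp add: X_def w_def G_def B_def form_const_def c_def C_def mult_ac)
qed

section \<open>Averages with respect to a measure\<close>

lemma superadditive_measure:
  assumes "finite S" "S \<subseteq> sets N" "\<And>Q. Q \<in> S \<Longrightarrow> emeasure N Q < \<infinity>"
  shows "superadditive S (measure N)"
  unfolding superadditive_def
proof (intro ballI allI impI)
  fix Q P assume Q: "Q \<in> S" and P: "P \<subseteq> S" "disjoint P" "\<forall>R\<in>P. R \<subseteq> Q"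
  have "sum (measure N) P = measure N (\<Union>R\<in>P. R)"
    using assms P by (intro measure_finite_Union[symmetric])
      (auto dest: finite_subset simp: disjoint_family_on_disjoint_image disjoint_family_on_def disjoint_def top.not_eq_extremum)
  also have "\<dots> \<le> measure N Q"
    using assms Q P by (intro measure_mono_fmeasurable) (auto simp: fmeasurable_def dest: finite_subset)
  finally show "sum (measure N) P \<le> measure N Q" .
qed

definition principal_const :: "real \<Rightarrow> real" where
  "principal_const s = 2 * 2 powr (s - 1) / (1 - 2 powr (1 - s))"

lemma principal_const_pos: "1 < s \<Longrightarrow> 0 < principal_const s"
  unfolding principal_const_def by (intro divide_pos_pos) (auto simp: powr_less_one)

text \<open>On a principal set \<open>F\<close> of level \<open>k\<close> the part of \<open>g\<close> below \<open>2 ^ (k - 1)\<close> accounts for at most half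
  of the average. The principal sets of one level are disjoint, so at a fixed point the levels with
  \<open>2 ^ (k - 1) < g\<close> form a geometric sum. This takes the place of the maximal theorem.\<close>

lemma principal_powr_le:
  fixes N :: "'a measure" and g :: "'a \<Rightarrow> real" and s :: real
  assumes S: "finite S" "laminar S" "S \<subseteq> sets N"
    and fin: "\<And>Q. Q \<in> S \<Longrightarrow> emeasure N Q < \<infinity>"
    and g[measurable]: "g \<in> borel_measurable N" and g0: "\<And>x. 0 \<le> g x"
    and a: "\<forall>Q\<in>S. 0 < a Q"
    and avg: "\<And>Q. Q \<in> S \<Longrightarrow> ennreal (a Q * measure N Q) = (\<integral>\<^sup>+x\<in>Q. ennreal (g x) \<partial>N)"
    and s: "1 < s"
  shows "ennreal (\<Sum>F\<in>principal_sets S (dyadic_level S a). 2 powr (s * dyadic_level S a F) * measure N F) \<le>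
    ennreal (principal_const s) * (\<integral>\<^sup>+x. ennreal (g x powr s) \<partial>N)"
proof -
  define l where "l = dyadic_level S a"
  define P where "P = principal_sets S l"
  have P: "finite P" "P \<subseteq> S" using principal_subset[of S l] S(1) by (auto simp: P_def dest: finite_subset)
  have meas: "F \<in> sets N" if "F \<in> P" for F using that P S(3) by auto
  define u where "u F x = (if 2 powr (l F - 1) < g x then g x else 0)" for F x
  have u[measurable]: "u F \<in> borel_measurable N" for F unfolding u_def by measurable
  have u0: "0 \<le> u F x" for F x using g0 by (simp add: u_def)
  have half: "ennreal (2 powr (l F - 1) * measure N F) \<le> (\<integral>\<^sup>+x\<in>F. ennreal (u F x) \<partial>N)"
    if F: "F \<in> P" for F
  proof -
    have [measurable]: "F \<in> sets N" using meas[OF F] .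
    have eF: "emeasure N F = ennreal (measure N F)"
      using fin[of F] F P(2) by (simp add: emeasure_eq_ennreal_measure subset_eq top.not_eq_extremum)
    have "2 powr l F \<le> a F"
      using powr_level_le_average[OF S(1) a] F by (simp add: P_def l_def)
    then have "2 powr (l F - 1) + 2 powr (l F - 1) \<le> a F" by (simp add: powr_diff)
    then have "(2 powr (l F - 1) + 2 powr (l F - 1)) * measure N F \<le> a F * measure N F"
      by (intro mult_right_mono) auto
    then have "ennreal (2 powr (l F - 1) * measure N F) + ennreal (2 powr (l F - 1) * measure N F)
        \<le> ennreal (a F * measure N F)"
      by (subst ennreal_plus[symmetric]) (auto intro!: ennreal_leI simp: algebra_simps)
    also have "\<dots> = (\<integral>\<^sup>+x\<in>F. ennreal (g x) \<partial>N)" using avg F P(2) by blast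
    also have "\<dots> \<le> (\<integral>\<^sup>+x. ennreal (u F x) * indicator F x + ennreal (2 powr (l F - 1)) * indicator F x \<partial>N)"
      by (intro nn_integral_mono) (auto simp: u_def indicator_def not_less intro!: ennreal_leI)
    also have "\<dots> = (\<integral>\<^sup>+x\<in>F. ennreal (u F x) \<partial>N) + ennreal (2 powr (l F - 1)) * emeasure N F"
      by (subst nn_integral_add) (auto simp: nn_integral_cmult_indicator)
    also have "ennreal (2 powr (l F - 1)) * emeasure N F = ennreal (2 powr (l F - 1) * measure N F)"
      unfolding eF by (simp add: ennreal_mult)
    finally show ?thesis by (simp add: ennreal_add_left_cancel_le add.commute[of "nn_integral N _"])
  qed
  define H where "H x = (\<Sum>F\<in>P. 2 * 2 powr ((s - 1) * l F) * u F x * indicator F x)" for x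
  have "ennreal (\<Sum>F\<in>P. 2 powr (s * l F) * measure N F) =
      (\<Sum>F\<in>P. ennreal (2 * 2 powr ((s - 1) * l F)) * ennreal (2 powr (l F - 1) * measure N F))"
  proof (subst sum_ennreal[symmetric])
    show "(\<Sum>F\<in>P. ennreal (2 powr (s * l F) * measure N F)) =
      (\<Sum>F\<in>P. ennreal (2 * 2 powr ((s - 1) * l F)) * ennreal (2 powr (l F - 1) * measure N F))"
    proof (rule sum.cong[OF refl])
      fix F
      have "2 powr (s * l F) = 2 * 2 powr ((s - 1) * l F) * 2 powr (l F - 1)"
        by (simp add: powr_diff left_diff_distrib)
      then show "ennreal (2 powr (s * l F) * measure N F) =
          ennreal (2 * 2 powr ((s - 1) * l F)) * ennreal (2 powr (l F - 1) * measure N F)"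
        by (simp add: ennreal_mult[symmetric] mult_ac)
    qed
  qed simp
  also have "\<dots> \<le> (\<Sum>F\<in>P. ennreal (2 * 2 powr ((s - 1) * l F)) * (\<integral>\<^sup>+x\<in>F. ennreal (u F x) \<partial>N))"
    by (intro sum_mono mult_left_mono half) auto
  also have "\<dots> = (\<integral>\<^sup>+x. (\<Sum>F\<in>P. ennreal (2 * 2 powr ((s - 1) * l F)) * (ennreal (u F x) * indicator F x)) \<partial>N)"
  proof (subst nn_integral_sum)
    show "(\<lambda>x. ennreal (2 * 2 powr ((s - 1) * l F)) * (ennreal (u F x) * indicator F x)) \<in> borel_measurable N"
      if "F \<in> P" for F
      using meas[OF that] by measurable
    show "(\<Sum>F\<in>P. ennreal (2 * 2 powr ((s - 1) * l F)) * (\<integral>\<^sup>+x\<in>F. ennreal (u F x) \<partial>N)) =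
        (\<Sum>F\<in>P. \<integral>\<^sup>+x. ennreal (2 * 2 powr ((s - 1) * l F)) * (ennreal (u F x) * indicator F x) \<partial>N)"
      using meas by (intro sum.cong refl nn_integral_cmult[symmetric]) auto
  qed
  also have "\<dots> = (\<integral>\<^sup>+x. ennreal (H x) \<partial>N)"
    unfolding H_def using u0
    by (intro nn_integral_cong, subst sum_ennreal[symmetric])
      (auto simp: ennreal_mult ennreal_indicator mult_ac intro!: sum.cong split: split_indicator)
  also have "\<dots> \<le> (\<integral>\<^sup>+x. ennreal (2 * 2 powr (s - 1) / (1 - 2 powr (1 - s))) * ennreal (g x powr s) \<partial>N)"
  proof (intro nn_integral_mono)
    fix x
    define Px where "Px = {F\<in>P. x \<in> F \<and> 2 powr (l F - 1) < g x}"
    have fPx: "finite Px" using P(1) by (simp add: Px_def)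
    have inj: "inj_on l Px"
    proof (rule inj_onI)
      fix F G assume FG: "F \<in> Px" "G \<in> Px" "l F = l G"
      have "disjoint {F\<in>P. l F = l G}" unfolding P_def by (rule disjoint_principal_level[OF S(2)])
      then show "F = G" using FG by (auto simp: disjoint_def Px_def)
    qed
    have "H x = (\<Sum>F\<in>Px. 2 * g x * 2 powr ((s - 1) * l F))"
      unfolding H_def Px_def using P(1)
      by (intro sum.mono_neutral_cong_right) (auto simp: u_def indicator_def split: if_splits)
    also have "\<dots> = 2 * g x * (\<Sum>k\<in>l ` Px. 2 powr ((s - 1) * real_of_int k))"
      by (simp add: sum.reindex[OF inj] sum_distrib_left)
    also have "\<dots> \<le> 2 * 2 powr (s - 1) / (1 - 2 powr (1 - s)) * g x powr s"
    proof (cases "g x = 0")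
      case False
      then have gx: "0 < g x" using g0[of x] by simp
      have "(\<Sum>k\<in>l ` Px. 2 powr ((s - 1) * real_of_int k)) \<le> (2 * g x) powr (s - 1) / (1 - 2 powr (- (s - 1)))"
        using fPx s gx by (intro sum_powr_below) (auto simp: Px_def powr_diff)
      then have "2 * g x * (\<Sum>k\<in>l ` Px. 2 powr ((s - 1) * real_of_int k)) \<le>
          2 * g x * ((2 * g x) powr (s - 1) / (1 - 2 powr (- (s - 1))))"
        using gx by (intro mult_left_mono) auto
      also have "\<dots> = 2 * 2 powr (s - 1) / (1 - 2 powr (1 - s)) * (g x * g x powr (s - 1))"
        using gx by (simp add: powr_mult)
      also have "g x * g x powr (s - 1) = g x powr s" using gx by (simp add: powr_diff)
      finally show ?thesis .
    qed (use s in simp)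
    finally show "ennreal (H x) \<le>
        ennreal (2 * 2 powr (s - 1) / (1 - 2 powr (1 - s))) * ennreal (g x powr s)"
      using s powr_less_one[of 2 "1 - s"] by (subst ennreal_mult[symmetric]) (auto intro: ennreal_leI)
  qed
  also have "\<dots> = ennreal (2 * 2 powr (s - 1) / (1 - 2 powr (1 - s))) * (\<integral>\<^sup>+x. ennreal (g x powr s) \<partial>N)"
    by (rule nn_integral_cmult) measurable
  finally show ?thesis by (simp add: P_def l_def principal_const_def)
qed

section \<open>Cubes and weights\<close>

lemma cubes_nested:
  assumes "dyadic_lattice M d \<delta>\<^sub>0 a\<^sub>1 A\<^sub>1 D" "Q \<in> cubes D" "R \<in> cubes D"
  shows "Q \<subseteq> R \<or> R \<subseteq> Q \<or> Q \<inter> R = {}"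
proof -
  obtain k l where kl: "Q \<in> D k" "R \<in> D l" using assms(2,3) by (auto simp: cubes_def)
  have *: "\<And>k l Q R. k \<le> l \<Longrightarrow> Q \<in> D k \<Longrightarrow> R \<in> D l \<Longrightarrow> R \<subseteq> Q \<or> R \<inter> Q = {}"
    using assms(1) unfolding dyadic_lattice_def by simp
  show ?thesis
  proof (cases "k \<le> l")
    case True then show ?thesis using *[OF True kl] by auto
  next
    case False then show ?thesis using *[of l k R Q] kl by auto
  qed
qed

lemma countable_cubes: "dyadic_lattice M d \<delta>\<^sub>0 a\<^sub>1 A\<^sub>1 D \<Longrightarrow> countable (cubes D)"
  unfolding dyadic_lattice_def cubes_def by (intro countable_UN) auto

lemma qball_measurable:
  assumes "homogeneous_type M d A\<^sub>0 C\<^sub>\<mu>" "x \<in> space M" "0 < r"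
  shows "qball M d x r \<in> sets M"
proof -
  have "sets M = sigma_sets (space M)
       ({U. openin (qtopology M d) U} \<union> {qball M d x r | x r. x \<in> space M \<and> 0 < r})"
    using assms(1) unfolding homogeneous_type_def by blast
  then show ?thesis using assms(2,3) by (auto intro!: sigma_sets.Basic)
qed

lemma qball_doubling:
  assumes "homogeneous_type M d A\<^sub>0 C\<^sub>\<mu>" "x \<in> space M" "0 < r"
  shows "0 < C\<^sub>\<mu>" "0 < emeasure M (qball M d x r)" "emeasure M (qball M d x r) < \<infinity>"
    "emeasure M (qball M d x (r * 2 ^ n)) \<le> ennreal (C\<^sub>\<mu> ^ n) * emeasure M (qball M d x r)"
proof -
  have *: "\<And>r. r > 0 \<Longrightarrow> 0 < emeasure M (qball M d x (2 * r)) \<and>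
      emeasure M (qball M d x (2 * r)) \<le> ennreal C\<^sub>\<mu> * emeasure M (qball M d x r) \<and>
      ennreal C\<^sub>\<mu> * emeasure M (qball M d x r) < \<infinity>"
    using assms(1,2) unfolding homogeneous_type_def by blast
  show C: "0 < C\<^sub>\<mu>"
  proof (rule ccontr)
    assume "\<not> 0 < C\<^sub>\<mu>"
    then have "ennreal C\<^sub>\<mu> = 0" by (simp add: ennreal_neg)
    then show False using *[OF assms(3)] by auto
  qed
  show "0 < emeasure M (qball M d x r)" using *[of "r / 2"] assms(3) by simp
  show "emeasure M (qball M d x r) < \<infinity>"
    using *[OF assms(3)] C by (auto simp: ennreal_mult_less_top)
  show "emeasure M (qball M d x (r * 2 ^ n)) \<le> ennreal (C\<^sub>\<mu> ^ n) * emeasure M (qball M d x r)"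
  proof (induction n)
    case (Suc n)
    have "emeasure M (qball M d x (r * 2 ^ Suc n)) \<le>
        ennreal C\<^sub>\<mu> * emeasure M (qball M d x (r * 2 ^ n))"
      using *[of "r * 2 ^ n"] assms(3) by (simp add: mult_ac)
    also have "\<dots> \<le> ennreal C\<^sub>\<mu> * (ennreal (C\<^sub>\<mu> ^ n) * emeasure M (qball M d x r))"
      by (intro mult_left_mono Suc) simp
    also have "\<dots> = ennreal (C\<^sub>\<mu> ^ Suc n) * emeasure M (qball M d x r)"
      using C by (simp add: ennreal_mult mult_ac)
    finally show ?case .
  qed simp
qed

lemma qball_mono: "r \<le> s \<Longrightarrow> qball M d x r \<subseteq> qball M d x s"
  by (auto simp: qball_def)

text \<open>The number \<open>n\<close> of doublings from the inner to the outer ball of a cube depends only on \<open>a\<^sub>1\<close> and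
  \<open>A\<^sub>1\<close>, so the constants below do not depend on the lattice.\<close>

lemma cube_in_ball:
  assumes h: "homogeneous_type M d A\<^sub>0 C\<^sub>\<mu>" and D: "dyadic_lattice M d \<delta>\<^sub>0 a\<^sub>1 A\<^sub>1 D"
    and Q: "Q \<in> cubes D" and n: "A\<^sub>1 \<le> a\<^sub>1 * 2 ^ n"
  obtains z r where "z \<in> space M" "0 < r" "Q \<subseteq> qball M d z r"
    "emeasure M (qball M d z r) \<le> ennreal (C\<^sub>\<mu> ^ n) * emeasure M Q"
    "emeasure M (qball M d z r) < \<infinity>" "0 < emeasure M Q" "Q \<in> sets M"
proof -
  obtain k where k: "Q \<in> D k" using Q by (auto simp: cubes_def)
  note D' = D[unfolded dyadic_lattice_def]
  have pos: "0 < \<delta>\<^sub>0" "0 < a\<^sub>1" "a\<^sub>1 \<le> A\<^sub>1"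
    using conjunct1[OF D'] D'[THEN conjunct2, THEN conjunct2] by simp_all
  have D_meas: "\<forall>k. countable (D k) \<and> D k \<subseteq> sets M" using D' by (elim conjE)
  have meas: "Q \<in> sets M" using D_meas k by blast
  have "\<exists>c. \<forall>k. \<forall>Q\<in>D k. c k Q \<in> space M \<and> qball M d (c k Q) (a\<^sub>1 * \<delta>\<^sub>0 powi k) \<subseteq> Q \<and>
      Q \<subseteq> qball M d (c k Q) (A\<^sub>1 * \<delta>\<^sub>0 powi k)"
    using D' by (elim conjE exE) (rule exI)
  then obtain c where c: "\<forall>k. \<forall>Q\<in>D k. c k Q \<in> space M \<and>
      qball M d (c k Q) (a\<^sub>1 * \<delta>\<^sub>0 powi k) \<subseteq> Q \<and> Q \<subseteq> qball M d (c k Q) (A\<^sub>1 * \<delta>\<^sub>0 powi k)"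
    by (elim exE)
  define z where "z = c k Q"
  have z: "z \<in> space M" "qball M d z (a\<^sub>1 * \<delta>\<^sub>0 powi k) \<subseteq> Q" "Q \<subseteq> qball M d z (A\<^sub>1 * \<delta>\<^sub>0 powi k)"
    using c k by (simp_all add: z_def)
  define b where "b = a\<^sub>1 * \<delta>\<^sub>0 powi k"
  define r where "r = A\<^sub>1 * \<delta>\<^sub>0 powi k"
  have br: "0 < b" "0 < r" "r \<le> b * 2 ^ n"
    using pos n by (auto simp: b_def r_def mult_ac intro!: mult_left_mono)
  have le: "emeasure M (qball M d z b) \<le> emeasure M Q" using z meas by (intro emeasure_mono) (auto simp: b_def)
  have "emeasure M (qball M d z r) \<le> emeasure M (qball M d z (b * 2 ^ n))"
    using br z(1) by (intro emeasure_mono qball_mono qball_measurable[OF h]) auto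
  also have "\<dots> \<le> ennreal (C\<^sub>\<mu> ^ n) * emeasure M (qball M d z b)"
    using qball_doubling(4)[OF h z(1) br(1)] .
  also have "\<dots> \<le> ennreal (C\<^sub>\<mu> ^ n) * emeasure M Q" by (intro mult_left_mono le) auto
  finally have up: "emeasure M (qball M d z r) \<le> ennreal (C\<^sub>\<mu> ^ n) * emeasure M Q" .
  have "0 < emeasure M Q" using qball_doubling(2)[OF h z(1) br(1)] le by (rule order_less_le_trans)
  moreover have "Q \<subseteq> qball M d z r" using z(3) by (simp add: r_def)
  ultimately show ?thesis
    using that[OF z(1) br(2) _ up qball_doubling(3)[OF h z(1) br(2)] _ meas] by metis
qed

lemma wmeasure_cube:
  assumes h: "homogeneous_type M d A\<^sub>0 C\<^sub>\<mu>" and D: "dyadic_lattice M d \<delta>\<^sub>0 a\<^sub>1 A\<^sub>1 D"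
    and Q: "Q \<in> cubes D" and v: "weight M d v"
  shows "0 < emeasure (wmeasure M v) Q" "emeasure (wmeasure M v) Q < \<infinity>"
    "emeasure (wmeasure M v) Q = (\<integral>\<^sup>+x\<in>Q. ennreal (v x) \<partial>M)"
proof -
  have pos: "0 < a\<^sub>1" using D unfolding dyadic_lattice_def by (elim conjE)
  obtain n :: nat where "A\<^sub>1 / a\<^sub>1 < 2 ^ n" using real_arch_pow[of 2] by auto
  then have n: "A\<^sub>1 \<le> a\<^sub>1 * 2 ^ n" using pos by (simp add: field_simps)
  obtain z r where zr: "z \<in> space M" "0 < r" "Q \<subseteq> qball M d z r" "0 < emeasure M Q"
    and meas[measurable]: "Q \<in> sets M"
    using cube_in_ball[OF h D Q n] by metis
  have v_meas[measurable]: "v \<in> borel_measurable M" and v_pos: "AE x in M. 0 < v x"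
    and v_int: "set_integrable M (qball M d z r) v"
    using v zr(1,2) by (auto simp: weight_def)
  show eq: "emeasure (wmeasure M v) Q = (\<integral>\<^sup>+x\<in>Q. ennreal (v x) \<partial>M)"
    unfolding wmeasure_def by (rule emeasure_density) auto
  have "(\<integral>\<^sup>+x\<in>Q. ennreal (v x) \<partial>M) \<le> (\<integral>\<^sup>+x. ennreal (norm (indicator (qball M d z r) x *\<^sub>R v x)) \<partial>M)"
    using zr(3) by (intro nn_integral_mono) (auto simp: indicator_def intro!: ennreal_leI)
  also have "\<dots> < \<infinity>" using v_int unfolding set_integrable_def by (simp add: integrable_iff_bounded)
  finally show "emeasure (wmeasure M v) Q < \<infinity>" unfolding eq .
  show "0 < emeasure (wmeasure M v) Q"
  proof (rule ccontr)
    assume "\<not> 0 < emeasure (wmeasure M v) Q"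
    then have "(\<integral>\<^sup>+x. ennreal (v x) * indicator Q x \<partial>M) = 0" unfolding eq by simp
    then have "AE x in M. ennreal (v x) * indicator Q x = 0"
      by (subst (asm) nn_integral_0_iff_AE) auto
    then have "AE x in M. x \<notin> Q" using v_pos
      by eventually_elim (auto simp: indicator_def ennreal_eq_0_iff split: if_splits)
    then have "emeasure M Q = 0"
      by (rule AE_iff_measurable[OF meas, THEN iffD1, rotated]) (use sets.sets_into_space[OF meas] in blast)
    then show False using zr(4) by simp
  qed
qed

lemma carleson_sparse:
  assumes S: "finite S" "S \<subseteq> sets M" and fin: "\<And>Q. Q \<in> S \<Longrightarrow> emeasure M Q < \<infinity>"
    and sp: "sparse_family M \<delta> S" and \<delta>: "0 < \<delta>"
  shows "carleson S (measure M) (1 / \<delta>) (measure M)"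
  unfolding carleson_def
proof
  fix Q assume Q: "Q \<in> S"
  obtain E where E': "\<forall>R\<in>S. E R \<in> sets M \<and> E R \<subseteq> R \<and> ennreal \<delta> * emeasure M R \<le> emeasure M (E R)"
    and dis: "disjoint_family_on E S"
    using sp unfolding sparse_family_def by (elim exE conjE)
  have E: "\<And>R. R \<in> S \<Longrightarrow> E R \<in> sets M" "\<And>R. R \<in> S \<Longrightarrow> E R \<subseteq> R"
      "\<And>R. R \<in> S \<Longrightarrow> ennreal \<delta> * emeasure M R \<le> emeasure M (E R)"
    using E' by simp_all
  have meas: "R \<in> sets M" if "R \<in> S" for R using S that by blast
  define T where "T = {R\<in>S. R \<subseteq> Q}"
  have T: "finite T" "T \<subseteq> S" using S by (auto simp: T_def)
  have finE: "emeasure M (E R) < \<infinity>" if "R \<in> S" for R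
    using emeasure_mono[OF E(2)[OF that] meas[OF that]] fin[OF that] by (rule order_le_less_trans)
  have "\<delta> * (\<Sum>R\<in>T. measure M R) \<le> (\<Sum>R\<in>T. measure M (E R))"
    unfolding sum_distrib_left
  proof (rule sum_mono)
    fix R assume "R \<in> T"
    then have R: "R \<in> S" using T by blast
    have "ennreal (\<delta> * measure M R) \<le> ennreal (measure M (E R))"
      using E(3)[OF R] fin[OF R] finE[OF R] \<delta>
      by (simp add: emeasure_eq_ennreal_measure ennreal_mult top.not_eq_extremum)
    then show "\<delta> * measure M R \<le> measure M (E R)" by simp
  qed
  also have "\<dots> = measure M (\<Union>R\<in>T. E R)"
    using T E finE disjoint_family_on_mono[OF T(2) dis]
    by (intro measure_finite_Union[symmetric]) (auto simp: top.not_eq_extremum)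
  also have "\<dots> \<le> measure M Q"
    using T E(1,2) fin[OF Q] meas[OF Q]
    by (intro measure_mono_fmeasurable) (auto simp: fmeasurable_def T_def subset_eq intro!: sets.finite_UN)
  finally show "(\<Sum>R\<in>{R\<in>S. R \<subseteq> Q}. measure M R) \<le> 1 / \<delta> * measure M Q"
    using \<delta> by (simp add: T_def field_simps)
qed

text \<open>Since \<open>\<mu>(R) \<le> \<mu>(E\<^sub>R) / \<delta>\<close>, the sum of the \<open>v(R)\<close> is at most \<open>1 / \<delta>\<close> times the integral of the
  function equal to \<open>\<langle>v\<rangle>\<^sub>R\<close> on each \<open>E\<^sub>R\<close>, and doubling bounds this function by the maximal function
  of \<open>v \<chi>\<^sub>Q\<close>.\<close>

lemma carleson_A_infty:
  assumes h: "homogeneous_type M d A\<^sub>0 C\<^sub>\<mu>" and D: "dyadic_lattice M d \<delta>\<^sub>0 a\<^sub>1 A\<^sub>1 D"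
    and v: "v \<in> A_infty M d D" and n: "A\<^sub>1 \<le> a\<^sub>1 * 2 ^ n"
    and S: "finite S" "S \<subseteq> cubes D" and sp: "sparse_family M \<delta> S" and \<delta>: "0 < \<delta>"
  shows "carleson S (measure (wmeasure M v)) (C\<^sub>\<mu> ^ n / \<delta> * enn2real (A_infty_const M d D v))
    (measure (wmeasure M v))"
  unfolding carleson_def
proof
  fix Q assume Q: "Q \<in> S"
  define V where "V = emeasure (wmeasure M v)"
  define A where "A = A_infty_const M d D v"
  have w: "weight M d v" and A: "A < \<infinity>" using v by (auto simp: A_infty_def A_def)
  have C: "0 < C\<^sub>\<mu>"
  proof -
    have "space M \<noteq> {}" using h unfolding homogeneous_type_def by (elim conjE)
    then obtain z where "z \<in> space M" by blast
    then show ?thesis using qball_doubling(1)[OF h, of z 1] by simp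
  qed
  have cube: "R \<in> cubes D" if "R \<in> S" for R using that S(2) by blast
  have V: "0 < V R" "V R < \<infinity>" "V R = (\<integral>\<^sup>+x\<in>R. ennreal (v x) \<partial>M)" if "R \<in> S" for R
    using wmeasure_cube[OF h D cube[OF that] w] by (auto simp: V_def)
  obtain E where E': "\<forall>R\<in>S. E R \<in> sets M \<and> E R \<subseteq> R \<and> ennreal \<delta> * emeasure M R \<le> emeasure M (E R)"
    and dis: "disjoint_family_on E S"
    using sp unfolding sparse_family_def by (elim exE conjE)
  have E: "\<And>R. R \<in> S \<Longrightarrow> E R \<in> sets M" "\<And>R. R \<in> S \<Longrightarrow> E R \<subseteq> R"
      "\<And>R. R \<in> S \<Longrightarrow> ennreal \<delta> * emeasure M R \<le> emeasure M (E R)"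
    using E' by simp_all
  define T where "T = {R\<in>S. R \<subseteq> Q}"
  have T: "finite T" "T \<subseteq> S" using S by (auto simp: T_def)
  have meas: "R \<in> sets M" if "R \<in> S" for R
    using cube_in_ball[OF h D cube[OF that] n] by metis
  have \<mu>: "0 < emeasure M R" "emeasure M R < \<infinity>" if R: "R \<in> S" for R
  proof -
    obtain z r where zr: "z \<in> space M" "0 < r" "R \<subseteq> qball M d z r" "0 < emeasure M R"
        "emeasure M (qball M d z r) < \<infinity>"
      using cube_in_ball[OF h D cube[OF R] n] by metis
    show "0 < emeasure M R" by fact
    show "emeasure M R < \<infinity>"
      using emeasure_mono[OF zr(3) qball_measurable[OF h zr(1,2)]] zr(5) by (rule order_le_less_trans)
  qed
  define b where "b R = V R / emeasure M R" for R
  define F where "F x = (\<Sum>R\<in>T. b R * indicator (E R) x)" for x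
  have "ennreal \<delta> * (\<Sum>R\<in>T. V R) \<le> (\<Sum>R\<in>T. b R * emeasure M (E R))"
    unfolding sum_distrib_left
  proof (rule sum_mono)
    fix R assume "R \<in> T"
    then have R: "R \<in> S" using T by blast
    have "V R = b R * emeasure M R"
      using \<mu>[OF R] by (simp add: b_def ennreal_divide_times divide_self)
    then have "ennreal \<delta> * V R = b R * (ennreal \<delta> * emeasure M R)" by (simp add: mult_ac)
    also have "\<dots> \<le> b R * emeasure M (E R)" using E(3)[OF R] by (intro mult_left_mono) auto
    finally show "ennreal \<delta> * V R \<le> b R * emeasure M (E R)" .
  qed
  also have "\<dots> = (\<integral>\<^sup>+x. F x \<partial>M)"
  proof -
    have "(\<integral>\<^sup>+x. F x \<partial>M) = (\<Sum>R\<in>T. \<integral>\<^sup>+x. b R * indicator (E R) x \<partial>M)"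
      unfolding F_def using E(1) T(2) by (intro nn_integral_sum) auto
    also have "\<dots> = (\<Sum>R\<in>T. b R * emeasure M (E R))"
      using E(1) T(2) by (intro sum.cong refl nn_integral_cmult_indicator) auto
    finally show ?thesis by simp
  qed
  finally have 1: "ennreal \<delta> * (\<Sum>R\<in>T. V R) \<le> (\<integral>\<^sup>+x. F x \<partial>M)" .
  have pointwise: "ennreal (1 / C\<^sub>\<mu> ^ n) * F x \<le> HL_maximal M d (\<lambda>y. v y * indicator Q y) x * indicator Q x" for x
  proof (cases "\<exists>R\<in>T. x \<in> E R")
    case False
    then have "F x = 0" by (auto simp: F_def indicator_def)
    then show ?thesis by simp
  next
    case True
    then obtain R where R: "R \<in> T" "x \<in> E R" by blast
    then have RS: "R \<in> S" and RQ: "R \<subseteq> Q" using T(2) by (auto simp: T_def)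
    have "indicator (E R') x = (0::ennreal)" if "R' \<in> T - {R}" for R'
      using that R RS T(2) dis by (auto simp: disjoint_family_on_def indicator_def)
    then have "F x = b R * indicator (E R) x + (\<Sum>R'\<in>T - {R}. 0)"
      unfolding F_def sum.remove[OF T(1) R(1)] by (intro arg_cong2[where f = plus] sum.cong) auto
    then have Fx: "F x = b R" using R by simp
    have xQ: "x \<in> Q" using R(2) E(2)[OF RS] RQ by blast
    obtain z r where zr: "z \<in> space M" "0 < r" "R \<subseteq> qball M d z r"
        "emeasure M (qball M d z r) \<le> ennreal (C\<^sub>\<mu> ^ n) * emeasure M R"
        "emeasure M (qball M d z r) < \<infinity>"
      using cube_in_ball[OF h D cube[OF RS] n] by metis
    define B where "B = qball M d z r"
    have "0 < emeasure M B" using qball_doubling(2)[OF h zr(1,2)] by (simp add: B_def)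
    obtain m where m: "emeasure M R = ennreal m" "0 < m"
      using \<mu>[OF RS] by (cases "emeasure M R") auto
    obtain t where t: "V R = ennreal t" "0 < t" using V(1,2)[OF RS] by (cases "V R") auto
    obtain \<beta> where \<beta>: "emeasure M B = ennreal \<beta>" "0 < \<beta>"
      using \<open>0 < emeasure M B\<close> zr(5) by (cases "emeasure M B") (auto simp: B_def)
    have "ennreal \<beta> \<le> ennreal (C\<^sub>\<mu> ^ n * m)"
      using zr(4) C m \<beta> by (simp add: B_def ennreal_mult)
    then have le: "\<beta> \<le> C\<^sub>\<mu> ^ n * m" using C m by (subst (asm) ennreal_le_iff) auto
    have "1 / C\<^sub>\<mu> ^ n * (t / m) = t / (C\<^sub>\<mu> ^ n * m)" by simp
    also have "\<dots> \<le> t / \<beta>" using le t \<beta> C m by (intro divide_left_mono) auto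
    finally have "ennreal (1 / C\<^sub>\<mu> ^ n) * b R \<le> V R / emeasure M B"
      unfolding b_def t m \<beta> using C t m \<beta>
      by (simp add: divide_ennreal ennreal_mult[symmetric] ennreal_leI)
    also have "\<dots> \<le> avg M (\<lambda>y. ennreal \<bar>v y * indicator Q y\<bar>) B"
      unfolding avg_def V(3)[OF RS] using RQ zr(3)
      by (intro divide_right_mono_ennreal nn_integral_mono)
        (auto simp: indicator_def B_def intro!: ennreal_leI)
    also have "\<dots> \<le> HL_maximal M d (\<lambda>y. v y * indicator Q y) x"
      unfolding HL_maximal_def using zr R(2) E(2)[OF RS] by (intro SUP_upper) (auto simp: B_def)
    finally show ?thesis using Fx xQ by simp
  qed
  have "ennreal (1 / C\<^sub>\<mu> ^ n) * (\<integral>\<^sup>+x. F x \<partial>M) = (\<integral>\<^sup>+x. ennreal (1 / C\<^sub>\<mu> ^ n) * F x \<partial>M)"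
    unfolding F_def using E(1) T(2)
    by (intro nn_integral_cmult[symmetric] borel_measurable_sum) auto
  also have "\<dots> \<le> (\<integral>\<^sup>+x\<in>Q. HL_maximal M d (\<lambda>y. v y * indicator Q y) x \<partial>M)"
    by (intro nn_integral_mono pointwise)
  also have "\<dots> \<le> A * V Q"
  proof -
    have "(\<integral>\<^sup>+x\<in>Q. HL_maximal M d (\<lambda>y. v y * indicator Q y) x \<partial>M) / V Q \<le> A"
      unfolding A_def A_infty_const_def V_def using cube[OF Q] by (intro SUP_upper)
    then have "(\<integral>\<^sup>+x\<in>Q. HL_maximal M d (\<lambda>y. v y * indicator Q y) x \<partial>M) / V Q * V Q \<le> A * V Q"
      by (intro mult_right_mono) auto
    then show ?thesis using V(1,2)[OF Q] by (simp add: ennreal_divide_times divide_self)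
  qed
  finally have 2: "ennreal (1 / C\<^sub>\<mu> ^ n) * (\<integral>\<^sup>+x. F x \<partial>M) \<le> A * V Q" .
  have "ennreal (1 / C\<^sub>\<mu> ^ n) * (ennreal \<delta> * (\<Sum>R\<in>T. V R)) \<le> A * V Q"
    using 1 2 by (meson mult_left_mono order_trans zero_le)
  moreover have VR: "V R = ennreal (measure (wmeasure M v) R)" if "R \<in> S" for R
    unfolding V_def using V(2)[OF that]
    by (intro emeasure_eq_ennreal_measure) (simp add: V_def)
  moreover have "(\<Sum>R\<in>T. V R) = ennreal (\<Sum>R\<in>T. measure (wmeasure M v) R)"
  proof -
    have "(\<Sum>R\<in>T. V R) = (\<Sum>R\<in>T. ennreal (measure (wmeasure M v) R))"
      using VR T(2) by (intro sum.cong) auto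
    then show ?thesis by simp
  qed
  moreover obtain \<alpha> where \<alpha>: "A = ennreal \<alpha>" "0 \<le> \<alpha>" using A by (cases A) auto
  ultimately have "ennreal (1 / C\<^sub>\<mu> ^ n) * (ennreal \<delta> * ennreal (\<Sum>R\<in>T. measure (wmeasure M v) R)) \<le>
      ennreal \<alpha> * ennreal (measure (wmeasure M v) Q)"
    using Q by simp
  then have "ennreal (1 / C\<^sub>\<mu> ^ n * (\<delta> * (\<Sum>R\<in>T. measure (wmeasure M v) R))) \<le>
      ennreal (\<alpha> * measure (wmeasure M v) Q)"
    using C \<delta> \<alpha>(2) by (simp add: ennreal_mult[symmetric] sum_nonneg)
  then have "1 / C\<^sub>\<mu> ^ n * (\<delta> * (\<Sum>R\<in>T. measure (wmeasure M v) R)) \<le>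
      enn2real A * measure (wmeasure M v) Q" using \<alpha> by simp
  then show "(\<Sum>R\<in>{R\<in>S. R \<subseteq> Q}. measure (wmeasure M v) R) \<le>
    C\<^sub>\<mu> ^ n / \<delta> * enn2real (A_infty_const M d D v) * measure (wmeasure M v) Q"
    using C \<delta> by (simp add: T_def A_def field_simps)
qed

section \<open>Extended powers and exhaustion by finite families\<close>

lemma epowr_ennreal: "0 \<le> r \<Longrightarrow> a \<noteq> 0 \<Longrightarrow> ennreal r powr\<^sub>\<infinity> a = ennreal (r powr a)"
  by (simp add: epowr_def)

lemma epowr_ennreal_pos: "0 < r \<Longrightarrow> ennreal r powr\<^sub>\<infinity> a = ennreal (r powr a)"
  by (simp add: epowr_def)



lemma epowr_mono:
  assumes "x \<le> y" "0 \<le> a"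
  shows "x powr\<^sub>\<infinity> a \<le> y powr\<^sub>\<infinity> a"
proof (cases "a = 0 \<or> y = \<infinity>")
  case True then show ?thesis by (auto simp: epowr_def)
next
  case False
  then obtain r s where "y = ennreal s" "0 \<le> s" "x = ennreal r" "0 \<le> r" "r \<le> s"
    using assms(1) by (cases y; cases x) (auto simp: top_unique)
  then show ?thesis using False assms(2) by (auto simp: epowr_ennreal intro!: ennreal_leI powr_mono2)
qed

lemma epowr_epowr:
  assumes "0 < a" "0 < b"
  shows "(x powr\<^sub>\<infinity> a) powr\<^sub>\<infinity> b = x powr\<^sub>\<infinity> (a * b)"
  using assms by (cases x) (auto simp: epowr_ennreal powr_powr, auto simp: epowr_def)

lemma epowr_one [simp]: "x powr\<^sub>\<infinity> 1 = x"
  by (cases x) (auto simp: epowr_ennreal, auto simp: epowr_def)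

lemma borel_measurable_epowr [measurable (raw)]:
  assumes [measurable]: "f \<in> borel_measurable N"
  shows "(\<lambda>x. f x powr\<^sub>\<infinity> a) \<in> borel_measurable N"
  unfolding epowr_def by measurable

text \<open>The power is an order isomorphism of \<open>[0, \<infinity>]\<close>, with inverse the power \<open>1 / a\<close>.\<close>

lemma epowr_SUP_le:
  fixes y :: "'i \<Rightarrow> ennreal"
  assumes a: "0 < a"
  shows "(SUP n\<in>A. y n) powr\<^sub>\<infinity> a \<le> (SUP n\<in>A. y n powr\<^sub>\<infinity> a)"
proof -
  define z where "z = (SUP n\<in>A. y n powr\<^sub>\<infinity> a)"
  have "y n \<le> z powr\<^sub>\<infinity> (1 / a)" if "n \<in> A" for n
  proof -
    have "y n = (y n powr\<^sub>\<infinity> a) powr\<^sub>\<infinity> (1 / a)" using a by (simp add: epowr_epowr)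
    also have "\<dots> \<le> z powr\<^sub>\<infinity> (1 / a)"
      unfolding z_def using a that by (intro epowr_mono SUP_upper) auto
    finally show ?thesis .
  qed
  then have "(SUP n\<in>A. y n) powr\<^sub>\<infinity> a \<le> (z powr\<^sub>\<infinity> (1 / a)) powr\<^sub>\<infinity> a"
    using a by (intro epowr_mono SUP_least) auto
  also have "\<dots> = z" using a by (simp add: epowr_epowr)
  finally show ?thesis by (simp add: z_def)
qed

text \<open>Monotone convergence along an enumeration of \<open>S\<close>: it suffices to treat finite families.\<close>

lemma nn_integral_epowr_infsum_le:
  fixes g :: "'b \<Rightarrow> 'a \<Rightarrow> ennreal"
  assumes S: "countable S" and a: "0 < a"
    and g: "\<And>Q. Q \<in> S \<Longrightarrow> g Q \<in> borel_measurable N"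
    and le: "\<And>F. finite F \<Longrightarrow> F \<subseteq> S \<Longrightarrow> (\<integral>\<^sup>+x. (\<Sum>Q\<in>F. g Q x) powr\<^sub>\<infinity> a \<partial>N) \<le> B"
  shows "(\<integral>\<^sup>+x. (\<Sum>\<^sub>\<infinity>Q\<in>S. g Q x) powr\<^sub>\<infinity> a \<partial>N) \<le> B"
proof (cases "S = {}")
  case True
  then show ?thesis using le[of "{}"] by simp
next
  case False
  define F where "F n = from_nat_into S ` {..<n}" for n :: nat
  have F: "finite (F n)" "F n \<subseteq> S" for n
    using from_nat_into[OF False] by (auto simp: F_def)
  have mono: "F i \<subseteq> F j" if "i \<le> j" for i j using that by (auto simp: F_def)
  have cover: "\<exists>n. G \<subseteq> F n" if G: "finite G" "G \<subseteq> S" for G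
  proof -
    have "G \<subseteq> range (from_nat_into S)" using range_from_nat_into[OF False S] G(2) by simp
    then obtain K where K: "finite K" "G = from_nat_into S ` K"
      using finite_subset_image[OF G(1)] by metis
    then obtain n where "\<forall>k\<in>K. k < n" using finite_nat_set_iff_bounded by blast
    then show ?thesis using K(2) by (intro exI[of _ n]) (auto simp: F_def)
  qed
  have "(\<Sum>\<^sub>\<infinity>Q\<in>S. g Q x) \<le> (SUP n. \<Sum>Q\<in>F n. g Q x)" for x
  proof -
    have "(\<Sum>\<^sub>\<infinity>Q\<in>S. g Q x) = (SUP G\<in>{G. finite G \<and> G \<subseteq> S}. \<Sum>Q\<in>G. g Q x)"
      by (rule nonneg_infsum_complete) simp
    also have "\<dots> \<le> (SUP n. \<Sum>Q\<in>F n. g Q x)"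
    proof (rule SUP_mono)
      fix G assume "G \<in> {G. finite G \<and> G \<subseteq> S}"
      then have "\<exists>n. G \<subseteq> F n" by (intro cover) auto
      then obtain n where "G \<subseteq> F n" by (elim exE)
      then show "\<exists>n\<in>UNIV. (\<Sum>Q\<in>G. g Q x) \<le> (\<Sum>Q\<in>F n. g Q x)"
        using F(1) by (intro bexI[of _ n] sum_mono2) auto
    qed
    finally show ?thesis .
  qed
  then have "(\<integral>\<^sup>+x. (\<Sum>\<^sub>\<infinity>Q\<in>S. g Q x) powr\<^sub>\<infinity> a \<partial>N) \<le>
      (\<integral>\<^sup>+x. (SUP n. (\<Sum>Q\<in>F n. g Q x) powr\<^sub>\<infinity> a) \<partial>N)"
    using a by (intro nn_integral_mono order_trans[OF epowr_mono epowr_SUP_le]) auto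
  also have "\<dots> = (SUP n. \<integral>\<^sup>+x. (\<Sum>Q\<in>F n. g Q x) powr\<^sub>\<infinity> a \<partial>N)"
  proof (rule nn_integral_monotone_convergence_SUP)
    show "incseq (\<lambda>n x. (\<Sum>Q\<in>F n. g Q x) powr\<^sub>\<infinity> a)"
      using a F(1) mono by (auto simp: incseq_def le_fun_def intro!: epowr_mono sum_mono2)
    show "(\<lambda>x. (\<Sum>Q\<in>F n. g Q x) powr\<^sub>\<infinity> a) \<in> borel_measurable N" for n
      using F(2) g by (intro borel_measurable_epowr borel_measurable_sum) auto
  qed
  also have "\<dots> \<le> B" using le F by (intro SUP_least) auto
  finally show ?thesis .
qed

text \<open>The substitution \<open>\<bar>f\<bar> ^ p\<^sub>0 = g v\<close>, which turns the norm of \<open>f\<close> in \<open>L ^ p\<close> with weight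
  \<open>v ^ (1 - p / p\<^sub>0)\<close> into a norm of \<open>g\<close> in \<open>L ^ (p / p\<^sub>0)\<close> with weight \<open>v\<close>.\<close>

lemma
  fixes h v :: "'a \<Rightarrow> real" and p p\<^sub>0 :: real
  assumes h[measurable]: "h \<in> borel_measurable M" and h0: "\<And>x. 0 \<le> h x"
    and v[measurable]: "v \<in> borel_measurable M" and v_pos: "AE x in M. 0 < v x"
    and p: "0 < p\<^sub>0"
  shows nn_integral_substitution:
    "Q \<in> sets M \<Longrightarrow> (\<integral>\<^sup>+x\<in>Q. ennreal (h x powr p\<^sub>0 / \<bar>v x\<bar>) \<partial>wmeasure M v) = (\<integral>\<^sup>+x\<in>Q. ennreal (h x powr p\<^sub>0) \<partial>M)"
    and nn_integral_substitution_powr: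
    "(\<integral>\<^sup>+x. ennreal ((h x powr p\<^sub>0 / \<bar>v x\<bar>) powr (p / p\<^sub>0)) \<partial>wmeasure M v) =
      (\<integral>\<^sup>+x. ennreal (h x powr p) \<partial>wmeasure M (\<lambda>x. v x powr (1 - p / p\<^sub>0)))"
proof -
  have 1: "AE x in M. ennreal (v x) * (ennreal (h x powr p\<^sub>0 / \<bar>v x\<bar>) * indicator Q x) =
      ennreal (h x powr p\<^sub>0) * indicator Q x" for Q
    using v_pos by eventually_elim (auto simp: ennreal_mult[symmetric] indicator_def)
  show "(\<integral>\<^sup>+x\<in>Q. ennreal (h x powr p\<^sub>0 / \<bar>v x\<bar>) \<partial>wmeasure M v) = (\<integral>\<^sup>+x\<in>Q. ennreal (h x powr p\<^sub>0) \<partial>M)"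
    if [measurable]: "Q \<in> sets M"
    unfolding wmeasure_def by (subst nn_integral_density) (auto intro!: nn_integral_cong_AE 1)
  have 2: "AE x in M. ennreal (v x) * ennreal ((h x powr p\<^sub>0 / \<bar>v x\<bar>) powr (p / p\<^sub>0)) =
      ennreal (v x powr (1 - p / p\<^sub>0)) * ennreal (h x powr p)"
    using v_pos
  proof eventually_elim
    case (elim x)
    have "v x * (h x powr p\<^sub>0 / \<bar>v x\<bar>) powr (p / p\<^sub>0) = v x powr (1 - p / p\<^sub>0) * h x powr p"
      using elim h0[of x] p by (simp add: powr_divide powr_powr powr_diff)
    then show ?case using elim by (simp add: ennreal_mult[symmetric])
  qed
  show "(\<integral>\<^sup>+x. ennreal ((h x powr p\<^sub>0 / \<bar>v x\<bar>) powr (p / p\<^sub>0)) \<partial>wmeasure M v) =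
      (\<integral>\<^sup>+x. ennreal (h x powr p) \<partial>wmeasure M (\<lambda>x. v x powr (1 - p / p\<^sub>0)))"
    unfolding wmeasure_def
    by (subst (1 2) nn_integral_density) (auto intro!: nn_integral_cong_AE 2)
qed

lemma nn_integral_finite_on:
  fixes g :: "'a \<Rightarrow> real"
  assumes [measurable]: "g \<in> borel_measurable N" "Q \<in> sets N" and g0: "\<And>x. 0 \<le> g x"
    and Q: "emeasure N Q < \<infinity>" and g: "(\<integral>\<^sup>+x. ennreal (g x powr s) \<partial>N) < \<infinity>" and s: "1 \<le> s"
  shows "(\<integral>\<^sup>+x\<in>Q. ennreal (g x) \<partial>N) < \<infinity>"
proof -
  have "(\<integral>\<^sup>+x\<in>Q. ennreal (g x) \<partial>N) \<le> (\<integral>\<^sup>+x. indicator Q x + ennreal (g x powr s) \<partial>N)"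
  proof (rule nn_integral_mono)
    fix x
    have "g x \<le> 1 + g x powr s"
    proof (cases "g x \<le> 1")
      case False
      then have "g x powr 1 \<le> g x powr s" using s by (intro powr_mono) auto
      then show ?thesis using False by simp
    qed (simp add: add_increasing2)
    then have "ennreal (g x) \<le> 1 + ennreal (g x powr s)"
      using g0[of x] by (metis ennreal_1 ennreal_leI ennreal_plus powr_ge_zero zero_le_one)
    then show "ennreal (g x) * indicator Q x \<le> indicator Q x + ennreal (g x powr s)"
      by (auto simp: indicator_def)
  qed
  also have "\<dots> = emeasure N Q + (\<integral>\<^sup>+x. ennreal (g x powr s) \<partial>N)"
    by (subst nn_integral_add) auto
  also have "\<dots> < \<infinity>" using Q g by simp
  finally show ?thesis .
qed

section \<open>The norm estimate for finite sparse families\<close>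

text \<open>The data of the estimate for a finite family: \<open>U\<close> is the measure with density \<open>u\<close>, \<open>V i Q\<close> is
  \<open>\<sigma>\<^sub>i(Q)\<close>, \<open>a i Q\<close> is the \<open>\<sigma>\<^sub>i\<close>-average of \<open>g\<^sub>i\<close>, \<open>\<Lambda> i\<close> and \<open>\<Lambda>\<^sub>0\<close> are Carleson constants, \<open>N i\<close> controls the
  norm of \<open>g\<^sub>i\<close> to the power \<open>s i\<close>, and \<open>K\<close> bounds the two-weight constant.\<close>

definition sparse_data :: "'i set \<Rightarrow> ('i \<Rightarrow> real) \<Rightarrow> real \<Rightarrow> real \<Rightarrow> 'a set set \<Rightarrow> 'a measure \<Rightarrow>
    ('a set \<Rightarrow> real) \<Rightarrow> ('i \<Rightarrow> 'a set \<Rightarrow> real) \<Rightarrow> ('i \<Rightarrow> 'a set \<Rightarrow> real) \<Rightarrow> real \<Rightarrow>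
    ('i \<Rightarrow> real) \<Rightarrow> real \<Rightarrow> ('i \<Rightarrow> real) \<Rightarrow> bool" where
  "sparse_data I s t \<Delta> S U \<mu> V a K \<Lambda> \<Lambda>\<^sub>0 N \<longleftrightarrow>
     sparse_system S I \<mu> V \<Delta> \<and>
     (\<forall>Q\<in>S. Q \<in> sets U \<and> 0 < emeasure U Q \<and> emeasure U Q < \<infinity>) \<and>
     (\<forall>i\<in>I. \<forall>Q\<in>S. 0 < a i Q) \<and>
     (\<forall>i\<in>I. 0 \<le> \<Lambda> i \<and> carleson S (V i) (\<Lambda> i) (V i)) \<and>
     0 \<le> \<Lambda>\<^sub>0 \<and> carleson S (measure U) \<Lambda>\<^sub>0 (measure U) \<and>
     (\<forall>i\<in>I. \<forall>T\<subseteq>S. (\<Sum>F\<in>principal_sets T (dyadic_level T (a i)). 2 powr (s i * dyadic_level T (a i) F) * V i F) \<le> N i) \<and>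
     0 \<le> K \<and> (\<forall>Q\<in>S. measure U Q / \<mu> Q * (\<Prod>i\<in>I. (V i Q / \<mu> Q) powr (t * (1 - 1 / s i))) \<le> K)"

text \<open>The coefficient of \<open>\<chi>\<^sub>Q\<close> in the \<open>\<gamma>\<close>-th power of the sparse operator, after the substitution.\<close>

definition sparse_coeff :: "'i set \<Rightarrow> ('i \<Rightarrow> real) \<Rightarrow> real \<Rightarrow> real \<Rightarrow>
    ('a set \<Rightarrow> real) \<Rightarrow> ('i \<Rightarrow> 'a set \<Rightarrow> real) \<Rightarrow> ('i \<Rightarrow> 'a set \<Rightarrow> real) \<Rightarrow> 'a set \<Rightarrow> real" where
  "sparse_coeff I s r t \<mu> V a Q =
     \<mu> Q powr (r * ((\<Sum>i\<in>I. 1 / s i) - 1 / t)) * (\<Prod>i\<in>I. (a i Q * (V i Q / \<mu> Q)) powr r)"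

text \<open>The dependence of the bounds on the \<open>A\<^sub>\<infinity>\<close> constants, as in the theorem.\<close>

definition A_infty_factor :: "'i set \<Rightarrow> ('i \<Rightarrow> real) \<Rightarrow> real \<Rightarrow> ('i \<Rightarrow> real) \<Rightarrow> real \<Rightarrow> real" where
  "A_infty_factor I e e\<^sub>0 \<Lambda> \<Lambda>\<^sub>0 =
     (\<Prod>i\<in>I. \<Lambda> i powr e i) + \<Lambda>\<^sub>0 powr e\<^sub>0 * (\<Sum>j\<in>I. \<Prod>i\<in>I - {j}. \<Lambda> i powr e i)"

lemma A_infty_factor_nonneg: "0 \<le> A_infty_factor I e e\<^sub>0 \<Lambda> \<Lambda>\<^sub>0"
  unfolding A_infty_factor_def
  by (intro add_nonneg_nonneg mult_nonneg_nonneg sum_nonneg prod_nonneg) auto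

lemma sum_powr_le_powr_sum:
  fixes y :: "'b \<Rightarrow> real"
  assumes "finite A" "\<And>x. x \<in> A \<Longrightarrow> 0 \<le> y x" "1 \<le> e"
  shows "(\<Sum>x\<in>A. y x powr e) \<le> (\<Sum>x\<in>A. y x) powr e"
  using sum_prod_powr_le[of "{()}" A "\<lambda>_. y" "\<lambda>_. e"] assms by simp

lemma powr_sum_le_sum_powr:
  fixes y :: "'b \<Rightarrow> real"
  assumes "finite A" "\<And>x. x \<in> A \<Longrightarrow> 0 \<le> y x" "0 < e" "e \<le> 1"
  shows "(\<Sum>x\<in>A. y x) powr e \<le> (\<Sum>x\<in>A. y x powr e)"
proof -
  have "(\<Sum>x\<in>A. y x) = (\<Sum>x\<in>A. (y x powr e) powr (1 / e))"
    using assms by (intro sum.cong) (auto simp: powr_powr)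
  also have "\<dots> \<le> (\<Sum>x\<in>A. y x powr e) powr (1 / e)"
    using assms by (intro sum_powr_le_powr_sum) auto
  finally have "(\<Sum>x\<in>A. y x) powr e \<le> ((\<Sum>x\<in>A. y x powr e) powr (1 / e)) powr e"
    using assms by (intro powr_mono2) (auto intro: sum_nonneg)
  then show ?thesis using assms by (simp add: powr_powr sum_nonneg)
qed

text \<open>As \<open>t / r \<le> 1\<close>, the power of the sum is at most the sum of the powers, so the family decouples and
  every cube contributes on its own.\<close>

lemma sparse_estimate_low:
  assumes I: "finite I" "I \<noteq> {}" and s: "\<And>i. i \<in> I \<Longrightarrow> 1 < s i"
    and rt: "0 < t" "t \<le> r" "1 / t \<le> (\<Sum>i\<in>I. 1 / s i)"
    and data: "sparse_data I s t \<Delta> S U \<mu> V a K \<Lambda> \<Lambda>\<^sub>0 N"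
  shows "(\<integral>\<^sup>+x. ennreal ((\<Sum>Q\<in>S. sparse_coeff I s r t \<mu> V a Q * indicator Q x) powr (t / r)) \<partial>U) \<le>
    ennreal ((\<Prod>i\<in>I. 2 powr t) * K * (\<Prod>i\<in>I. \<Lambda> i powr (t / s i)) * (\<Prod>i\<in>I. N i powr (t / s i)))"
proof -
  define c where "c = sparse_coeff I s r t \<mu> V a"
  note d = data[unfolded sparse_data_def sparse_system_def]
  have S: "finite S" using d by simp
  have U: "\<And>Q. Q \<in> S \<Longrightarrow> Q \<in> sets U" "\<And>Q. Q \<in> S \<Longrightarrow> emeasure U Q = ennreal (measure U Q)"
    using d by (auto intro!: emeasure_eq_ennreal_measure)
  have pos: "\<And>Q. Q \<in> S \<Longrightarrow> 0 < \<mu> Q" "\<And>i Q. i \<in> I \<Longrightarrow> Q \<in> S \<Longrightarrow> 0 < V i Q"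
    "\<And>i Q. i \<in> I \<Longrightarrow> Q \<in> S \<Longrightarrow> 0 < a i Q" and K0: "0 \<le> K"
    using d by auto
  have \<Lambda>: "\<And>i. i \<in> I \<Longrightarrow> 0 \<le> \<Lambda> i" "\<And>i. i \<in> I \<Longrightarrow> carleson S (V i) (\<Lambda> i) (V i)" using d by auto
  have N: "\<And>i. i \<in> I \<Longrightarrow> (\<Sum>F\<in>principal_sets S (dyadic_level S (a i)). 2 powr (s i * dyadic_level S (a i) F) * V i F) \<le> N i"
    using d by blast
  have N0: "0 \<le> N i" if "i \<in> I" for i
  proof -
    have "0 \<le> (\<Sum>F\<in>principal_sets S (dyadic_level S (a i)). 2 powr (s i * dyadic_level S (a i) F) * V i F)"
      using pos(2)[OF that] principal_subset[of S "dyadic_level S (a i)"]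
      by (intro sum_nonneg) (auto simp: less_imp_le)
    then show ?thesis using N[OF that] by linarith
  qed
  have c0: "0 \<le> c Q" for Q by (simp add: c_def sparse_coeff_def prod_nonneg)
  have term_le: "c Q powr (t / r) * measure U Q \<le> K * (\<Prod>i\<in>I. (a i Q powr s i * V i Q) powr (t / s i))"
    if Q: "Q \<in> S" for Q
  proof -
    have m: "0 < \<mu> Q" using pos(1)[OF Q] .
    have si: "0 < s i" if "i \<in> I" for i using s[OF that] by simp
    have "c Q powr (t / r) = \<mu> Q powr (t * ((\<Sum>i\<in>I. 1 / s i) - 1 / t)) *
        (\<Prod>i\<in>I. (a i Q * (V i Q / \<mu> Q)) powr t)"
      unfolding c_def sparse_coeff_def using rt
      by (simp add: powr_mult prod_nonneg prod_powr_distrib powr_powr mult_ac)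
    also have "\<mu> Q powr (t * ((\<Sum>i\<in>I. 1 / s i) - 1 / t)) = (\<Prod>i\<in>I. \<mu> Q powr (t / s i)) / \<mu> Q"
      using m rt by (simp add: right_diff_distrib powr_diff powr_sum[symmetric] sum_distrib_left)
    finally have "c Q powr (t / r) * measure U Q = (measure U Q / \<mu> Q) *
        (\<Prod>i\<in>I. \<mu> Q powr (t / s i) * (a i Q * (V i Q / \<mu> Q)) powr t)"
      by (simp add: prod.distrib)
    also have "(\<Prod>i\<in>I. \<mu> Q powr (t / s i) * (a i Q * (V i Q / \<mu> Q)) powr t) =
        (\<Prod>i\<in>I. (V i Q / \<mu> Q) powr (t * (1 - 1 / s i)) * (a i Q powr s i * V i Q) powr (t / s i))"
    proof (rule prod.cong[OF refl])
      fix i assume i: "i \<in> I"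
      have "t * (1 - 1 / s i) = t - t / s i" by (simp add: right_diff_distrib)
      then show "\<mu> Q powr (t / s i) * (a i Q * (V i Q / \<mu> Q)) powr t =
          (V i Q / \<mu> Q) powr (t * (1 - 1 / s i)) * (a i Q powr s i * V i Q) powr (t / s i)"
        using m pos(2,3)[OF i Q] si[OF i]
        by (simp add: powr_mult powr_divide powr_powr powr_diff)
    qed
    also have "\<dots> = (\<Prod>i\<in>I. (V i Q / \<mu> Q) powr (t * (1 - 1 / s i))) *
        (\<Prod>i\<in>I. (a i Q powr s i * V i Q) powr (t / s i))" by (rule prod.distrib)
    finally have "c Q powr (t / r) * measure U Q =
        (measure U Q / \<mu> Q * (\<Prod>i\<in>I. (V i Q / \<mu> Q) powr (t * (1 - 1 / s i)))) *
        (\<Prod>i\<in>I. (a i Q powr s i * V i Q) powr (t / s i))" by simp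
    also have "\<dots> \<le> K * (\<Prod>i\<in>I. (a i Q powr s i * V i Q) powr (t / s i))"
      using d Q by (intro mult_right_mono) (auto simp: prod_nonneg)
    finally show ?thesis .
  qed
  have sum_le: "(\<Sum>Q\<in>S. a i Q powr s i * V i Q) \<le> 2 powr s i * (\<Lambda> i * N i)" if i: "i \<in> I" for i
  proof -
    define l where "l = dyadic_level S (a i)"
    have ai: "\<forall>Q\<in>S. 0 < a i Q" using pos(3)[OF i] by blast
    have "(\<Sum>Q\<in>S. a i Q powr s i * V i Q) \<le> (\<Sum>Q\<in>S. 2 powr s i * (2 powr (s i * l Q) * V i Q))"
    proof (rule sum_mono)
      fix Q assume Q: "Q \<in> S"
      have "a i Q powr s i \<le> (2 powr (l Q + 1)) powr s i"
        using average_le[OF S ai Q] ai Q s[OF i] by (intro powr_mono2) (auto simp: l_def less_imp_le)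
      also have "\<dots> = 2 powr s i * 2 powr (s i * l Q)"
        by (simp add: powr_powr powr_add[symmetric] algebra_simps)
      finally show "a i Q powr s i * V i Q \<le> 2 powr s i * (2 powr (s i * l Q) * V i Q)"
        using pos(2)[OF i Q] by (simp add: mult_right_mono mult.assoc[symmetric])
    qed
    also have "\<dots> = 2 powr s i * (\<Sum>Q\<in>S. 2 powr (s i * l Q) * V i Q)" by (simp add: sum_distrib_left)
    also have "\<dots> \<le> 2 powr s i * (\<Lambda> i * N i)"
    proof (intro mult_left_mono)
      have "(\<Sum>Q\<in>S. 2 powr (s i * l Q) * V i Q) \<le> \<Lambda> i * (\<Sum>F\<in>principal_sets S l. 2 powr (s i * l F) * V i F)"
        using S \<Lambda>(2)[OF i] pos(2)[OF i]
        by (intro sum_le_sum_principal[where w = "\<lambda>k. 2 powr (s i * k)"]) (auto simp: less_imp_le)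
      also have "\<dots> \<le> \<Lambda> i * N i" using N[OF i] \<Lambda>(1)[OF i] by (intro mult_left_mono) (auto simp: l_def)
      finally show "(\<Sum>Q\<in>S. 2 powr (s i * l Q) * V i Q) \<le> \<Lambda> i * N i" .
    qed simp
    finally show ?thesis .
  qed
  have "(\<integral>\<^sup>+x. ennreal ((\<Sum>Q\<in>S. c Q * indicator Q x) powr (t / r)) \<partial>U) \<le>
      (\<integral>\<^sup>+x. (\<Sum>Q\<in>S. ennreal (c Q powr (t / r)) * indicator Q x) \<partial>U)"
  proof (rule nn_integral_mono)
    fix x
    have "(\<Sum>Q\<in>S. c Q * indicator Q x) powr (t / r) \<le> (\<Sum>Q\<in>S. (c Q * indicator Q x) powr (t / r))"
      using S c0 rt by (intro powr_sum_le_sum_powr) auto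
    then have "ennreal ((\<Sum>Q\<in>S. c Q * indicator Q x) powr (t / r)) \<le>
        ennreal (\<Sum>Q\<in>S. (c Q * indicator Q x) powr (t / r))" by (rule ennreal_leI)
    also have "\<dots> = (\<Sum>Q\<in>S. ennreal ((c Q * indicator Q x) powr (t / r)))" by simp
    also have "\<dots> = (\<Sum>Q\<in>S. ennreal (c Q powr (t / r)) * indicator Q x)"
      using rt by (intro sum.cong) (auto simp: indicator_def)
    finally show "ennreal ((\<Sum>Q\<in>S. c Q * indicator Q x) powr (t / r)) \<le>
        (\<Sum>Q\<in>S. ennreal (c Q powr (t / r)) * indicator Q x)" .
  qed
  also have "\<dots> = (\<Sum>Q\<in>S. ennreal (c Q powr (t / r)) * emeasure U Q)"
    using U(1) by (subst nn_integral_sum) (auto simp: nn_integral_cmult_indicator)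
  also have "\<dots> = ennreal (\<Sum>Q\<in>S. c Q powr (t / r) * measure U Q)"
    using U(2) by (simp add: ennreal_mult[symmetric])
  also have "\<dots> \<le> ennreal ((\<Prod>i\<in>I. 2 powr t) * K * (\<Prod>i\<in>I. \<Lambda> i powr (t / s i)) * (\<Prod>i\<in>I. N i powr (t / s i)))"
  proof (rule ennreal_leI)
    have "(\<Sum>Q\<in>S. c Q powr (t / r) * measure U Q) \<le>
        (\<Sum>Q\<in>S. K * (\<Prod>i\<in>I. (a i Q powr s i * V i Q) powr (t / s i)))"
      by (intro sum_mono term_le)
    also have "\<dots> = K * (\<Sum>Q\<in>S. \<Prod>i\<in>I. (a i Q powr s i * V i Q) powr (t / s i))"
      by (simp add: sum_distrib_left)
    also have "\<dots> \<le> K * (\<Prod>i\<in>I. (\<Sum>Q\<in>S. a i Q powr s i * V i Q) powr (t / s i))"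
    proof (intro mult_left_mono[OF _ K0] sum_prod_powr_le I(1) S)
      show "0 < t / s i" if "i \<in> I" for i using s[OF that] rt by simp
      have "1 = t * (1 / t)" using rt by simp
      also have "\<dots> \<le> t * (\<Sum>i\<in>I. 1 / s i)" using rt by (intro mult_left_mono) auto
      finally show "1 \<le> (\<Sum>i\<in>I. t / s i)" by (simp add: sum_distrib_left)
      show "0 \<le> a i Q powr s i * V i Q" if "i \<in> I" "Q \<in> S" for i Q
        using pos(2)[OF that] by simp
    qed
    also have "\<dots> \<le> K * (\<Prod>i\<in>I. (2 powr s i * (\<Lambda> i * N i)) powr (t / s i))"
    proof (intro mult_left_mono[OF _ K0] prod_mono conjI powr_mono2)
      show "0 \<le> t / s i" if "i \<in> I" for i using s[OF that] rt by simp
      show "0 \<le> (\<Sum>Q\<in>S. a i Q powr s i * V i Q)" if "i \<in> I" for i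
        using pos(2)[OF that] by (intro sum_nonneg) (auto simp: less_imp_le)
    qed (use sum_le in auto)
    also have "(\<Prod>i\<in>I. (2 powr s i * (\<Lambda> i * N i)) powr (t / s i)) =
        (\<Prod>i\<in>I. 2 powr t * (\<Lambda> i powr (t / s i) * N i powr (t / s i)))"
    proof (rule prod.cong[OF refl])
      fix i assume i: "i \<in> I"
      show "(2 powr s i * (\<Lambda> i * N i)) powr (t / s i) = 2 powr t * (\<Lambda> i powr (t / s i) * N i powr (t / s i))"
        using s[OF i] \<Lambda>(1)[OF i] N0[OF i] by (simp add: powr_mult powr_powr)
    qed
    finally show "(\<Sum>Q\<in>S. c Q powr (t / r) * measure U Q) \<le>
        (\<Prod>i\<in>I. 2 powr t) * K * (\<Prod>i\<in>I. \<Lambda> i powr (t / s i)) * (\<Prod>i\<in>I. N i powr (t / s i))"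
      by (simp add: prod.distrib mult_ac)
  qed
  finally show ?thesis by (simp add: c_def)
qed

text \<open>The index 0 is reserved for the dual function.\<close>

definition dual_const :: "nat set \<Rightarrow> (nat \<Rightarrow> real) \<Rightarrow> real \<Rightarrow> real \<Rightarrow> real \<Rightarrow> real" where
  "dual_const I s r t \<Delta> =
    (form_const (insert 0 I) (\<lambda>i. if i = 0 then 1 - r / t else r / s i) (\<lambda>i. if i = 0 then 1 else r) \<Delta> *
      principal_const (1 / (1 - r / t)) powr (1 - r / t)) powr (t / r)"

lemma dual_const_pos:
  assumes "0 < r" "r < t"
  shows "0 < dual_const I s r t \<Delta>"
proof -
  have "0 < principal_const (1 / (1 - r / t))"
    using assms by (intro principal_const_pos) (simp add: field_simps)
  then have "0 < form_const (insert 0 I) (\<lambda>i. if i = 0 then 1 - r / t else r / s i)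
      (\<lambda>i. if i = 0 then 1 else r) \<Delta> * principal_const (1 / (1 - r / t)) powr (1 - r / t)"
    by (intro mult_pos_pos form_const_pos) simp
  then show ?thesis unfolding dual_const_def powr_gt_zero by (rule less_imp_neq[THEN not_sym])
qed

text \<open>Here \<open>t / r > 1\<close>. The function \<open>h = \<Phi> powr (t / r - 1)\<close> realises the duality between \<open>L ^ (t / r)\<close> and
  its dual space, and takes the index 0 in the multilinear form. The form is then bounded by a constant times \<open>T powr \<theta> 0\<close>,
  where \<open>T\<close> is the integral to be estimated and \<open>\<theta> 0 < 1\<close>; since \<open>T\<close> is finite, solving for \<open>T\<close> gives
  the claim.\<close>

lemma sparse_estimate_high:
  fixes I :: "nat set" and s :: "nat \<Rightarrow> real"
  assumes I: "finite I" "I \<noteq> {}" "0 \<notin> I" and s: "\<And>i. i \<in> I \<Longrightarrow> 1 < s i"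
    and rt: "0 < r" "r < t" "1 / t \<le> (\<Sum>i\<in>I. 1 / s i)" and \<Delta>: "0 \<le> \<Delta>"
    and data: "sparse_data I s t \<Delta> S U \<mu> V a K \<Lambda> \<Lambda>\<^sub>0 N"
  shows "(\<integral>\<^sup>+x. ennreal ((\<Sum>Q\<in>S. sparse_coeff I s r t \<mu> V a Q * indicator Q x) powr (t / r)) \<partial>U) \<le>
    ennreal (dual_const I s r t \<Delta> * K * A_infty_factor I (\<lambda>i. r / s i) (1 - r / t) \<Lambda> \<Lambda>\<^sub>0 powr (t / r) *
      (\<Prod>i\<in>I. N i powr (t / s i)))"
proof -
  define J where "J = insert 0 I"
  \<comment> \<open>\<open>1 - r / t\<close> is the reciprocal of the exponent dual to \<open>t / r\<close>\<close>
  define \<theta> where "\<theta> i = (if i = 0 then 1 - r / t else r / s i)" for i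
  define \<rho> where "\<rho> i = (if i = 0 then 1 else r)" for i :: nat
  have t: "0 < t" using rt by simp
  have si: "0 < s i" if "i \<in> I" for i using s[OF that] by simp
  have nz: "i \<noteq> 0" if "i \<in> I" for i using I(3) that by metis
  have J: "finite J" "J \<noteq> {}" using I by (auto simp: J_def)
  have \<theta>0: "0 < \<theta> 0" "\<theta> 0 < 1" "1 - \<theta> 0 = r / t" using rt by (auto simp: \<theta>_def)
  have \<theta>I: "\<theta> i = r / s i" "\<rho> i = r" if "i \<in> I" for i using nz[OF that] by (auto simp: \<theta>_def \<rho>_def)
  have \<theta>: "0 < \<theta> i" "\<theta> i < \<rho> i" if "i \<in> J" for i
    using that \<theta>0 \<theta>I s si rt by (auto simp: J_def \<rho>_def divide_less_eq)
  have sum\<theta>I: "sum \<theta> I = r * (\<Sum>i\<in>I. 1 / s i)"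
    using \<theta>I by (simp add: sum_distrib_left)
  have sum\<theta>: "1 \<le> sum \<theta> J"
  proof -
    have "r * (1 / t) \<le> r * (\<Sum>i\<in>I. 1 / s i)" using rt by (intro mult_left_mono) auto
    then show ?thesis using I \<theta>0 sum\<theta>I by (simp add: J_def)
  qed
  define C where "C = form_const J \<theta> \<rho> \<Delta>"
  have C: "0 < C" by (simp add: C_def form_const_pos)
  define \<kappa> where "\<kappa> = 1 / \<theta> 0"
  have \<kappa>: "1 < \<kappa>" using \<theta>0 by (simp add: \<kappa>_def)
  define c\<^sub>0 where "c\<^sub>0 = principal_const \<kappa>"
  have c\<^sub>0: "0 < c\<^sub>0" using \<kappa> by (simp add: c\<^sub>0_def principal_const_pos)
  define C' where "C' = (C * c\<^sub>0 powr \<theta> 0) powr (t / r)"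
  have C': "0 < C'" using C c\<^sub>0 by (simp add: C'_def)
  have C'_eq: "dual_const I s r t \<Delta> = C'"
    by (simp add: dual_const_def C'_def C_def c\<^sub>0_def \<kappa>_def J_def \<theta>_def[abs_def] \<rho>_def[abs_def])
  define c where "c = sparse_coeff I s r t \<mu> V a"
  note d = data[unfolded sparse_data_def sparse_system_def]
  have S: "finite S" "laminar S" "{} \<notin> S" "S \<subseteq> sets U" using d by auto
  have U: "\<And>Q. Q \<in> S \<Longrightarrow> Q \<in> sets U" "\<And>Q. Q \<in> S \<Longrightarrow> emeasure U Q = ennreal (measure U Q)"
    "\<And>Q. Q \<in> S \<Longrightarrow> emeasure U Q < \<infinity>"
    using d by (auto intro!: emeasure_eq_ennreal_measure)
  have U0: "0 < measure U Q" if Q: "Q \<in> S" for Q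
  proof -
    have "0 < emeasure U Q" using d Q by blast
    then show ?thesis using U(2)[OF Q] by simp
  qed
  have pos: "\<And>Q. Q \<in> S \<Longrightarrow> 0 < \<mu> Q" "\<And>i Q. i \<in> I \<Longrightarrow> Q \<in> S \<Longrightarrow> 0 < V i Q"
    "\<And>i Q. i \<in> I \<Longrightarrow> Q \<in> S \<Longrightarrow> 0 < a i Q" and K0: "0 \<le> K"
    using d by auto
  have \<Lambda>: "\<And>i. i \<in> I \<Longrightarrow> 0 \<le> \<Lambda> i" "\<And>i. i \<in> I \<Longrightarrow> carleson S (V i) (\<Lambda> i) (V i)" using d by auto
  have N: "\<And>i T. i \<in> I \<Longrightarrow> T \<subseteq> S \<Longrightarrow> (\<Sum>F\<in>principal_sets T (dyadic_level T (a i)). 2 powr (s i * dyadic_level T (a i) F) * V i F) \<le> N i"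
    using d by blast
  have N0: "0 \<le> N i" if "i \<in> I" for i
    using N[OF that, of "{}"] by (simp add: principal_sets_def)
  have c_pos: "0 < c Q" if Q: "Q \<in> S" for Q
    unfolding c_def sparse_coeff_def using pos(1)[OF Q] pos(2,3)[OF _ Q]
    by (intro mult_pos_pos prod_pos) (auto simp: less_imp_neq[THEN not_sym])
  define \<Phi> where "\<Phi> x = (\<Sum>Q\<in>S. c Q * indicator Q x)" for x
  have \<Phi>_meas[measurable]: "\<Phi> \<in> borel_measurable U"
    unfolding \<Phi>_def using U(1) by (intro borel_measurable_sum) auto
  have \<Phi>0: "0 \<le> \<Phi> x" for x unfolding \<Phi>_def using c_pos
    by (intro sum_nonneg) (auto simp: less_imp_le)
  define h where "h x = \<Phi> x powr (t / r - 1)" for x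
  have h_meas[measurable]: "h \<in> borel_measurable U" unfolding h_def by measurable
  have h0: "0 \<le> h x" for x by (simp add: h_def)
  have \<Phi>_ge: "c Q \<le> \<Phi> x" if "Q \<in> S" "x \<in> Q" for Q x
  proof -
    have "c Q * indicator Q x \<le> \<Phi> x"
      unfolding \<Phi>_def using c_pos that S(1)
      by (intro member_le_sum) (auto simp: less_imp_le)
    then show ?thesis using that by simp
  qed
  have \<Phi>_le: "\<Phi> x \<le> sum c S" for x
    unfolding \<Phi>_def using c_pos by (intro sum_mono) (auto simp: indicator_def less_imp_le)
  have fin_h: "(\<integral>\<^sup>+x\<in>Q. ennreal (h x) \<partial>U) < \<infinity>" if Q: "Q \<in> S" for Q
  proof -
    have "(\<integral>\<^sup>+x\<in>Q. ennreal (h x) \<partial>U) \<le> (\<integral>\<^sup>+x. ennreal (sum c S powr (t / r - 1)) * indicator Q x \<partial>U)"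
      unfolding h_def using \<Phi>_le \<Phi>0 rt
      by (intro nn_integral_mono mult_right_mono ennreal_leI powr_mono2) auto
    also have "\<dots> = ennreal (sum c S powr (t / r - 1)) * emeasure U Q"
      using U(1)[OF Q] by (rule nn_integral_cmult_indicator)
    also have "\<dots> < \<infinity>" using U(3)[OF Q] by (simp add: ennreal_mult_less_top)
    finally show ?thesis .
  qed
  define a\<^sub>0 where "a\<^sub>0 Q = enn2real (\<integral>\<^sup>+x\<in>Q. ennreal (h x) \<partial>U) / measure U Q" for Q
  have a0_avg: "ennreal (a\<^sub>0 Q * measure U Q) = (\<integral>\<^sup>+x\<in>Q. ennreal (h x) \<partial>U)" if Q: "Q \<in> S" for Q
    using U0[OF Q] fin_h[OF Q] by (simp add: a\<^sub>0_def)
  have a0_pos: "0 < a\<^sub>0 Q" if Q: "Q \<in> S" for Q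
  proof -
    have "0 < ennreal (c Q powr (t / r - 1)) * emeasure U Q"
      using c_pos[OF Q] U0[OF Q] U(2)[OF Q] by (simp add: ennreal_zero_less_mult_iff)
    also have "\<dots> = (\<integral>\<^sup>+x. ennreal (c Q powr (t / r - 1)) * indicator Q x \<partial>U)"
      using U(1)[OF Q] by (rule nn_integral_cmult_indicator[symmetric])
    also have "\<dots> \<le> (\<integral>\<^sup>+x\<in>Q. ennreal (h x) \<partial>U)"
      unfolding h_def using \<Phi>_ge[OF Q] c_pos[OF Q] rt
      by (intro nn_integral_mono) (auto simp: indicator_def intro!: ennreal_leI powr_mono2)
    finally have "0 < ennreal (a\<^sub>0 Q * measure U Q)" unfolding a0_avg[OF Q] .
    then show ?thesis using U0[OF Q] by (simp add: zero_less_mult_iff)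
  qed
  define T where "T = (\<Sum>Q\<in>S. c Q * (a\<^sub>0 Q * measure U Q))"
  have T0: "0 \<le> T" unfolding T_def using c_pos a0_pos by (intro sum_nonneg) (auto simp: less_imp_le)
  have int_eq: "(\<integral>\<^sup>+x. ennreal (\<Phi> x powr (t / r)) \<partial>U) = ennreal T"
  proof -
    have "(\<integral>\<^sup>+x. ennreal (\<Phi> x powr (t / r)) \<partial>U) =
        (\<integral>\<^sup>+x. (\<Sum>Q\<in>S. ennreal (c Q) * (ennreal (h x) * indicator Q x)) \<partial>U)"
    proof (rule nn_integral_cong)
      fix x
      have "\<Phi> x powr (t / r) = \<Phi> x * h x"
        unfolding h_def using \<Phi>0[of x] rt by (cases "\<Phi> x = 0") (auto simp: powr_diff)
      also have "\<dots> = (\<Sum>Q\<in>S. c Q * (h x * indicator Q x))"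
        unfolding \<Phi>_def sum_distrib_right by (simp add: mult_ac)
      finally have "ennreal (\<Phi> x powr (t / r)) = (\<Sum>Q\<in>S. ennreal (c Q * (h x * indicator Q x)))"
        using c_pos h0 by (subst sum_ennreal) (auto simp: less_imp_le)
      also have "\<dots> = (\<Sum>Q\<in>S. ennreal (c Q) * (ennreal (h x) * indicator Q x))"
        using c_pos h0 by (intro sum.cong) (auto simp: indicator_def ennreal_mult less_imp_le)
      finally show "ennreal (\<Phi> x powr (t / r)) = (\<Sum>Q\<in>S. ennreal (c Q) * (ennreal (h x) * indicator Q x))" .
    qed
    also have "\<dots> = (\<Sum>Q\<in>S. ennreal (c Q) * (\<integral>\<^sup>+x\<in>Q. ennreal (h x) \<partial>U))"
      using U(1) by (subst nn_integral_sum) (auto intro!: sum.cong nn_integral_cmult)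
    also have "\<dots> = (\<Sum>Q\<in>S. ennreal (c Q * (a\<^sub>0 Q * measure U Q)))"
      using a0_avg c_pos a0_pos by (intro sum.cong) (auto simp: ennreal_mult less_imp_le)
    also have "\<dots> = ennreal T"
      unfolding T_def using c_pos a0_pos by (intro sum_ennreal) (auto simp: less_imp_le)
    finally show ?thesis .
  qed
  have h_powr: "h x powr \<kappa> = \<Phi> x powr (t / r)" for x
  proof -
    have "(t / r - 1) * \<kappa> = t / r"
      using rt \<theta>0 by (simp add: \<kappa>_def \<theta>_def field_simps)
    then show ?thesis by (simp add: h_def powr_powr)
  qed
  have N_0: "(\<Sum>F\<in>principal_sets S' (dyadic_level S' a\<^sub>0). 2 powr (\<kappa> * dyadic_level S' a\<^sub>0 F) * measure U F) \<le> c\<^sub>0 * T"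
    if S': "S' \<subseteq> S" for S'
  proof -
    have "ennreal (\<Sum>F\<in>principal_sets S' (dyadic_level S' a\<^sub>0). 2 powr (\<kappa> * dyadic_level S' a\<^sub>0 F) * measure U F) \<le>
        ennreal c\<^sub>0 * (\<integral>\<^sup>+x. ennreal (h x powr \<kappa>) \<partial>U)"
      unfolding c\<^sub>0_def
      using S S' U a0_pos a0_avg h0 \<kappa> h_meas finite_subset[OF S' S(1)] laminar_subset[OF S(2) S']
      by (intro principal_powr_le) auto
    also have "\<dots> = ennreal (c\<^sub>0 * T)" unfolding h_powr int_eq using c\<^sub>0 T0 by (simp add: ennreal_mult)
    finally show ?thesis using c\<^sub>0 T0 by (subst (asm) ennreal_le_iff) auto
  qed
  define V' where "V' i = (if i = 0 then measure U else V i)" for i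
  define a' where "a' i = (if i = 0 then a\<^sub>0 else a i)" for i
  define \<Lambda>' where "\<Lambda>' i = (if i = 0 then \<Lambda>\<^sub>0 else \<Lambda> i)" for i
  define N' where "N' i = (if i = 0 then c\<^sub>0 * T else N i)" for i
  have at0: "V' 0 = measure U" "a' 0 = a\<^sub>0" "\<Lambda>' 0 = \<Lambda>\<^sub>0" "N' 0 = c\<^sub>0 * T" "\<rho> 0 = 1"
    by (auto simp: V'_def a'_def \<Lambda>'_def N'_def \<rho>_def)
  have atI: "V' i = V i" "a' i = a i" "\<Lambda>' i = \<Lambda> i" "N' i = N i" if "i \<in> I" for i
    using nz[OF that] by (auto simp: V'_def a'_def \<Lambda>'_def N'_def)
  have prodJ: "(\<Prod>i\<in>J. f i) = f 0 * (\<Prod>i\<in>I. f i)" for f :: "nat \<Rightarrow> real"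
    using I by (simp add: J_def)
  define B where "B = (\<Prod>i\<in>I. \<Lambda> i powr (r / s i)) +
      \<Lambda>\<^sub>0 powr (1 - r / t) * (\<Sum>j\<in>I. \<Prod>i\<in>I - {j}. \<Lambda> i powr (r / s i))"
  have B0: "0 \<le> B" unfolding B_def by (intro add_nonneg_nonneg mult_nonneg_nonneg sum_nonneg prod_nonneg) auto
  have B_eq: "(\<Sum>j\<in>J. \<Prod>i\<in>J - {j}. \<Lambda>' i powr \<theta> i) = B"
  proof -
    have "(\<Prod>i\<in>J - {j}. \<Lambda>' i powr \<theta> i) = \<Lambda>\<^sub>0 powr (1 - r / t) * (\<Prod>i\<in>I - {j}. \<Lambda> i powr (r / s i))"
      if j: "j \<in> I" for j
    proof -
      have "J - {j} = insert 0 (I - {j})" using nz[OF j] by (auto simp: J_def)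
      then have "(\<Prod>i\<in>J - {j}. \<Lambda>' i powr \<theta> i) = \<Lambda>' 0 powr \<theta> 0 * (\<Prod>i\<in>I - {j}. \<Lambda>' i powr \<theta> i)"
        using I by simp
      also have "(\<Prod>i\<in>I - {j}. \<Lambda>' i powr \<theta> i) = (\<Prod>i\<in>I - {j}. \<Lambda> i powr (r / s i))"
        using atI \<theta>I by (intro prod.cong) auto
      finally show ?thesis by (simp add: at0 \<theta>_def)
    qed
    moreover have "(\<Prod>i\<in>J - {0}. \<Lambda>' i powr \<theta> i) = (\<Prod>i\<in>I. \<Lambda> i powr (r / s i))"
      using I atI \<theta>I by (intro prod.cong) (auto simp: J_def)
    ultimately show ?thesis
      using I by (simp add: J_def B_def sum_distrib_left)
  qed
  have term_eq: "(\<Prod>i\<in>J. a' i Q powr \<rho> i) *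
      ((\<Prod>i\<in>J. (V' i Q / \<mu> Q) powr (\<rho> i - \<theta> i)) * (\<Prod>i\<in>J. V' i Q powr \<theta> i)) =
      c Q * (a\<^sub>0 Q * measure U Q)" if Q: "Q \<in> S" for Q
  proof -
    have m: "0 < \<mu> Q" using pos(1)[OF Q] .
    have "(\<Prod>i\<in>J. a' i Q powr \<rho> i) *
      ((\<Prod>i\<in>J. (V' i Q / \<mu> Q) powr (\<rho> i - \<theta> i)) * (\<Prod>i\<in>J. V' i Q powr \<theta> i)) =
      (a\<^sub>0 Q * ((measure U Q / \<mu> Q) powr (1 - \<theta> 0) * measure U Q powr \<theta> 0)) *
      (\<Prod>i\<in>I. a' i Q powr \<rho> i * ((V' i Q / \<mu> Q) powr (\<rho> i - \<theta> i) * V' i Q powr \<theta> i))"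
      unfolding prodJ at0 using a0_pos[OF Q] by (simp add: prod.distrib)
    also have "(measure U Q / \<mu> Q) powr (1 - \<theta> 0) * measure U Q powr \<theta> 0 = \<mu> Q powr (- r / t) * measure U Q"
    proof -
      have "(measure U Q / \<mu> Q) powr (1 - \<theta> 0) = measure U Q powr (1 - \<theta> 0) * \<mu> Q powr (- r / t)"
        unfolding \<theta>0(3) using m U0[OF Q] by (simp add: powr_divide powr_minus_divide)
      moreover have "measure U Q powr (1 - \<theta> 0) * measure U Q powr \<theta> 0 = measure U Q"
        using U0[OF Q] by (simp add: powr_add[symmetric])
      ultimately show ?thesis by (simp add: mult_ac)
    qed
    also have "(\<Prod>i\<in>I. a' i Q powr \<rho> i * ((V' i Q / \<mu> Q) powr (\<rho> i - \<theta> i) * V' i Q powr \<theta> i)) =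
        (\<Prod>i\<in>I. \<mu> Q powr \<theta> i * (a i Q * (V i Q / \<mu> Q)) powr r)"
    proof (rule prod.cong[OF refl])
      fix i assume i: "i \<in> I"
      have "(V i Q / \<mu> Q) powr (r - \<theta> i) * V i Q powr \<theta> i = \<mu> Q powr \<theta> i * (V i Q / \<mu> Q) powr r"
        using m pos(2)[OF i Q] by (simp add: powr_diff powr_divide)
      then show "a' i Q powr \<rho> i * ((V' i Q / \<mu> Q) powr (\<rho> i - \<theta> i) * V' i Q powr \<theta> i) =
          \<mu> Q powr \<theta> i * (a i Q * (V i Q / \<mu> Q)) powr r"
        unfolding atI[OF i] \<theta>I(2)[OF i] powr_mult[of "a i Q" "V i Q / \<mu> Q" r] by (simp only: mult_ac)
    qed
    also have "\<dots> = \<mu> Q powr sum \<theta> I * (\<Prod>i\<in>I. (a i Q * (V i Q / \<mu> Q)) powr r)"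
      using m by (simp add: prod.distrib powr_sum)
    finally have "(\<Prod>i\<in>J. a' i Q powr \<rho> i) *
      ((\<Prod>i\<in>J. (V' i Q / \<mu> Q) powr (\<rho> i - \<theta> i)) * (\<Prod>i\<in>J. V' i Q powr \<theta> i)) =
      (\<mu> Q powr sum \<theta> I * \<mu> Q powr (- r / t)) * (\<Prod>i\<in>I. (a i Q * (V i Q / \<mu> Q)) powr r) *
      (a\<^sub>0 Q * measure U Q)" by (simp add: mult_ac)
    also have "\<mu> Q powr sum \<theta> I * \<mu> Q powr (- r / t) = \<mu> Q powr (r * ((\<Sum>i\<in>I. 1 / s i) - 1 / t))"
      unfolding sum\<theta>I by (simp add: powr_add[symmetric] right_diff_distrib)
    finally show ?thesis by (simp add: c_def sparse_coeff_def)
  qed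
  have "T \<le> C * K powr (r / t) * (B * (\<Prod>i\<in>J. N' i powr \<theta> i))"
  proof -
    have "(\<Sum>Q\<in>S. (\<Prod>i\<in>J. a' i Q powr \<rho> i) *
        ((\<Prod>i\<in>J. (V' i Q / \<mu> Q) powr (\<rho> i - \<theta> i)) * (\<Prod>i\<in>J. V' i Q powr \<theta> i)))
      \<le> C * K powr (r / t) * ((\<Sum>j\<in>J. \<Prod>i\<in>J - {j}. \<Lambda>' i powr \<theta> i) * (\<Prod>i\<in>J. N' i powr \<theta> i))"
      unfolding C_def
    proof (rule multilinear_form_bound[OF J \<theta> sum\<theta> \<Delta>])
      show "sparse_system S J \<mu> V' \<Delta>"
      proof -
        have "superadditive S (measure U)" using S U by (intro superadditive_measure) auto
        then show ?thesis using d U0 atI unfolding sparse_system_def J_def by (auto simp: at0)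
      qed
      show "0 \<le> K powr (r / t)" by simp
      show "0 < a' i Q" if "i \<in> J" "Q \<in> S" for i Q
        using that a0_pos pos(3) atI at0 by (auto simp: J_def)
      show "0 \<le> \<Lambda>' i" "carleson S (V' i) (\<Lambda>' i) (V' i)" if "i \<in> J" for i
        using that \<Lambda> atI d by (auto simp: at0 J_def)
      show "(\<Sum>F\<in>principal_sets T (dyadic_level T (a' i)). 2 powr (\<rho> i / \<theta> i * dyadic_level T (a' i) F) * V' i F) \<le> N' i"
        if i: "i \<in> J" and T: "T \<subseteq> S" for i T
      proof (cases "i = 0")
        case True
        then show ?thesis using N_0[OF T] by (simp add: at0 \<kappa>_def)
      next
        case False
        then have iI: "i \<in> I" using i by (simp add: J_def)
        have "\<rho> i / \<theta> i = s i" using \<theta>I[OF iI] si[OF iI] rt by simp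
        then show ?thesis using N[OF iI T] by (simp add: atI[OF iI])
      qed
      show "(\<Prod>i\<in>J. (V' i Q / \<mu> Q) powr (\<rho> i - \<theta> i)) \<le> K powr (r / t)" if Q: "Q \<in> S" for Q
      proof -
        have "(\<Prod>i\<in>I. (V' i Q / \<mu> Q) powr (\<rho> i - \<theta> i)) = (\<Prod>i\<in>I. ((V i Q / \<mu> Q) powr (t * (1 - 1 / s i))) powr (r / t))"
        proof (rule prod.cong[OF refl])
          fix i assume i: "i \<in> I"
          have "r - r / s i = t * (1 - 1 / s i) * (r / t)" using t si[OF i] by (simp add: field_simps)
          then show "(V' i Q / \<mu> Q) powr (\<rho> i - \<theta> i) = ((V i Q / \<mu> Q) powr (t * (1 - 1 / s i))) powr (r / t)"
            by (simp add: atI[OF i] \<theta>I[OF i] powr_powr)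
        qed
        then have "(\<Prod>i\<in>J. (V' i Q / \<mu> Q) powr (\<rho> i - \<theta> i)) =
            (measure U Q / \<mu> Q * (\<Prod>i\<in>I. (V i Q / \<mu> Q) powr (t * (1 - 1 / s i)))) powr (r / t)"
          by (simp only: prodJ at0 \<theta>0(3) powr_mult prod_powr_distrib)
        also have "\<dots> \<le> K powr (r / t)"
        proof (rule powr_mono2)
          show "measure U Q / \<mu> Q * (\<Prod>i\<in>I. (V i Q / \<mu> Q) powr (t * (1 - 1 / s i))) \<le> K"
            using d Q by blast
          show "0 \<le> measure U Q / \<mu> Q * (\<Prod>i\<in>I. (V i Q / \<mu> Q) powr (t * (1 - 1 / s i)))"
            using pos(1)[OF Q]
            by (intro mult_nonneg_nonneg divide_nonneg_nonneg prod_nonneg) auto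
        qed (use rt in simp)
        finally show ?thesis .
      qed
    qed
    then show ?thesis unfolding B_eq T_def using term_eq by simp
  qed
  also have "(\<Prod>i\<in>J. N' i powr \<theta> i) = (c\<^sub>0 * T) powr \<theta> 0 * (\<Prod>i\<in>I. N i powr (r / s i))"
    unfolding prodJ at0 using atI \<theta>I by (intro arg_cong2[where f = times] prod.cong refl) auto
  finally have T_le: "T \<le> C * K powr (r / t) * (B * ((c\<^sub>0 * T) powr \<theta> 0 * (\<Prod>i\<in>I. N i powr (r / s i))))" .
  have "T \<le> C' * K * B powr (t / r) * (\<Prod>i\<in>I. N i powr (t / s i))"
  proof (cases "T = 0")
    case True
    then show ?thesis using C' K0 by (auto intro!: mult_nonneg_nonneg prod_nonneg)
  next
    case False
    then have T: "0 < T" using T0 by simp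
    \<comment> \<open>dividing by \<open>T powr \<theta> 0\<close> leaves \<open>T powr (r / t)\<close> on the left\<close>
    define D where "D = (C * c\<^sub>0 powr \<theta> 0) * (K powr (r / t) * (B * (\<Prod>i\<in>I. N i powr (r / s i))))"
    have "r / t + \<theta> 0 = 1" using \<theta>0(3) by simp
    then have "T powr (r / t) * T powr \<theta> 0 = T"
      using T by (simp only: powr_add[symmetric] powr_one)
    moreover have "T \<le> D * T powr \<theta> 0" using T_le c\<^sub>0 T by (simp add: D_def powr_mult mult_ac)
    ultimately have "T powr (r / t) * T powr \<theta> 0 \<le> D * T powr \<theta> 0" by simp
    then have "T powr (r / t) \<le> D" using T by simp
    then have "(T powr (r / t)) powr (t / r) \<le> D powr (t / r)"
      using rt t by (intro powr_mono2) auto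
    then have "T \<le> D powr (t / r)" using T rt t by (simp add: powr_powr)
    also have "\<dots> = C' * (K * (B powr (t / r) * (\<Prod>i\<in>I. (N i powr (r / s i)) powr (t / r))))"
      unfolding D_def C'_def using C c\<^sub>0 K0 B0 rt t
      by (simp add: powr_mult powr_powr prod_nonneg prod_powr_distrib)
    also have "(\<Prod>i\<in>I. (N i powr (r / s i)) powr (t / r)) = (\<Prod>i\<in>I. N i powr (t / s i))"
      using rt by (simp add: powr_powr)
    finally show ?thesis by (simp add: mult_ac)
  qed
  then have "ennreal T \<le> ennreal (C' * K * B powr (t / r) * (\<Prod>i\<in>I. N i powr (t / s i)))" by (rule ennreal_leI)
  then show ?thesis using int_eq by (simp add: \<Phi>_def c_def B_def C'_eq A_infty_factor_def)
qed

lemma powr_sum_le_card: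
  fixes y :: "'b \<Rightarrow> real"
  assumes "finite A" "\<And>x. x \<in> A \<Longrightarrow> 0 \<le> y x" "0 < e"
  shows "(\<Sum>x\<in>A. y x) powr e \<le> card A powr e * (\<Sum>x\<in>A. y x powr e)"
proof (cases "A = {}")
  case False
  define m where "m = Max (y ` A)"
  have m: "m \<in> y ` A" "\<And>x. x \<in> A \<Longrightarrow> y x \<le> m" using assms(1) False by (auto simp: m_def)
  have m0: "0 \<le> m" using m(1) assms(2) by auto
  have "(\<Sum>x\<in>A. y x) \<le> card A * m" using m(2) by (intro sum_bounded_above)
  then have "(\<Sum>x\<in>A. y x) powr e \<le> (card A * m) powr e"
    using assms by (intro powr_mono2 sum_nonneg) auto
  also have "\<dots> = card A powr e * m powr e" using m0 by (simp add: powr_mult)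
  also have "m powr e \<le> (\<Sum>x\<in>A. y x powr e)"
    using m(1) assms(1) by (auto intro!: member_le_sum)
  finally show ?thesis by (simp add: mult_left_mono)
qed simp

text \<open>A power \<open>b\<close>, which may exceed 1, passes to the summands at the price of a factor depending only
  on their number. The common factor \<open>c\<close> of the constants comes out with different exponents; as
  \<open>c \<ge> 1\<close>, the sum of all exponents bounds each of them.\<close>

lemma A_infty_factor_powr_le:
  assumes I: "finite I" and e: "\<And>i. i \<in> I \<Longrightarrow> 0 < e i" "0 \<le> e\<^sub>0" and b: "0 < b" and c: "1 \<le> c"
    and \<alpha>: "\<And>i. i \<in> I \<Longrightarrow> 0 \<le> \<alpha> i" "0 \<le> \<alpha>\<^sub>0"
  shows "A_infty_factor I e e\<^sub>0 (\<lambda>i. c * \<alpha> i) (c * \<alpha>\<^sub>0) powr b \<le>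
    (2 * (1 + card I)) powr b * c powr (b * (e\<^sub>0 + sum e I)) *
      A_infty_factor I (\<lambda>i. e i * b) (e\<^sub>0 * b) \<alpha> \<alpha>\<^sub>0"
proof -
  have scale: "(\<Prod>i\<in>J. (c * \<alpha> i) powr e i) \<le> c powr sum e I * (\<Prod>i\<in>J. \<alpha> i powr e i)" if J: "J \<subseteq> I" for J
  proof -
    have "(\<Prod>i\<in>J. (c * \<alpha> i) powr e i) = (\<Prod>i\<in>J. c powr e i * \<alpha> i powr e i)"
      using J c \<alpha> by (intro prod.cong) (auto simp: powr_mult)
    also have "\<dots> = c powr sum e J * (\<Prod>i\<in>J. \<alpha> i powr e i)"
      using c by (simp add: prod.distrib powr_sum)
    also have "\<dots> \<le> c powr sum e I * (\<Prod>i\<in>J. \<alpha> i powr e i)"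
      using J I e(1) c by (intro mult_right_mono powr_mono sum_mono2 prod_nonneg) (auto simp: less_imp_le)
    finally show ?thesis .
  qed
  define x where "x J = (\<Prod>i\<in>J. \<alpha> i powr e i)" for J
  have x0: "0 \<le> x J" for J by (simp add: x_def prod_nonneg)
  have xb: "x J powr b = (\<Prod>i\<in>J. \<alpha> i powr (e i * b))" for J
    by (simp add: x_def prod_powr_distrib powr_powr)
  define k where "k = c powr (e\<^sub>0 + sum e I)"
  have k: "c powr sum e I \<le> k" "0 < k" "c powr e\<^sub>0 * c powr sum e I = k"
    using c e(2) ge_one_powr_ge_zero[of c e\<^sub>0] by (auto simp: k_def powr_add)
  define P where "P = x I"
  define R where "R = \<alpha>\<^sub>0 powr e\<^sub>0 * (\<Sum>j\<in>I. x (I - {j}))"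
  have PR: "0 \<le> P" "0 \<le> R" using x0 by (auto simp: P_def R_def intro!: mult_nonneg_nonneg sum_nonneg)
  have "A_infty_factor I e e\<^sub>0 (\<lambda>i. c * \<alpha> i) (c * \<alpha>\<^sub>0) \<le> k * (P + R)"
  proof -
    have "(\<Prod>i\<in>I. (c * \<alpha> i) powr e i) \<le> k * P"
      using order_trans[OF scale[OF subset_refl] mult_right_mono[OF k(1) x0[of I, unfolded x_def]]]
      by (simp add: x_def P_def)
    moreover have "(c * \<alpha>\<^sub>0) powr e\<^sub>0 * (\<Sum>j\<in>I. \<Prod>i\<in>I - {j}. (c * \<alpha> i) powr e i) \<le> k * R"
    proof -
      have "(\<Sum>j\<in>I. \<Prod>i\<in>I - {j}. (c * \<alpha> i) powr e i) \<le> (\<Sum>j\<in>I. c powr sum e I * x (I - {j}))"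
        unfolding x_def by (intro sum_mono scale) auto
      then have "(c * \<alpha>\<^sub>0) powr e\<^sub>0 * (\<Sum>j\<in>I. \<Prod>i\<in>I - {j}. (c * \<alpha> i) powr e i) \<le>
          (c * \<alpha>\<^sub>0) powr e\<^sub>0 * (\<Sum>j\<in>I. c powr sum e I * x (I - {j}))" by (intro mult_left_mono) auto
      also have "\<dots> = (c powr e\<^sub>0 * c powr sum e I) * R"
        using c \<alpha>(2) by (simp add: R_def powr_mult sum_distrib_left mult_ac)
      finally show ?thesis by (simp add: k(3))
    qed
    ultimately show ?thesis by (simp add: A_infty_factor_def distrib_left)
  qed
  then have "A_infty_factor I e e\<^sub>0 (\<lambda>i. c * \<alpha> i) (c * \<alpha>\<^sub>0) powr b \<le> (k * (P + R)) powr b"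
    using b A_infty_factor_nonneg by (intro powr_mono2) auto
  also have "\<dots> = k powr b * (P + R) powr b" using k PR by (simp add: powr_mult)
  also have "(P + R) powr b \<le> (2 * (1 + card I)) powr b * A_infty_factor I (\<lambda>i. e i * b) (e\<^sub>0 * b) \<alpha> \<alpha>\<^sub>0"
  proof -
    have "P + R = (\<Sum>i\<in>{True, False}. if i then P else R)" by simp
    then have "(P + R) powr b \<le> 2 powr b * (P powr b + R powr b)"
      using powr_sum_le_card[of "{True, False}" "\<lambda>i. if i then P else R" b] PR b by simp
    also have "\<dots> \<le> 2 powr b * ((1 + card I) powr b * A_infty_factor I (\<lambda>i. e i * b) (e\<^sub>0 * b) \<alpha> \<alpha>\<^sub>0)"
    proof (rule mult_left_mono)
      have "R powr b = \<alpha>\<^sub>0 powr (e\<^sub>0 * b) * (\<Sum>j\<in>I. x (I - {j})) powr b"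
        unfolding R_def using x0 by (simp add: powr_mult powr_powr sum_nonneg)
      also have "\<dots> \<le> \<alpha>\<^sub>0 powr (e\<^sub>0 * b) * (card I powr b * (\<Sum>j\<in>I. x (I - {j}) powr b))"
        using x0 I b by (intro mult_left_mono powr_sum_le_card) auto
      also have "\<dots> \<le> \<alpha>\<^sub>0 powr (e\<^sub>0 * b) * ((1 + card I) powr b * (\<Sum>j\<in>I. x (I - {j}) powr b))"
        using b by (intro mult_left_mono mult_right_mono powr_mono2 sum_nonneg) auto
      finally have R: "R powr b \<le> (1 + card I) powr b * (\<alpha>\<^sub>0 powr (e\<^sub>0 * b) * (\<Sum>j\<in>I. x (I - {j}) powr b))"
        by (simp add: mult_ac)
      have "1 powr b \<le> (1 + card I) powr b" using b by (intro powr_mono2) auto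
      then have "1 * P powr b \<le> (1 + card I) powr b * P powr b" by (intro mult_right_mono) auto
      then show "P powr b + R powr b \<le> (1 + card I) powr b * A_infty_factor I (\<lambda>i. e i * b) (e\<^sub>0 * b) \<alpha> \<alpha>\<^sub>0"
        using R unfolding A_infty_factor_def xb P_def by (simp add: distrib_left)
    qed simp
    also have "\<dots> = (2 * (1 + card I)) powr b * A_infty_factor I (\<lambda>i. e i * b) (e\<^sub>0 * b) \<alpha> \<alpha>\<^sub>0"
      using powr_mult[of 2 "1 + real (card I)" b] by simp
    finally show ?thesis .
  qed
  finally have "A_infty_factor I e e\<^sub>0 (\<lambda>i. c * \<alpha> i) (c * \<alpha>\<^sub>0) powr b \<le>
      k powr b * ((2 * (1 + card I)) powr b * A_infty_factor I (\<lambda>i. e i * b) (e\<^sub>0 * b) \<alpha> \<alpha>\<^sub>0)"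
    by (simp add: mult_left_mono)
  moreover have "k powr b = c powr (b * (e\<^sub>0 + sum e I))" by (simp add: k_def powr_powr mult.commute)
  ultimately show ?thesis by (simp add: mult_ac)
qed

text \<open>In the case \<open>t \<le> r\<close> the constant comes from the factor 2 between an average and its dyadic level.\<close>

definition sparse_const :: "nat set \<Rightarrow> (nat \<Rightarrow> real) \<Rightarrow> real \<Rightarrow> real \<Rightarrow> real \<Rightarrow> real" where
  "sparse_const I s r t \<Delta> = (if r < t then dual_const I s r t \<Delta> else (\<Prod>i\<in>I. 2 powr t))"

lemma sparse_const_pos: "0 < r \<Longrightarrow> 0 < sparse_const I s r t \<Delta>"
  unfolding sparse_const_def by (auto intro!: dual_const_pos prod_pos)

lemma sparse_estimate:
  fixes I :: "nat set" and s :: "nat \<Rightarrow> real"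
  assumes I: "finite I" "I \<noteq> {}" "0 \<notin> I" and s: "\<And>i. i \<in> I \<Longrightarrow> 1 < s i"
    and rt: "0 < r" "0 < t" "1 / t \<le> (\<Sum>i\<in>I. 1 / s i)" and \<Delta>: "0 \<le> \<Delta>"
    and data: "sparse_data I s t \<Delta> S U \<mu> V a K \<Lambda> \<Lambda>\<^sub>0 N"
  shows "(\<integral>\<^sup>+x. ennreal ((\<Sum>Q\<in>S. sparse_coeff I s r t \<mu> V a Q * indicator Q x) powr (t / r)) \<partial>U) \<le>
    ennreal (sparse_const I s r t \<Delta> * K *
      A_infty_factor I (\<lambda>i. r / s i) (max (1 - r / t) 0) \<Lambda> \<Lambda>\<^sub>0 powr (t / r) *
      (\<Prod>i\<in>I. N i powr (t / s i)))" (is "?L \<le> _")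
proof (cases "r < t")
  case True
  then have "max (1 - r / t) 0 = 1 - r / t" using rt by simp
  then show ?thesis
    using sparse_estimate_high[OF I s rt(1) True rt(3) \<Delta> data] True by (simp add: sparse_const_def)
next
  case False
  define B where "B = A_infty_factor I (\<lambda>i. r / s i) (max (1 - r / t) 0) \<Lambda> \<Lambda>\<^sub>0"
  have K0: "0 \<le> K" using data by (simp add: sparse_data_def)
  have "(\<Prod>i\<in>I. \<Lambda> i powr (t / s i)) = (\<Prod>i\<in>I. \<Lambda> i powr (r / s i)) powr (t / r)"
    using rt by (simp add: prod_powr_distrib powr_powr)
  also have "\<dots> \<le> B powr (t / r)"
    using rt unfolding A_infty_factor_def B_def
    by (intro powr_mono2) (auto intro!: prod_nonneg mult_nonneg_nonneg sum_nonneg)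
  finally have le: "(\<Prod>i\<in>I. \<Lambda> i powr (t / s i)) \<le> B powr (t / r)" .
  have "?L \<le> ennreal ((\<Prod>i\<in>I. 2 powr t) * K * (\<Prod>i\<in>I. \<Lambda> i powr (t / s i)) * (\<Prod>i\<in>I. N i powr (t / s i)))"
    using I s rt False data by (intro sparse_estimate_low) auto
  also have "\<dots> \<le> ennreal ((\<Prod>i\<in>I. 2 powr t) * K * B powr (t / r) * (\<Prod>i\<in>I. N i powr (t / s i)))"
    using le K0 by (intro ennreal_leI mult_right_mono mult_left_mono) (auto simp: prod_nonneg)
  finally show ?thesis using False by (simp add: sparse_const_def B_def)
qed

section \<open>The sparse operator\<close>

lemma ennreal_powr_le_epowr: "0 \<le> x \<Longrightarrow> ennreal (x powr a) \<le> ennreal x powr\<^sub>\<infinity> a"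
  by (cases "a = 0") (auto simp: epowr_def)

definition sparse_term :: "'a measure \<Rightarrow> nat \<Rightarrow> real \<Rightarrow> real \<Rightarrow> (nat \<Rightarrow> 'a \<Rightarrow> complex) \<Rightarrow> 'a set \<Rightarrow> ennreal" where
  "sparse_term M m \<eta> p\<^sub>0 f Q = emeasure M Q powr\<^sub>\<infinity> \<eta> *
     (\<Prod>i=1..m. avg M (\<lambda>y. ennreal (norm (f i y)) powr\<^sub>\<infinity> p\<^sub>0) Q powr\<^sub>\<infinity> (1 / p\<^sub>0))"

text \<open>This translates the estimate for finite families into the terms of the theorem, with
  \<open>F i\<close> the \<open>p\<^sub>i\<close>-th power of the norm of \<open>f\<^sub>i\<close>. Cubes on which some \<open>f\<^sub>i\<close> has average zero have coefficient
  zero and are discarded first, because the labels of the remaining ones are logarithms of the averages.\<close>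

lemma finite_sparse_family_estimate:
  fixes M :: "'a measure" and p :: "nat \<Rightarrow> real" and f :: "nat \<Rightarrow> 'a \<Rightarrow> complex" and I :: "nat set"
  assumes h: "homogeneous_type M d A\<^sub>0 C\<^sub>\<mu>" and D: "dyadic_lattice M d \<delta>\<^sub>0 a\<^sub>1 A\<^sub>1 D"
    and n: "A\<^sub>1 \<le> a\<^sub>1 * 2 ^ n" and \<delta>: "0 < \<delta>"
    and exps: "0 < \<gamma>" "0 < q" "1 \<le> p\<^sub>0" "\<And>i. i \<in> {1..m} \<Longrightarrow> p\<^sub>0 < p i" "\<eta> = (\<Sum>i=1..m. 1 / p i) - 1 / q"
    and m: "0 < m" and \<eta>: "0 \<le> \<eta>"
    and u: "u \<in> A_infty M d D" and \<sigma>: "\<And>i. i \<in> {1..m} \<Longrightarrow> \<sigma> i \<in> A_infty M d D"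
    and Astar: "A_star M D m (\<lambda>i. p i / p\<^sub>0) (q / p\<^sub>0) u \<sigma> < \<infinity>"
    and f: "\<And>i. i \<in> {1..m} \<Longrightarrow> f i \<in> borel_measurable M"
    and F: "\<And>i. i \<in> {1..m} \<Longrightarrow>
      (\<integral>\<^sup>+x. ennreal (norm (f i x) powr p i) \<partial>wmeasure M (\<lambda>x. \<sigma> i x powr (1 - p i / p\<^sub>0))) = ennreal (F i)"
      "\<And>i. i \<in> {1..m} \<Longrightarrow> 0 \<le> F i"
    and S: "finite S" "S \<subseteq> cubes D" and sp: "sparse_family M \<delta> S"
    and c: "C\<^sub>\<mu> ^ n / \<delta> \<le> c"
  shows "(\<integral>\<^sup>+x. (\<Sum>Q\<in>S. sparse_term M m \<eta> p\<^sub>0 f Q powr\<^sub>\<infinity> \<gamma> * indicator Q x) powr\<^sub>\<infinity> (q / \<gamma>) \<partial>wmeasure M u) \<le>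
    ennreal (sparse_const {1..m} (\<lambda>i. p i / p\<^sub>0) (\<gamma> / p\<^sub>0) (q / p\<^sub>0) (1 / \<delta>) * enn2real (A_star M D m (\<lambda>i. p i / p\<^sub>0) (q / p\<^sub>0) u \<sigma>) *
      A_infty_factor {1..m} (\<lambda>i. \<gamma> / p i) (max (1 - \<gamma> / q) 0)
        (\<lambda>i. c * enn2real (A_infty_const M d D (\<sigma> i))) (c * enn2real (A_infty_const M d D u)) powr (q / \<gamma>) *
      (\<Prod>i=1..m. (principal_const (p i / p\<^sub>0) * F i) powr (q / p i)))"
proof -
  define I where "I = {1..m}"
  define s where "s i = p i / p\<^sub>0" for i
  define r where "r = \<gamma> / p\<^sub>0"
  define t where "t = q / p\<^sub>0"
  define U where "U = wmeasure M u"
  define V where "V i = measure (wmeasure M (\<sigma> i))" for i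
  define \<mu> where "\<mu> = measure M"
  define J where "J i Q = (\<integral>\<^sup>+x\<in>Q. ennreal (norm (f i x) powr p\<^sub>0) \<partial>M)" for i Q
  define a where "a i Q = enn2real (J i Q) / V i Q" for i Q
  define K where "K = enn2real (A_star M D m s t u \<sigma>)"
  define \<alpha> where "\<alpha> v = enn2real (A_infty_const M d D v)" for v
  define k where "k = sparse_coeff I s r t \<mu> V a"
  define N where "N i = principal_const (s i) * F i" for i
  have p0: "0 < p\<^sub>0" using exps(3) by simp
  have si: "1 < s i" if "i \<in> I" for i using exps(4)[of i] that p0 by (simp add: s_def I_def)
  have weights: "weight M d u" "\<And>i. i \<in> I \<Longrightarrow> weight M d (\<sigma> i)"
    using u \<sigma> by (auto simp: A_infty_def I_def)
  have \<sigma>m[measurable]: "\<sigma> i \<in> borel_measurable M" and \<sigma>p: "AE x in M. 0 < \<sigma> i x" if "i \<in> I" for i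
    using weights(2)[OF that] by (auto simp: weight_def)
  have cube: "Q \<in> cubes D" if "Q \<in> S" for Q using that S(2) by blast
  have Q_meas: "Q \<in> sets M" and \<mu>Q: "0 < emeasure M Q" "emeasure M Q < \<infinity>" if Q: "Q \<in> S" for Q
  proof -
    obtain z \<rho> where z: "z \<in> space M" "0 < \<rho>" "Q \<subseteq> qball M d z \<rho>" "emeasure M (qball M d z \<rho>) < \<infinity>"
        "0 < emeasure M Q" "Q \<in> sets M"
      using cube_in_ball[OF h D cube[OF Q] n] by metis
    show "Q \<in> sets M" "0 < emeasure M Q" by fact+
    show "emeasure M Q < \<infinity>"
      using emeasure_mono[OF z(3) qball_measurable[OF h z(1,2)]] z(4) by (rule order_le_less_trans)
  qed
  have \<mu>_eq: "emeasure M Q = ennreal (\<mu> Q)" "0 < \<mu> Q" if Q: "Q \<in> S" for Q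
  proof -
    show "emeasure M Q = ennreal (\<mu> Q)"
      using \<mu>Q(2)[OF Q] by (simp add: \<mu>_def emeasure_eq_ennreal_measure)
    then show "0 < \<mu> Q" using \<mu>Q(1)[OF Q] by simp
  qed
  have U_eq: "emeasure U Q = ennreal (measure U Q)" "0 < measure U Q"
      "(\<integral>\<^sup>+x\<in>Q. ennreal (u x) \<partial>M) = ennreal (measure U Q)" if Q: "Q \<in> S" for Q
  proof -
    note w = wmeasure_cube[OF h D cube[OF Q] weights(1)]
    show 1: "emeasure U Q = ennreal (measure U Q)"
      using w(2) by (simp add: U_def emeasure_eq_ennreal_measure)
    then show "0 < measure U Q" using w(1) by (simp add: U_def)
    show "(\<integral>\<^sup>+x\<in>Q. ennreal (u x) \<partial>M) = ennreal (measure U Q)" using w(3) 1 by (simp add: U_def)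
  qed
  have V_eq: "emeasure (wmeasure M (\<sigma> i)) Q = ennreal (V i Q)" "0 < V i Q"
      "(\<integral>\<^sup>+x\<in>Q. ennreal (\<sigma> i x) \<partial>M) = ennreal (V i Q)" if i: "i \<in> I" and Q: "Q \<in> S" for i Q
  proof -
    note w = wmeasure_cube[OF h D cube[OF Q] weights(2)[OF i]]
    show 1: "emeasure (wmeasure M (\<sigma> i)) Q = ennreal (V i Q)"
      using w(2) by (simp add: V_def emeasure_eq_ennreal_measure)
    then show "0 < V i Q" using w(1) by simp
    show "(\<integral>\<^sup>+x\<in>Q. ennreal (\<sigma> i x) \<partial>M) = ennreal (V i Q)" using w(3) 1 by simp
  qed
  define g where "g i x = norm (f i x) powr p\<^sub>0 / \<bar>\<sigma> i x\<bar>" for i x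
  have g0: "0 \<le> g i x" for i x by (simp add: g_def)
  have g_meas: "g i \<in> borel_measurable (wmeasure M (\<sigma> i))" if i: "i \<in> I" for i
  proof -
    have [measurable]: "f i \<in> borel_measurable M" "\<sigma> i \<in> borel_measurable M"
      using f \<sigma>m i by (auto simp: I_def)
    have "g i \<in> borel_measurable M" unfolding g_def by measurable
    then show ?thesis by (simp add: wmeasure_def)
  qed
  have norm_meas: "(\<lambda>x. norm (f i x)) \<in> borel_measurable M" if "i \<in> I" for i
    using f[of i] that by (simp add: I_def)
  have g_int: "(\<integral>\<^sup>+x\<in>Q. ennreal (g i x) \<partial>wmeasure M (\<sigma> i)) = J i Q" if "i \<in> I" "Q \<in> S" for i Q
    unfolding g_def J_def
    by (rule nn_integral_substitution[OF norm_meas _ \<sigma>m \<sigma>p p0 Q_meas]) (use that in auto)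
  have g_powr: "(\<integral>\<^sup>+x. ennreal (g i x powr s i) \<partial>wmeasure M (\<sigma> i)) = ennreal (F i)" if i: "i \<in> I" for i
    using nn_integral_substitution_powr[OF norm_meas[OF i] _ \<sigma>m[OF i] \<sigma>p[OF i] p0, of "p i"] F(1)[of i] i
    by (simp add: g_def s_def I_def)
  have J_fin: "J i Q = ennreal (a i Q * V i Q)" if i: "i \<in> I" and Q: "Q \<in> S" for i Q
  proof -
    have "(\<integral>\<^sup>+x\<in>Q. ennreal (g i x) \<partial>wmeasure M (\<sigma> i)) < \<infinity>"
      using g_meas[OF i] Q_meas[OF Q] g0 V_eq(1)[OF i Q] g_powr[OF i] si[OF i]
      by (intro nn_integral_finite_on[where s = "s i"]) (auto simp: wmeasure_def)
    then show ?thesis using V_eq(2)[OF i Q] by (simp add: g_int[OF i Q] a_def)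
  qed
  have a0: "0 \<le> a i Q" for i Q by (simp add: a_def V_def)
  have N0: "0 \<le> N i" if i: "i \<in> I" for i
    using F(2)[of i] i principal_const_pos[OF si[OF i]] by (simp add: N_def I_def)
  have coeff: "sparse_term M m \<eta> p\<^sub>0 f Q powr\<^sub>\<infinity> \<gamma> = ennreal (k Q)"
    if Q: "Q \<in> S" for Q
  proof -
    have m: "0 < \<mu> Q" by (rule \<mu>_eq(2)[OF Q])
    have b0: "0 \<le> a i Q * (V i Q / \<mu> Q)" for i
      using a0 m by (auto simp: V_def)
    have "avg M (\<lambda>y. ennreal (norm (f i y)) powr\<^sub>\<infinity> p\<^sub>0) Q powr\<^sub>\<infinity> (1 / p\<^sub>0) =
        ennreal ((a i Q * (V i Q / \<mu> Q)) powr (1 / p\<^sub>0))" if i: "i \<in> I" for i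
    proof -
      have "(\<integral>\<^sup>+x\<in>Q. (ennreal (norm (f i x)) powr\<^sub>\<infinity> p\<^sub>0) \<partial>M) = J i Q"
        unfolding J_def using p0 by (simp add: epowr_ennreal)
      then have "avg M (\<lambda>y. ennreal (norm (f i y)) powr\<^sub>\<infinity> p\<^sub>0) Q = ennreal (a i Q * V i Q / \<mu> Q)"
        unfolding avg_def using J_fin[OF i Q] \<mu>_eq[OF Q] a0[of i Q] V_eq(2)[OF i Q] by (simp add: divide_ennreal)
      then show ?thesis using b0[of i] p0 by (simp add: epowr_ennreal)
    qed
    then have "(\<Prod>i=1..m. avg M (\<lambda>y. ennreal (norm (f i y)) powr\<^sub>\<infinity> p\<^sub>0) Q powr\<^sub>\<infinity> (1 / p\<^sub>0)) =
        ennreal (\<Prod>i\<in>I. (a i Q * (V i Q / \<mu> Q)) powr (1 / p\<^sub>0))"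
      unfolding I_def by (subst prod_ennreal[symmetric]) (auto intro!: prod.cong)
    then have "sparse_term M m \<eta> p\<^sub>0 f Q powr\<^sub>\<infinity> \<gamma> =
        ennreal ((\<mu> Q powr \<eta> * (\<Prod>i\<in>I. (a i Q * (V i Q / \<mu> Q)) powr (1 / p\<^sub>0))) powr \<gamma>)"
      using \<mu>_eq(1)[OF Q] m exps(1) unfolding sparse_term_def
      by (simp add: epowr_ennreal_pos epowr_ennreal ennreal_mult[symmetric] prod_nonneg)
    also have "(\<mu> Q powr \<eta> * (\<Prod>i\<in>I. (a i Q * (V i Q / \<mu> Q)) powr (1 / p\<^sub>0))) powr \<gamma> =
        \<mu> Q powr (\<eta> * \<gamma>) * (\<Prod>i\<in>I. (a i Q * (V i Q / \<mu> Q)) powr r)"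
      by (simp add: powr_mult prod_nonneg prod_powr_distrib powr_powr r_def)
    also have "\<eta> * \<gamma> = r * ((\<Sum>i\<in>I. 1 / s i) - 1 / t)"
    proof -
      have "(\<Sum>i\<in>I. 1 / s i) = p\<^sub>0 * (\<Sum>i=1..m. 1 / p i)"
        by (simp add: s_def I_def sum_distrib_left)
      then show ?thesis using p0 unfolding exps(5) r_def t_def by (simp add: field_simps)
    qed
    finally show ?thesis by (simp add: k_def sparse_coeff_def)
  qed
  define S' where "S' = {Q\<in>S. \<forall>i\<in>I. 0 < a i Q}"
  have S': "S' \<subseteq> S" "finite S'" using S by (auto simp: S'_def)
  have k_zero: "k Q = 0" if "Q \<in> S - S'" for Q
  proof -
    have "\<exists>i\<in>I. \<not> 0 < a i Q" using that unfolding S'_def by blast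
    then obtain i where i: "i \<in> I" "\<not> 0 < a i Q" by blast
    then have "a i Q = 0" using a0[of i Q] by simp
    then have "(\<Prod>i\<in>I. (a i Q * (V i Q / \<mu> Q)) powr r) = 0"
      using i(1) by (intro prod_zero bexI[of _ i]) (auto simp: I_def)
    then show ?thesis by (simp add: k_def sparse_coeff_def)
  qed
  have k0: "0 \<le> k Q" for Q by (simp add: k_def sparse_coeff_def prod_nonneg)
  have "(\<integral>\<^sup>+x. (\<Sum>Q\<in>S. sparse_term M m \<eta> p\<^sub>0 f Q powr\<^sub>\<infinity> \<gamma> * indicator Q x) powr\<^sub>\<infinity> (q / \<gamma>) \<partial>U) =
      (\<integral>\<^sup>+x. ennreal ((\<Sum>Q\<in>S'. k Q * indicator Q x) powr (q / \<gamma>)) \<partial>U)"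
  proof (rule nn_integral_cong)
    fix x
    have "(\<Sum>Q\<in>S. sparse_term M m \<eta> p\<^sub>0 f Q powr\<^sub>\<infinity> \<gamma> * indicator Q x) = (\<Sum>Q\<in>S. ennreal (k Q * indicator Q x))"
      using coeff by (intro sum.cong) (auto simp: indicator_def)
    also have "\<dots> = (\<Sum>Q\<in>S'. ennreal (k Q * indicator Q x))"
      using S(1) S' k_zero by (intro sum.mono_neutral_right) auto
    also have "\<dots> = ennreal (\<Sum>Q\<in>S'. k Q * indicator Q x)"
      using k0 by (intro sum_ennreal) auto
    finally show "(\<Sum>Q\<in>S. sparse_term M m \<eta> p\<^sub>0 f Q powr\<^sub>\<infinity> \<gamma> * indicator Q x) powr\<^sub>\<infinity> (q / \<gamma>) = ennreal ((\<Sum>Q\<in>S'. k Q * indicator Q x) powr (q / \<gamma>))"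
      using k0 exps(1,2) by (simp add: epowr_ennreal sum_nonneg)
  qed
  also have "\<dots> \<le> ennreal (sparse_const I s r t (1 / \<delta>) * K * A_infty_factor I (\<lambda>i. r / s i) (max (1 - r / t) 0)
      (\<lambda>i. c * \<alpha> (\<sigma> i)) (c * \<alpha> u) powr (t / r) * (\<Prod>i\<in>I. N i powr (t / s i)))"
  proof -
    have lam: "laminar S'" unfolding laminar_def
      using cubes_nested[OF D] cube S'(1) by blast
    have C: "0 \<le> C\<^sub>\<mu> ^ n / \<delta>"
    proof -
      have "space M \<noteq> {}" using h unfolding homogeneous_type_def by (elim conjE)
      then obtain z where "z \<in> space M" by blast
      then show ?thesis using qball_doubling(1)[OF h, of z 1] \<delta> by simp
    qed
    have c0: "0 \<le> c" using C c by simp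
    have \<alpha>0: "0 \<le> \<alpha> v" for v by (simp add: \<alpha>_def)
    have car: "carleson S' (measure (wmeasure M v)) (c * \<alpha> v) (measure (wmeasure M v))"
      if v: "v \<in> A_infty M d D" for v
      unfolding carleson_def
    proof
      fix Q assume Q: "Q \<in> S'"
      have "carleson S' (measure (wmeasure M v)) (C\<^sub>\<mu> ^ n / \<delta> * \<alpha> v) (measure (wmeasure M v))"
        using carleson_subset[OF carleson_A_infty[OF h D v n S sp \<delta>] S'(1) S(1)] by (simp add: \<alpha>_def)
      then have "(\<Sum>R\<in>{R\<in>S'. R \<subseteq> Q}. measure (wmeasure M v) R) \<le> C\<^sub>\<mu> ^ n / \<delta> * \<alpha> v * measure (wmeasure M v) Q"
        using Q by (auto simp: carleson_def)
      also have "\<dots> \<le> c * \<alpha> v * measure (wmeasure M v) Q"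
        using c \<alpha>0 by (intro mult_right_mono) auto
      finally show "(\<Sum>R\<in>{R\<in>S'. R \<subseteq> Q}. measure (wmeasure M v) R) \<le> c * \<alpha> v * measure (wmeasure M v) Q" .
    qed
    have sys: "sparse_system S' I \<mu> V (1 / \<delta>)"
      unfolding sparse_system_def
    proof (intro conjI ballI)
      show "finite S'" "laminar S'" by fact+
      show "{} \<notin> S'" using \<mu>Q(1)[of "{}"] S'(1) by auto
      show "0 < \<mu> Q" if "Q \<in> S'" for Q using \<mu>_eq(2) that S'(1) by blast
      show "0 < V i Q" if "i \<in> I" "Q \<in> S'" for i Q using V_eq(2) that S'(1) by blast
      have "carleson S \<mu> (1 / \<delta>) \<mu>"
        unfolding \<mu>_def using S Q_meas \<mu>Q sp \<delta> by (intro carleson_sparse) auto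
      then show "carleson S' \<mu> (1 / \<delta>) \<mu>"
        using carleson_subset[OF _ S'(1) S(1)] \<mu>_eq(2) by (simp add: less_imp_le)
      show "superadditive S' (V i)" if "i \<in> I" for i
        unfolding V_def using that S' Q_meas V_eq(1)
        by (intro superadditive_measure) (auto simp: wmeasure_def V_def subset_eq)
    qed
    have NP: "(\<Sum>F\<in>principal_sets T (dyadic_level T (a i)). 2 powr (s i * dyadic_level T (a i) F) * V i F) \<le> N i"
      if i: "i \<in> I" and T: "T \<subseteq> S'" for i T
    proof -
      have "ennreal (\<Sum>F\<in>principal_sets T (dyadic_level T (a i)). 2 powr (s i * dyadic_level T (a i) F) * V i F) \<le>
          ennreal (principal_const (s i)) *
            (\<integral>\<^sup>+x. ennreal (g i x powr s i) \<partial>wmeasure M (\<sigma> i))"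
        unfolding V_def
      proof (rule principal_powr_le)
        show "finite T" "laminar T" using T S'(2) finite_subset laminar_subset[OF lam T] by auto
        show "T \<subseteq> sets (wmeasure M (\<sigma> i))" using T S'(1) Q_meas by (auto simp: wmeasure_def)
        show "emeasure (wmeasure M (\<sigma> i)) Q < \<infinity>" if "Q \<in> T" for Q
          using V_eq(1)[OF i, of Q] that T S'(1) by auto
        show "\<forall>Q\<in>T. 0 < a i Q" using T i by (auto simp: S'_def)
        show "ennreal (a i Q * measure (wmeasure M (\<sigma> i)) Q) = (\<integral>\<^sup>+x\<in>Q. ennreal (g i x) \<partial>wmeasure M (\<sigma> i))"
          if "Q \<in> T" for Q
        proof -
          have Q: "Q \<in> S" using that T S'(1) by blast
          show ?thesis unfolding g_int[OF i Q] J_fin[OF i Q] by (simp add: V_def)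
        qed
      qed (use g_meas[OF i] g0 si[OF i] in auto)
      also have "\<dots> = ennreal (N i)"
        using F(2)[of i] i principal_const_pos[OF si[OF i]]
        unfolding g_powr[OF i] N_def by (subst ennreal_mult[symmetric]) (auto simp: I_def)
      finally show ?thesis using N0[OF i] by simp
    qed
    have KQ: "measure U Q / \<mu> Q * (\<Prod>i\<in>I. (V i Q / \<mu> Q) powr (t * (1 - 1 / s i))) \<le> K" if Q: "Q \<in> S" for Q
    proof -
      have e: "t / conj_exponent (s i) = t * (1 - 1 / s i)" "t * (1 - 1 / s i) \<noteq> 0" if "i \<in> I" for i
        using si[OF that] exps(2) p0 by (auto simp: conj_exponent_def t_def field_simps)
      have "avg M (\<lambda>x. ennreal (u x)) Q = ennreal (measure U Q / \<mu> Q)"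
        unfolding avg_def U_eq(3)[OF Q] using \<mu>_eq[OF Q] U_eq(2)[OF Q] by (simp add: divide_ennreal)
      moreover have "(\<Prod>i=1..m. avg M (\<lambda>x. ennreal (\<sigma> i x)) Q powr\<^sub>\<infinity> (t / conj_exponent (s i))) =
          ennreal (\<Prod>i\<in>I. (V i Q / \<mu> Q) powr (t * (1 - 1 / s i)))"
      proof -
        have "avg M (\<lambda>x. ennreal (\<sigma> i x)) Q powr\<^sub>\<infinity> (t / conj_exponent (s i)) =
            ennreal ((V i Q / \<mu> Q) powr (t * (1 - 1 / s i)))" if i: "i \<in> I" for i
          unfolding avg_def V_eq(3)[OF i Q] e(1)[OF i] using \<mu>_eq[OF Q] V_eq(2)[OF i Q]
          by (simp add: divide_ennreal epowr_ennreal_pos)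
        then show ?thesis unfolding I_def by (subst prod_ennreal[symmetric]) (auto intro!: prod.cong)
      qed
      moreover have "avg M (\<lambda>x. ennreal (u x)) Q *
          (\<Prod>i=1..m. avg M (\<lambda>x. ennreal (\<sigma> i x)) Q powr\<^sub>\<infinity> (t / conj_exponent (s i))) \<le> A_star M D m s t u \<sigma>"
        unfolding A_star_def using cube[OF Q] by (intro SUP_upper)
      moreover have "A_star M D m s t u \<sigma> = ennreal K"
        using Astar by (simp add: K_def s_def[abs_def] t_def)
      ultimately have "ennreal (measure U Q / \<mu> Q * (\<Prod>i\<in>I. (V i Q / \<mu> Q) powr (t * (1 - 1 / s i)))) \<le> ennreal K"
        by (subst ennreal_mult) (auto simp: \<mu>_def prod_nonneg)
      then show ?thesis by (subst (asm) ennreal_le_iff) (auto simp: K_def)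
    qed
    have "sparse_data I s t (1 / \<delta>) S' U \<mu> V a K (\<lambda>i. c * \<alpha> (\<sigma> i)) (c * \<alpha> u) N"
      unfolding sparse_data_def
    proof (intro conjI ballI allI impI)
      show "carleson S' (V i) (c * \<alpha> (\<sigma> i)) (V i)" if "i \<in> I" for i
        unfolding V_def using \<sigma> that by (intro car) (auto simp: I_def)
      show "carleson S' (measure U) (c * \<alpha> u) (measure U)" unfolding U_def by (rule car[OF u])
      show "Q \<in> sets U" if "Q \<in> S'" for Q using Q_meas that S'(1) by (auto simp: U_def wmeasure_def)
      show "0 < emeasure U Q" "emeasure U Q < \<infinity>" if "Q \<in> S'" for Q
        using U_eq[of Q] that S'(1) by auto
      show "0 < a i Q" if "i \<in> I" "Q \<in> S'" for i Q using that by (auto simp: S'_def)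
      show "0 \<le> K" by (simp add: K_def)
    qed (use sys c0 \<alpha>0 NP KQ S'(1) in auto)
    moreover have "1 / t \<le> (\<Sum>i\<in>I. 1 / s i)"
    proof -
      have "1 / q \<le> (\<Sum>i=1..m. 1 / p i)" using exps(5) \<eta> by simp
      then have "p\<^sub>0 * (1 / q) \<le> p\<^sub>0 * (\<Sum>i=1..m. 1 / p i)" using p0 by (intro mult_left_mono) auto
      then show ?thesis by (simp add: sum_distrib_left t_def s_def I_def)
    qed
    ultimately show ?thesis
      using sparse_estimate[of I s r t "1 / \<delta>" S' U \<mu> V a K "\<lambda>i. c * \<alpha> (\<sigma> i)" "c * \<alpha> u" N]
        si m p0 exps(1,2) \<delta>
      by (simp add: k_def r_def t_def I_def)
  qed
  finally show ?thesis
    using p0 by (simp add: U_def K_def s_def[abs_def] t_def r_def I_def \<alpha>_def N_def)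
qed

theorem theorem1p17:
  fixes M :: "'a measure" and d :: "'a \<Rightarrow> 'a \<Rightarrow> real"
    and A\<^sub>0 C\<^sub>\<mu> \<delta>\<^sub>0 a\<^sub>1 A\<^sub>1 \<delta> \<gamma> \<eta> q p\<^sub>0 :: real
    and m :: nat and p :: "nat \<Rightarrow> real"
  assumes "homogeneous_type M d A\<^sub>0 C\<^sub>\<mu>"
    and "0 < \<delta>" and "\<delta> < 1"
    and "0 < \<gamma>" and "0 < q"
    and "1 \<le> p\<^sub>0" and "\<And>i. i \<in> {1..m} \<Longrightarrow> p\<^sub>0 < p i"
    and "\<eta> = (\<Sum>i=1..m. 1 / p i) - 1 / q"
    and "0 \<le> \<eta>" and "\<eta> < real m"
    and "p\<^sub>0 \<le> \<gamma> \<or> (\<gamma> < p\<^sub>0 \<and> \<gamma> < q)"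
  shows "\<exists>C::real. 0 < C \<and>
    (\<forall>D u \<sigma> \<omega>.
       dyadic_lattice M d \<delta>\<^sub>0 a\<^sub>1 A\<^sub>1 D \<longrightarrow>
       weight M d u \<longrightarrow> (\<forall>i\<in>{1..m}. weight M d (\<sigma> i)) \<longrightarrow>
       A_star M D m (\<lambda>i. p i / p\<^sub>0) (q / p\<^sub>0) u \<sigma> < \<infinity> \<longrightarrow>
       u \<in> A_infty M d D \<longrightarrow> (\<forall>i\<in>{1..m}. \<sigma> i \<in> A_infty M d D) \<longrightarrow>
       (\<forall>i\<in>{1..m}. \<omega> i = (\<lambda>x. \<sigma> i x powr (1 - p i / p\<^sub>0))) \<longrightarrow>
       (SUP S\<in>{S. S \<subseteq> cubes D \<and> sparse_family M \<delta> S}.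
          op_norm M m p q \<omega> u (sparse_op M m \<eta> S p\<^sub>0 \<gamma>))
       \<le> ennreal C * A_star M D m (\<lambda>i. p i / p\<^sub>0) (q / p\<^sub>0) u \<sigma> powr\<^sub>\<infinity> (1 / q) *
         ((\<Prod>i=1..m. A_infty_const M d D (\<sigma> i) powr\<^sub>\<infinity> (1 / p i)) +
          A_infty_const M d D u powr\<^sub>\<infinity> max (1 / \<gamma> - 1 / q) 0 *
          (\<Sum>j=1..m. \<Prod>i\<in>{1..m} - {j}. A_infty_const M d D (\<sigma> i) powr\<^sub>\<infinity> (1 / p i))))"
proof -
  have p0: "0 < p\<^sub>0" using assms(6) by simp
  have pi: "0 < p i" "p\<^sub>0 < p i" if "i \<in> {1..m}" for i using assms(7)[OF that] p0 by auto
  have m: "0 < m" using assms(9,10) by simp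
  have h: "homogeneous_type M d A\<^sub>0 C\<^sub>\<mu>" by fact
  define C\<^sub>1 where "C\<^sub>1 = sparse_const {1..m} (\<lambda>i. p i / p\<^sub>0) (\<gamma> / p\<^sub>0) (q / p\<^sub>0) (1 / \<delta>)"
  have C1: "0 < C\<^sub>1" using p0 assms(4) by (simp add: C\<^sub>1_def sparse_const_pos)
  obtain n :: nat where n: "0 < a\<^sub>1 \<longrightarrow> A\<^sub>1 \<le> a\<^sub>1 * 2 ^ n"
  proof -
    obtain n :: nat where "A\<^sub>1 / a\<^sub>1 < 2 ^ n" using real_arch_pow[of 2] by auto
    then have "0 < a\<^sub>1 \<longrightarrow> A\<^sub>1 \<le> a\<^sub>1 * 2 ^ n" by (auto simp: field_simps)
    then show ?thesis using that by blast
  qed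
  \<comment> \<open>the ratio between Carleson and \<open>A\<^sub>\<infinity>\<close> constants, made at least 1 so that its powers can be merged\<close>
  define c where "c = max 1 (C\<^sub>\<mu> ^ n / \<delta>)"
  define c\<^sub>P where "c\<^sub>P i = principal_const (p i / p\<^sub>0)" for i
  define e\<^sub>0 where "e\<^sub>0 = max (1 - \<gamma> / q) 0"
  define c\<^sub>2 where "c\<^sub>2 = (2 * (1 + card {1..m})) powr (1 / \<gamma>) * c powr (1 / \<gamma> * (e\<^sub>0 + (\<Sum>i=1..m. \<gamma> / p i)))"
  define C where "C = C\<^sub>1 powr (1 / q) * c\<^sub>2 * (\<Prod>i=1..m. c\<^sub>P i powr (1 / p i))"
  have cP: "0 < c\<^sub>P i" if "i \<in> {1..m}" for i
    unfolding c\<^sub>P_def using pi[OF that] p0 by (intro principal_const_pos) simp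
  have c: "1 \<le> c" "C\<^sub>\<mu> ^ n / \<delta> \<le> c" by (auto simp: c_def)
  have c2: "0 < c\<^sub>2" using c by (auto simp: c\<^sub>2_def)
  have C: "0 < C" unfolding C_def using C1 c2 cP
    by (intro mult_pos_pos prod_pos) (auto simp: less_imp_neq[THEN not_sym])
  show ?thesis
  proof (intro exI[of _ C] conjI allI impI C)
    fix D u \<sigma> \<omega>
    assume D: "dyadic_lattice M d \<delta>\<^sub>0 a\<^sub>1 A\<^sub>1 D"
      and Astar: "A_star M D m (\<lambda>i. p i / p\<^sub>0) (q / p\<^sub>0) u \<sigma> < \<infinity>"
      and u: "u \<in> A_infty M d D" and \<sigma>: "\<forall>i\<in>{1..m}. \<sigma> i \<in> A_infty M d D"
      and \<omega>: "\<forall>i\<in>{1..m}. \<omega> i = (\<lambda>x. \<sigma> i x powr (1 - p i / p\<^sub>0))"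
    define K where "K = A_star M D m (\<lambda>i. p i / p\<^sub>0) (q / p\<^sub>0) u \<sigma>"
    define \<alpha> where "\<alpha> v = A_infty_const M d D v" for v
    define B where "B = (\<Prod>i=1..m. \<alpha> (\<sigma> i) powr\<^sub>\<infinity> (1 / p i)) + \<alpha> u powr\<^sub>\<infinity> max (1 / \<gamma> - 1 / q) 0 *
        (\<Sum>j=1..m. \<Prod>i\<in>{1..m} - {j}. \<alpha> (\<sigma> i) powr\<^sub>\<infinity> (1 / p i))"
    have "0 < a\<^sub>1" using D unfolding dyadic_lattice_def by (elim conjE)
    then have nA: "A\<^sub>1 \<le> a\<^sub>1 * 2 ^ n" using n by simp
    have \<alpha>_fin: "ennreal (enn2real (\<alpha> v)) = \<alpha> v" if "v \<in> A_infty M d D" for v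
      using that by (simp add: A_infty_def \<alpha>_def)
    have K_fin: "ennreal (enn2real K) = K" using Astar by (simp add: K_def)
    define R where "R = A_infty_factor {1..m} (\<lambda>i. \<gamma> / p i) e\<^sub>0
        (\<lambda>i. c * enn2real (\<alpha> (\<sigma> i))) (c * enn2real (\<alpha> u))"
    have R0: "0 \<le> R" unfolding R_def by (rule A_infty_factor_nonneg)
    have R_le: "ennreal (R powr (1 / \<gamma>)) \<le> ennreal c\<^sub>2 * B"
    proof -
      have e: "\<gamma> / p i * (1 / \<gamma>) = 1 / p i" "e\<^sub>0 * (1 / \<gamma>) = max (1 / \<gamma> - 1 / q) 0" for i
      proof -
        show "\<gamma> / p i * (1 / \<gamma>) = 1 / p i" using assms(4) by simp
        have "max (1 - \<gamma> / q) 0 * (1 / \<gamma>) = max ((1 - \<gamma> / q) * (1 / \<gamma>)) (0 * (1 / \<gamma>))"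
          using assms(4) by (intro max_mult_distrib_right[THEN trans]) simp
        also have "(1 - \<gamma> / q) * (1 / \<gamma>) = 1 / \<gamma> - 1 / q" using assms(4,5) by (simp add: field_simps)
        finally show "e\<^sub>0 * (1 / \<gamma>) = max (1 / \<gamma> - 1 / q) 0" by (simp add: e\<^sub>0_def)
      qed
      have "R powr (1 / \<gamma>) \<le> c\<^sub>2 * A_infty_factor {1..m} (\<lambda>i. 1 / p i) (max (1 / \<gamma> - 1 / q) 0)
          (\<lambda>i. enn2real (\<alpha> (\<sigma> i))) (enn2real (\<alpha> u))"
        using A_infty_factor_powr_le[of "{1..m}" "\<lambda>i. \<gamma> / p i" e\<^sub>0 "1 / \<gamma>" c
            "\<lambda>i. enn2real (\<alpha> (\<sigma> i))" "enn2real (\<alpha> u)"] pi assms(4) c(1)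
        unfolding R_def c\<^sub>2_def e by (simp add: e\<^sub>0_def)
      then have "ennreal (R powr (1 / \<gamma>)) \<le>
          ennreal c\<^sub>2 * ennreal (A_infty_factor {1..m} (\<lambda>i. 1 / p i) (max (1 / \<gamma> - 1 / q) 0)
          (\<lambda>i. enn2real (\<alpha> (\<sigma> i))) (enn2real (\<alpha> u)))"
        using c2 A_infty_factor_nonneg by (subst ennreal_mult[symmetric]) (auto intro: ennreal_leI)
      also have "ennreal (A_infty_factor {1..m} (\<lambda>i. 1 / p i) (max (1 / \<gamma> - 1 / q) 0)
          (\<lambda>i. enn2real (\<alpha> (\<sigma> i))) (enn2real (\<alpha> u))) \<le> B"
      proof -
        have prod_eq: "ennreal (\<Prod>i\<in>J. enn2real (\<alpha> (\<sigma> i)) powr (1 / p i)) = (\<Prod>i\<in>J. \<alpha> (\<sigma> i) powr\<^sub>\<infinity> (1 / p i))"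
          if J: "J \<subseteq> {1..m}" for J
        proof (subst prod_ennreal[symmetric])
          show "(\<Prod>i\<in>J. ennreal (enn2real (\<alpha> (\<sigma> i)) powr (1 / p i))) = (\<Prod>i\<in>J. \<alpha> (\<sigma> i) powr\<^sub>\<infinity> (1 / p i))"
          proof (rule prod.cong[OF refl])
            fix i assume "i \<in> J"
            then have i: "i \<in> {1..m}" using J by blast
            have "\<sigma> i \<in> A_infty M d D" using \<sigma> i by (rule bspec)
            then have "\<alpha> (\<sigma> i) powr\<^sub>\<infinity> (1 / p i) = ennreal (enn2real (\<alpha> (\<sigma> i))) powr\<^sub>\<infinity> (1 / p i)"
              using \<alpha>_fin by simp
            then show "ennreal (enn2real (\<alpha> (\<sigma> i)) powr (1 / p i)) = \<alpha> (\<sigma> i) powr\<^sub>\<infinity> (1 / p i)"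
              using pi(1)[OF i] by (simp add: epowr_ennreal)
          qed
        qed simp
        have sum_eq: "ennreal (\<Sum>j=1..m. \<Prod>i\<in>{1..m} - {j}. enn2real (\<alpha> (\<sigma> i)) powr (1 / p i)) =
            (\<Sum>j=1..m. \<Prod>i\<in>{1..m} - {j}. \<alpha> (\<sigma> i) powr\<^sub>\<infinity> (1 / p i))"
          using prod_eq by (subst sum_ennreal[symmetric]) (auto simp: prod_nonneg)
        have "ennreal (enn2real (\<alpha> u) powr max (1 / \<gamma> - 1 / q) 0) \<le> \<alpha> u powr\<^sub>\<infinity> max (1 / \<gamma> - 1 / q) 0"
          using ennreal_powr_le_epowr[of "enn2real (\<alpha> u)"] \<alpha>_fin[OF u] by simp
        then have "ennreal (enn2real (\<alpha> u) powr max (1 / \<gamma> - 1 / q) 0) *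
            (\<Sum>j=1..m. \<Prod>i\<in>{1..m} - {j}. \<alpha> (\<sigma> i) powr\<^sub>\<infinity> (1 / p i)) \<le>
            \<alpha> u powr\<^sub>\<infinity> max (1 / \<gamma> - 1 / q) 0 *
            (\<Sum>j=1..m. \<Prod>i\<in>{1..m} - {j}. \<alpha> (\<sigma> i) powr\<^sub>\<infinity> (1 / p i))"
          by (intro mult_right_mono) auto
        moreover have "ennreal (A_infty_factor {1..m} (\<lambda>i. 1 / p i) (max (1 / \<gamma> - 1 / q) 0)
            (\<lambda>i. enn2real (\<alpha> (\<sigma> i))) (enn2real (\<alpha> u))) =
            (\<Prod>i=1..m. \<alpha> (\<sigma> i) powr\<^sub>\<infinity> (1 / p i)) +
            ennreal (enn2real (\<alpha> u) powr max (1 / \<gamma> - 1 / q) 0) *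
            (\<Sum>j=1..m. \<Prod>i\<in>{1..m} - {j}. \<alpha> (\<sigma> i) powr\<^sub>\<infinity> (1 / p i))"
          unfolding prod_eq[OF subset_refl, symmetric] sum_eq[symmetric] A_infty_factor_def
          by (simp add: ennreal_mult prod_nonneg sum_nonneg)
        ultimately show ?thesis unfolding B_def by (simp only: add_left_mono)
      qed
      finally show ?thesis by (simp add: mult_left_mono)
    qed
    have main: "Lp_norm (wmeasure M u) q (sparse_op M m \<eta> S p\<^sub>0 \<gamma> f) \<le>
        ennreal C * K powr\<^sub>\<infinity> (1 / q) * B *
        (\<Prod>i=1..m. Lp_norm (wmeasure M (\<omega> i)) (p i) (\<lambda>x. ennreal (norm (f i x))))"
      if S: "S \<subseteq> cubes D" and sp: "sparse_family M \<delta> S"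
        and f: "\<forall>i\<in>{1..m}. f i \<in> Lp_space (wmeasure M (\<omega> i)) (p i)" for S f
    proof -
      define I\<^sub>f where "I\<^sub>f i = (\<integral>\<^sup>+x. ennreal (norm (f i x) powr p i) \<partial>wmeasure M (\<omega> i))" for i
      define F where "F i = enn2real (I\<^sub>f i)" for i
      define z where "z = C\<^sub>1 * enn2real K * R powr (q / \<gamma>) * (\<Prod>i=1..m. (c\<^sub>P i * F i) powr (q / p i))"
      have F0: "0 \<le> F i" for i by (simp add: F_def)
      have norm_eq: "Lp_norm (wmeasure M (\<omega> i)) (p i) (\<lambda>x. ennreal (norm (f i x))) = I\<^sub>f i powr\<^sub>\<infinity> (1 / p i)"
        if i: "i \<in> {1..m}" for i
        unfolding Lp_norm_def I\<^sub>f_def using pi(1)[OF i] by (simp add: epowr_ennreal)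
      have IF: "I\<^sub>f i = ennreal (F i)" if i: "i \<in> {1..m}" for i
      proof -
        have "I\<^sub>f i powr\<^sub>\<infinity> (1 / p i) < \<infinity>"
          using bspec[OF f i] unfolding norm_eq[OF i, symmetric] Lp_space_def by simp
        then have "I\<^sub>f i \<noteq> \<infinity>" using pi(1)[OF i] by (auto simp: epowr_def)
        then show ?thesis by (simp add: F_def top.not_eq_extremum)
      qed
      have f_meas: "f i \<in> borel_measurable M" if "i \<in> {1..m}" for i
        using f that by (auto simp: Lp_space_def wmeasure_def)
      have "(\<integral>\<^sup>+x. (\<Sum>\<^sub>\<infinity>Q\<in>S. sparse_term M m \<eta> p\<^sub>0 f Q powr\<^sub>\<infinity> \<gamma> * indicator Q x) powr\<^sub>\<infinity> (q / \<gamma>) \<partial>wmeasure M u) \<le> ennreal z"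
      proof (rule nn_integral_epowr_infsum_le)
        show "countable S" using countable_cubes[OF D] S countable_subset by blast
        show "0 < q / \<gamma>" using assms(4,5) by simp
        show "(\<lambda>x. sparse_term M m \<eta> p\<^sub>0 f Q powr\<^sub>\<infinity> \<gamma> * indicator Q x) \<in> borel_measurable (wmeasure M u)" if "Q \<in> S" for Q
        proof -
          have "Q \<in> sets M" using cube_in_ball[OF h D _ nA] S that by (metis subsetD)
          then show ?thesis by (simp add: wmeasure_def)
        qed
        fix G assume G: "finite G" "G \<subseteq> S"
        show "(\<integral>\<^sup>+x. (\<Sum>Q\<in>G. sparse_term M m \<eta> p\<^sub>0 f Q powr\<^sub>\<infinity> \<gamma> * indicator Q x) powr\<^sub>\<infinity> (q / \<gamma>) \<partial>wmeasure M u) \<le> ennreal z"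
          unfolding z_def R_def K_def \<alpha>_def e\<^sub>0_def c\<^sub>P_def C\<^sub>1_def
        proof (rule finite_sparse_family_estimate[OF h D nA assms(2,4,5,6,7,8) m assms(9) u _ Astar f_meas])
          show "\<sigma> i \<in> A_infty M d D" if "i \<in> {1..m}" for i using \<sigma> that by (rule bspec)
          show "(\<integral>\<^sup>+x. ennreal (norm (f i x) powr p i) \<partial>wmeasure M (\<lambda>x. \<sigma> i x powr (1 - p i / p\<^sub>0))) = ennreal (F i)"
            if i: "i \<in> {1..m}" for i
            using IF[OF i] bspec[OF \<omega> i] unfolding I\<^sub>f_def by simp
          show "G \<subseteq> cubes D" using G(2) S by blast
          show "sparse_family M \<delta> G"
            using sp G(2) unfolding sparse_family_def by (meson disjoint_family_on_mono subsetD)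
        qed (assumption | rule G(1) F0 c(2))+
      qed
      moreover have "Lp_norm (wmeasure M u) q (sparse_op M m \<eta> S p\<^sub>0 \<gamma> f) =
          (\<integral>\<^sup>+x. (\<Sum>\<^sub>\<infinity>Q\<in>S. sparse_term M m \<eta> p\<^sub>0 f Q powr\<^sub>\<infinity> \<gamma> * indicator Q x) powr\<^sub>\<infinity> (q / \<gamma>) \<partial>wmeasure M u) powr\<^sub>\<infinity> (1 / q)"
        unfolding Lp_norm_def sparse_op_def sparse_term_def using assms(4,5) by (simp add: epowr_epowr)
      ultimately have "Lp_norm (wmeasure M u) q (sparse_op M m \<eta> S p\<^sub>0 \<gamma> f) \<le> ennreal z powr\<^sub>\<infinity> (1 / q)"
        using assms(5) by (simp add: epowr_mono)
      also have "\<dots> = ennreal (z powr (1 / q))"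
        using assms(5) C1 by (subst epowr_ennreal) (auto simp: z_def intro!: mult_nonneg_nonneg prod_nonneg)
      also have "z powr (1 / q) = (C\<^sub>1 powr (1 / q) * (\<Prod>i=1..m. c\<^sub>P i powr (1 / p i))) * enn2real K powr (1 / q) *
          R powr (1 / \<gamma>) * (\<Prod>i=1..m. F i powr (1 / p i))"
      proof -
        have "z powr (1 / q) = C\<^sub>1 powr (1 / q) * enn2real K powr (1 / q) * (R powr (q / \<gamma>)) powr (1 / q) *
            (\<Prod>i=1..m. ((c\<^sub>P i * F i) powr (q / p i)) powr (1 / q))"
          unfolding z_def using C1 by (simp add: powr_mult prod_nonneg prod_powr_distrib)
        also have "(R powr (q / \<gamma>)) powr (1 / q) = R powr (1 / \<gamma>)"
          using assms(5) by (simp add: powr_powr)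
        also have "(\<Prod>i=1..m. ((c\<^sub>P i * F i) powr (q / p i)) powr (1 / q)) =
            (\<Prod>i=1..m. c\<^sub>P i powr (1 / p i) * F i powr (1 / p i))"
        proof (rule prod.cong[OF refl])
          fix i assume "i \<in> {1..m}"
          then show "((c\<^sub>P i * F i) powr (q / p i)) powr (1 / q) = c\<^sub>P i powr (1 / p i) * F i powr (1 / p i)"
            using cP[of i] F0[of i] assms(5) by (simp add: powr_powr powr_mult)
        qed
        finally show ?thesis by (simp add: prod.distrib mult_ac)
      qed
      also have "ennreal ((C\<^sub>1 powr (1 / q) * (\<Prod>i=1..m. c\<^sub>P i powr (1 / p i))) * enn2real K powr (1 / q) *
          R powr (1 / \<gamma>) * (\<Prod>i=1..m. F i powr (1 / p i))) =
          ennreal (C\<^sub>1 powr (1 / q) * (\<Prod>i=1..m. c\<^sub>P i powr (1 / p i))) * K powr\<^sub>\<infinity> (1 / q) *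
          ennreal (R powr (1 / \<gamma>)) * (\<Prod>i=1..m. I\<^sub>f i powr\<^sub>\<infinity> (1 / p i))"
      proof -
        have "K powr\<^sub>\<infinity> (1 / q) = ennreal (enn2real K powr (1 / q))"
          using epowr_ennreal[of "enn2real K" "1 / q"] K_fin assms(5) by simp
        moreover have "(\<Prod>i=1..m. I\<^sub>f i powr\<^sub>\<infinity> (1 / p i)) = ennreal (\<Prod>i=1..m. F i powr (1 / p i))"
        proof -
          have "I\<^sub>f i powr\<^sub>\<infinity> (1 / p i) = ennreal (F i powr (1 / p i))" if i: "i \<in> {1..m}" for i
            unfolding IF[OF i] using F0 pi(1)[OF i] by (simp add: epowr_ennreal)
          then show ?thesis by (subst prod_ennreal[symmetric]) (auto intro!: prod.cong)
        qed
        ultimately show ?thesis by (simp add: ennreal_mult prod_nonneg)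
      qed
      also have "\<dots> \<le> ennreal (C\<^sub>1 powr (1 / q) * (\<Prod>i=1..m. c\<^sub>P i powr (1 / p i))) * K powr\<^sub>\<infinity> (1 / q) *
          (ennreal c\<^sub>2 * B) * (\<Prod>i=1..m. I\<^sub>f i powr\<^sub>\<infinity> (1 / p i))"
        by (intro mult_right_mono mult_left_mono R_le) auto
      also have "\<dots> = ennreal C * K powr\<^sub>\<infinity> (1 / q) * B * (\<Prod>i=1..m. I\<^sub>f i powr\<^sub>\<infinity> (1 / p i))"
        unfolding C_def using c2 by (simp add: ennreal_mult prod_nonneg mult_ac)
      also have "(\<Prod>i=1..m. I\<^sub>f i powr\<^sub>\<infinity> (1 / p i)) =
          (\<Prod>i=1..m. Lp_norm (wmeasure M (\<omega> i)) (p i) (\<lambda>x. ennreal (norm (f i x))))"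
        using norm_eq by (intro prod.cong) auto
      finally show ?thesis .
    qed
    have "(SUP S\<in>{S. S \<subseteq> cubes D \<and> sparse_family M \<delta> S}.
        op_norm M m p q \<omega> u (sparse_op M m \<eta> S p\<^sub>0 \<gamma>)) \<le> ennreal C * K powr\<^sub>\<infinity> (1 / q) * B"
      unfolding op_norm_def using main by (intro SUP_least Inf_lower) auto
    then show "(SUP S\<in>{S. S \<subseteq> cubes D \<and> sparse_family M \<delta> S}.
          op_norm M m p q \<omega> u (sparse_op M m \<eta> S p\<^sub>0 \<gamma>))
       \<le> ennreal C * A_star M D m (\<lambda>i. p i / p\<^sub>0) (q / p\<^sub>0) u \<sigma> powr\<^sub>\<infinity> (1 / q) *
         ((\<Prod>i=1..m. A_infty_const M d D (\<sigma> i) powr\<^sub>\<infinity> (1 / p i)) +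
          A_infty_const M d D u powr\<^sub>\<infinity> max (1 / \<gamma> - 1 / q) 0 *
          (\<Sum>j=1..m. \<Prod>i\<in>{1..m} - {j}. A_infty_const M d D (\<sigma> i) powr\<^sub>\<infinity> (1 / p i)))"
      by (simp add: K_def B_def \<alpha>_def)
  qed
qed

end
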